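(* Suppose the bounded-noise, strong convexity/smoothness and mixing assumptions (A1), (A2), (A3) of the context hold, and let the sequences $\{\mathbf{x}_t\}$, $\{\mathbf{q}_t\}$, $\{\mathbf{s}_t\}$ be generated by the algorithm SS_DSGT described in the context, with $p=\theta$. Then: (i) If $\bar\sigma^2=0$ and the step size is $\eta_t=\frac{\theta}{2^6\cdot 3\cdot L}$ for all $t$, then $$\mathbb{E}\left[\|\bar{x}_T-x^*\|^2+\frac{1}{8m}\Psi_T\right]\le \exp\left(-\frac{1}{2^7\cdot 3}\cdot\frac{\theta\mu}{L}\cdot T\right)\cdot\left(\|\bar{x}_0-x^*\|^2+\frac{1}{8m}\Psi_0\right).$$ (ii) If $\bar\sigma^2>0$, set $$\eta_t=\frac{6\beta}{L+\beta\mu t},\qquad \omega_t=\frac{\eta_t}{\eta_0}\exp\left(\frac{\mu}{2}\sum_{i=0}^t\eta_i\right),\qquad \beta=\frac{\theta}{2^7\cdot 3^2},$$ and $S_T=\sum_{t=0}^T\omega_t$. Then for $T\ge 1$ $$\frac{1}{S_T}\sum_{t=0}^T\omega_t\big(\mathbb{E}[f(\bar{x}_t)]-f(x^* )\big)\le \frac{24(L+\beta\mu(T+1))^2}{\beta^2\mu^3T^3}\cdot\frac{\bar\sigma^2}{m}+\frac{2^8\cdot 3^5\cdot L}{\mu^2\theta^2}\cdot\frac{\bar\sigma^2}{T^2}+\frac{2^{24}\cdot 3^6\cdot L^3}{\theta^3\mu^2}\cdot\frac{1}{T^3}\cdot\left(\|\bar{x}_0-x^*\|^2+\frac{\Ps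i_0}{8m}\right).$$
   Context: Problem: $m$ agents minimize $f(x)=\frac1m\sum_{i=1}^m f_i(x)$ over $x\in\mathbb{R}^d$, where $f_i(x)=\mathbb{E}_{\xi^{(i)}\sim\mathcal{D}^{(i)}}f_i(x,\xi^{(i)})$; $x^*$ is the minimizer of $f$. Stochastic gradients $\nabla f_i(x,\xi^{(i)})$ are unbiased for $\nabla f_i(x)$, and samples are independent across agents and iterations. Notation: for $\mathbf{x}\in\mathbb{R}^{m\times d}$ with rows $\mathbf{x}^{(i)}$, $\bar{x}=\frac1m\mathbf{1}^\top\mathbf{x}$ ($\mathbf 1$ the all-ones vector), $\boldsymbol{\Pi}=I_m-\frac{\mathbf{1}\mathbf{1}^\top}{m}$, $\nabla F(\mathbf{x})\in\mathbb{R}^{m\times d}$ has rows $\nabla f_i(\mathbf{x}^{(i)})$, and $\nabla F(\mathbf{x},\xi)$ with $\xi=(\xi^{(1)},\dots,\xi^{(m)})$ has rows $\nabla f_i(\mathbf{x}^{(i)},\xi^{(i)})$. $\mathbf{1}x^*$ is the matrix all of whose rows equal $x^*$. $\|\cdot\|$ is the Frobenius norm. Assumptions. (A1) For any $\mathbf{x}^{(i)}\in\mathbb{R}^d$, $i\in[m]$: $\frac1m\sum_{i=1}^m\mathbb{E}_{\xi^{(i)}}\|\nabla f_i(\mathbf{x}^{(i)},\xi^{(i)})-\nabla f_i(\mathbf{x}^{(i)})\|^2\le\bar\sigma^2$. (A2) Each $f_i:\mathbb{R}^d\to\mathbb{R}$ is $\mu$-strongly convex and $L$-smooth: $f_i(x)+\langle\nabla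 f_i(x),y-x\rangle+\frac{\mu}{2}\|x-y\|^2\le f_i(y)\le f_i(x)+\langle\nabla f_i(x),y-x\rangle+\frac L2\|x-y\|^2$ for all $x,y$. (A3) $W\in[0,1]^{m\times m}$ is a (possibly random) mixing matrix, symmetric and doubly stochastic, and for $\theta=1-\sqrt{\lambda_2(\mathbb{E}[W^\top W])}\in(0,1]$ ($\lambda_2$ = second largest eigenvalue), $\mathbb{E}_W\|W\mathbf{x}-\mathbf{1}\bar{x}\|^2\le(1-\theta)^2\|\mathbf{x}-\mathbf{1}\bar{x}\|^2$ for all $\mathbf{x}$. If $W$ is random, the matrix used at iteration $t$ is drawn independently of the past and of the current samples. Algorithm SS_DSGT: given $x_0\in\mathbb{R}^d$, $p$, step sizes $\eta_t>0$, set $\mathbf{x}_0=\mathbf{q}_0=\mathbf{1}x_0$, $\mathbf{s}_0^{(i)}=\nabla f_i(\mathbf{x}_0^{(i)},\xi_0^{(i)})$, $\tau=0$. For $t=0,1,2,\dots$: draw $\zeta_t\sim\mathrm{Bernoulli}(p)$ and samples $\xi_t=(\xi_t^{(1)},\dots,\xi_t^{(m)})$ ($\xi_0$ being the initialization sample); put $\mathbf{x}_{t+1}=W\big(\mathbf{x}_t-\eta_t(\mathbf{s}_t+\nabla F(\mathbf{x}_t,\xi_t)-\nabla F(\mathbf{q}_t,\xi_\tau))\big)$, $\mathbf{q}_{t+1}=\zeta_t\mathbf{x}_t+(1-\zeta_t)\mathbf{q}_t$, $\mathbf{s}_{t+1}=W\mathbf{s}_t+\zeta_t(\nabla F(\mathbf{x}_t,\xi_t)-\nabla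 F(\mathbf{q}_t,\xi_\tau))$; then set $\tau=t$ if $\zeta_t=1$ and leave $\tau$ unchanged otherwise. Lyapunov function: $\Psi_t=\|\boldsymbol{\Pi}\mathbf{x}_t\|^2+C_{1,t}\|\boldsymbol{\Pi}\mathbf{s}_t\|^2+C_{2,t}\|\nabla F(\mathbf{q}_t)-\nabla F(\mathbf{1}x^* )\|^2$ with $C_{1,t}=4\eta_t^2/\theta^2$, $C_{2,t}=2\eta_t/(L\theta)$. *)

theory Defs
  imports "HOL-Probability.Probability" "HOL-Computational_Algebra.Polynomial"
begin

text \<open>Agents are the elements of a finite type \<open>'m\<close>. An \<open>m \<times> d\<close> matrix with one row per agent is
  an element of type \<open>real^'d^'m\<close>; the norm of that type is the Frobenius norm, and \<open>vec v\<close> is the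
  matrix all of whose rows equal \<open>v\<close>. The random variables \<open>\<xi>\<^sup>(\<^sup>i\<^sup>)\<close> of agent \<open>i\<close> take values
  in the measure space \<open>D i\<close>.\<close>

definition row_mean :: "real^'d^'m \<Rightarrow> real^'d" where
  "row_mean x = (1 / real CARD('m)) *\<^sub>R (\<Sum>i\<in>UNIV. x $ i)"

definition centering :: "real^'m^'m" where
  "centering = mat 1 - (1 / real CARD('m)) *\<^sub>R vec (vec 1)"

definition average_objective :: "('m::finite \<Rightarrow> real^'d \<Rightarrow> real) \<Rightarrow> real^'d \<Rightarrow> real" where
  "average_objective f x = (1 / real CARD('m)) * (\<Sum>i\<in>UNIV. f i x)"

definition grad_rows :: "('m \<Rightarrow> real^'d \<Rightarrow> real^'d) \<Rightarrow> real^'d^'m \<Rightarrow> real^'d^'m" where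
  "grad_rows gf x = (\<chi> i. gf i (x $ i))"

definition sample_grad_rows ::
    "('m \<Rightarrow> real^'d \<Rightarrow> 's \<Rightarrow> real^'d) \<Rightarrow> real^'d^'m \<Rightarrow> ('m \<Rightarrow> 's) \<Rightarrow> real^'d^'m" where
  "sample_grad_rows g x z = (\<chi> i. g i (x $ i) (z i))"

text \<open>\<open>fs i x z\<close> and \<open>gs i x z\<close> are the sample loss of agent \<open>i\<close> and its gradient in \<open>x\<close>;
  \<open>f i\<close> and \<open>gf i\<close> are the expected loss and its gradient.\<close>

definition stochastic_objective ::
    "('m::finite \<Rightarrow> 's measure) \<Rightarrow> ('m \<Rightarrow> real^'d \<Rightarrow> 's \<Rightarrow> real) \<Rightarrow> ('m \<Rightarrow> real^'d \<Rightarrow> 's \<Rightarrow> real^'d) \<Rightarrow>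
     ('m \<Rightarrow> real^'d \<Rightarrow> real) \<Rightarrow> ('m \<Rightarrow> real^'d \<Rightarrow> real^'d) \<Rightarrow> bool" where
  "stochastic_objective D fs gs f gf \<longleftrightarrow>
     (\<forall>i. prob_space (D i)) \<and>
     (\<forall>i x. integrable (D i) (fs i x) \<and> f i x = (LINT z|D i. fs i x z)) \<and>
     (\<forall>i x. \<forall>z\<in>space (D i). GDERIV (\<lambda>y. fs i y z) x :> gs i x z) \<and>
     (\<forall>i x. GDERIV (f i) x :> gf i x) \<and>
     (\<forall>i. (\<lambda>(x, z). gs i x z) \<in> borel_measurable (borel \<Otimes>\<^sub>M D i)) \<and>
     (\<forall>i x. integrable (D i) (gs i x) \<and> (LINT z|D i. gs i x z) = gf i x)"

text \<open>Square integrability is part of the bound, because the Bochner integral of a non-integrable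
  function is \<open>0\<close>.\<close>

definition bounded_noise ::
    "('m::finite \<Rightarrow> 's measure) \<Rightarrow> ('m \<Rightarrow> real^'d \<Rightarrow> 's \<Rightarrow> real^'d) \<Rightarrow> ('m \<Rightarrow> real^'d \<Rightarrow> real^'d) \<Rightarrow>
     real \<Rightarrow> bool" where
  "bounded_noise D gs gf \<sigma> \<longleftrightarrow>
     (\<forall>i x. integrable (D i) (\<lambda>z. (norm (gs i x z - gf i x))\<^sup>2)) \<and>
     (\<forall>x :: real^'d^'m. (1 / real CARD('m)) *
        (\<Sum>i\<in>UNIV. LINT z|D i. (norm (gs i (x $ i) z - gf i (x $ i)))\<^sup>2) \<le> \<sigma>\<^sup>2)"

definition strongly_convex_smooth ::
    "real \<Rightarrow> real \<Rightarrow> (real^'d \<Rightarrow> real) \<Rightarrow> (real^'d \<Rightarrow> real^'d) \<Rightarrow> bool" where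
  "strongly_convex_smooth \<mu> L f g \<longleftrightarrow>
     (\<forall>x y. f x + g x \<bullet> (y - x) + \<mu> / 2 * (norm (x - y))\<^sup>2 \<le> f y \<and>
            f y \<le> f x + g x \<bullet> (y - x) + L / 2 * (norm (x - y))\<^sup>2)"

text \<open>The second largest eigenvalue counts multiplicities: it is the second entry of the
  decreasing list of roots of the characteristic polynomial. It is meaningful for real symmetric
  matrices of size at least two; the value for other arguments is irrelevant.\<close>

definition charpoly :: "real^'m^'m \<Rightarrow> real poly" where
  "charpoly A = det (\<chi> i j. (if i = j then [:0, 1:] else 0) - [:A $ i $ j:])"

definition second_eigenvalue :: "real^'m^'m \<Rightarrow> real" where
  "second_eigenvalue A = rev (sorted_list_of_multiset (proots (charpoly A))) ! 1"

definition doubly_stochastic :: "real^'m^'m \<Rightarrow> bool" where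
  "doubly_stochastic A \<longleftrightarrow>
     (\<forall>i j. A $ i $ j \<in> {0..1}) \<and>
     (\<forall>i. (\<Sum>j\<in>UNIV. A $ i $ j) = 1) \<and> (\<forall>j. (\<Sum>i\<in>UNIV. A $ i $ j) = 1)"

text \<open>\<open>MW\<close> is the law of the mixing matrix; a deterministic \<open>W\<close> is the case
  \<open>MW = return borel W\<close>.\<close>

definition mixing_law :: "(real^'m^'m) measure \<Rightarrow> bool" where
  "mixing_law MW \<longleftrightarrow>
     prob_space MW \<and> sets MW = sets borel \<and>
     (AE A in MW. transpose A = A \<and> doubly_stochastic A)"

text \<open>Samples, coins and mixing matrices have different value types, which \<open>indep_vars\<close> does not
  allow; their joint independence is stated through the \<open>\<sigma>\<close>-algebras that they generate.\<close>

datatype 'm draw = Sample nat 'm | Coin nat | Mixing nat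

definition generated_events :: "'w measure \<Rightarrow> 'a measure \<Rightarrow> ('w \<Rightarrow> 'a) \<Rightarrow> 'w set set" where
  "generated_events M N X = {X -` A \<inter> space M | A. A \<in> sets N}"

definition independent_draws ::
    "'w measure \<Rightarrow> ('m::finite \<Rightarrow> 's measure) \<Rightarrow> (real^'m^'m) measure \<Rightarrow> real \<Rightarrow>
     (nat \<Rightarrow> 'm \<Rightarrow> 'w \<Rightarrow> 's) \<Rightarrow> (nat \<Rightarrow> 'w \<Rightarrow> bool) \<Rightarrow> (nat \<Rightarrow> 'w \<Rightarrow> real^'m^'m) \<Rightarrow> bool" where
  "independent_draws M D MW p \<xi> \<zeta> W \<longleftrightarrow>
     (\<forall>t i. \<xi> t i \<in> measurable M (D i) \<and> distr M (D i) (\<xi> t i) = D i) \<and>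
     (\<forall>t. \<zeta> t \<in> measurable M (count_space UNIV) \<and>
          distr M (count_space UNIV) (\<zeta> t) = measure_pmf (bernoulli_pmf p)) \<and>
     (\<forall>t. W t \<in> borel_measurable M \<and> distr M borel (W t) = MW) \<and>
     prob_space.indep_sets M
       (\<lambda>d. case d of
              Sample t i \<Rightarrow> generated_events M (D i) (\<xi> t i)
            | Coin t \<Rightarrow> generated_events M (count_space UNIV) (\<zeta> t)
            | Mixing t \<Rightarrow> generated_events M borel (W t)) UNIV"

record ('m, 'd) ss_state =
  xvar :: "real^'d^'m"
  qvar :: "real^'d^'m"
  svar :: "real^'d^'m"
  tau :: nat

text \<open>One run of the algorithm for given realisations \<open>W\<close>, \<open>\<zeta>\<close>, \<open>\<xi>\<close> of all draws. The
  initialisation sample \<open>\<xi> 0\<close> is also the sample of iteration \<open>0\<close>.\<close>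

primrec ss_dsgt ::
    "('m::finite \<Rightarrow> real^'d::finite \<Rightarrow> 's \<Rightarrow> real^'d) \<Rightarrow> (nat \<Rightarrow> real) \<Rightarrow> real^'d \<Rightarrow>
     (nat \<Rightarrow> real^'m^'m) \<Rightarrow> (nat \<Rightarrow> bool) \<Rightarrow> (nat \<Rightarrow> 'm \<Rightarrow> 's) \<Rightarrow> nat \<Rightarrow> ('m, 'd) ss_state" where
  "ss_dsgt gs \<eta> x0 W \<zeta> \<xi> 0 =
     \<lparr>xvar = vec x0, qvar = vec x0, svar = sample_grad_rows gs (vec x0) (\<xi> 0), tau = 0\<rparr>"
| "ss_dsgt gs \<eta> x0 W \<zeta> \<xi> (Suc t) =
     (let st = ss_dsgt gs \<eta> x0 W \<zeta> \<xi> t;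
          \<Delta> = sample_grad_rows gs (xvar st) (\<xi> t) - sample_grad_rows gs (qvar st) (\<xi> (tau st))
      in \<lparr>xvar = W t ** (xvar st - \<eta> t *\<^sub>R (svar st + \<Delta>)),
          qvar = of_bool (\<zeta> t) *\<^sub>R xvar st + (1 - of_bool (\<zeta> t)) *\<^sub>R qvar st,
          svar = W t ** svar st + of_bool (\<zeta> t) *\<^sub>R \<Delta>,
          tau = (if \<zeta> t then t else tau st)\<rparr>)"

definition lyapunov ::
    "('m::finite \<Rightarrow> real^'d::finite \<Rightarrow> real^'d) \<Rightarrow> real^'d \<Rightarrow> real \<Rightarrow> real \<Rightarrow> real \<Rightarrow>
     ('m, 'd) ss_state \<Rightarrow> real" where
  "lyapunov gf xstar L \<theta> \<eta>t st =
     (norm (centering ** xvar st))\<^sup>2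
     + 4 * \<eta>t\<^sup>2 / \<theta>\<^sup>2 * (norm (centering ** svar st))\<^sup>2
     + 2 * \<eta>t / (L * \<theta>) * (norm (grad_rows gf (qvar st) - grad_rows gf (vec xstar)))\<^sup>2"

end

theory Submission
  imports Defs
begin

text \<open>
  Both rates come from one recursion for the expectation of
  \<open>\<Phi>\<^sub>t = \<parallel>x\<^sub>t - x\<^sup>*\<parallel>\<^sup>2 + \<kappa>\<^sub>t \<Psi>\<^sub>t\<close>, where the first term refers to the mean of the local iterates.

  Mixing preserves the mean of the rows, so the mean of the tracker is always the mean of the anchor
  gradient (\<open>AE_tracker_mean\<close>). The mean iterate therefore follows stochastic gradient descent with
  the mean of the \<open>m\<close> fresh gradients, each taken at a local iterate. The samples of an iteration
  are independent of the iterates and of each other, so the noise has mean zero and its variance is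
  divided by \<open>m\<close>; convexity at the local iterates and smoothness between them and their mean show
  that the price for the different evaluation points is proportional to the consensus error
  (\<open>opt_err_step\<close>).

  The three parts of \<open>\<Psi>\<close> contract by \<open>1 - \<theta>\<close> up to errors. The consensus error is contracted by the
  mixing and disturbed by the tracker and by the gradient increment, with a factor \<open>\<eta>\<^sup>2 / \<theta>\<close>
  (\<open>cons_err_step\<close>). The tracker is disturbed by the increment only when the coin shows a refresh,
  which happens with probability \<open>\<theta>\<close> (\<open>track_err_step\<close>); this is why the increment enters
  with the small weight \<open>2 * \<theta>\<close> and why the coin should have the bias \<open>\<theta>\<close>. The anchor is replaced
  by the current iterate with the same probability (\<open>anchor_gap_step\<close>). The increment itself is bounded by
  the gradient gaps at the iterate and at the anchor and by the noise at both points
  (\<open>increment_second_moment\<close>), and the gradient gap at the iterate by the consensus error and the objective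
  gap (\<open>grad_gap_le\<close>). For \<open>\<eta> L \<le> \<theta> / 192\<close> all errors fit into the contraction and into the decrease
  of the objective, which gives \<open>lyapunov_step\<close>:
  \<open>\<Phi>\<^sub>t\<^sub>+\<^sub>1 \<le> (1 - \<eta> \<mu> / 2) \<Phi>\<^sub>t - c \<eta> (objective gap) + \<eta>\<^sup>2 \<sigma>\<^sup>2 / m + 80 \<kappa> \<eta>\<^sup>2 m \<sigma>\<^sup>2 / \<theta>\<close>
  in expectation, whenever \<open>3 \<eta> L / \<theta> \<le> \<kappa> m\<close>; the constant \<open>c\<close> is positive if \<open>\<kappa> m \<le> 1 / 8\<close>.

  Without noise, \<open>\<kappa> = 1 / (8 m)\<close> and a constant step size give the linear rate. With noise, the last term
  would be of the same order \<open>\<eta>\<^sup>2\<close> as the unavoidable one but without the division by \<open>m\<close>. Taking the smallest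
  admissible weight \<open>\<kappa>\<^sub>t = 3 \<eta>\<^sub>t L / (\<theta> m)\<close> turns it into a term of order \<open>\<eta>\<^sup>3\<close>. For the step sizes
  \<open>\<eta>\<^sub>t = 6 / (\<mu> (a + t))\<close> with \<open>a = L / (\<beta> \<mu>)\<close> the averaging weights are comparable to
  \<open>(a + t)\<^sup>2 / a\<^sup>2\<close>, and summing the recursion with these weights (\<open>weighted_recursion\<close>,
  \<open>weighted_average_bound\<close>) yields the three terms of the sublinear bound.

  Expectations of quantities that involve a fresh draw are computed by Fubini's theorem: the state is
  measurable with respect to the \<open>\<sigma>\<close>-algebra of the earlier draws (\<open>state_known\<close>), hence independent of
  the new one (\<open>indep_pair_known\<close>), and the new draw can be integrated out with the state held fixed
  (\<open>indep_freezing\<close>, \<open>indep_uncorrelated\<close>). Square integrability of the state is part of the same induction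
  (\<open>state_square_integrable\<close>).
\<close>

section \<open>Mean rows and the centering matrix\<close>

lemma norm_sq_rows:
  fixes x :: "real^'d::finite^'m::finite"
  shows "(norm x)\<^sup>2 = (\<Sum>i\<in>UNIV. (norm (x $ i))\<^sup>2)"
  by (simp add: norm_vec_def L2_set_def sum_nonneg)

lemma row_mean_add: "row_mean (x + y) = row_mean x + row_mean y"
  by (simp add: row_mean_def sum.distrib scaleR_add_right)

lemma row_mean_diff: "row_mean (x - y) = row_mean x - row_mean y"
  by (simp add: row_mean_def sum_subtractf scaleR_diff_right)

lemma row_mean_scaleR: "row_mean (c *\<^sub>R x) = c *\<^sub>R row_mean x"
  by (simp add: row_mean_def flip: scaleR_sum_right)

lemma sum_rows_eq_row_mean:
  fixes x :: "real^'d^'m::finite"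
  shows "(\<Sum>i\<in>UNIV. x $ i) = real CARD('m) *\<^sub>R row_mean x"
  by (simp add: row_mean_def)

lemma row_mean_doubly_stochastic:
  fixes x :: "real^'d::finite^'m::finite"
  assumes "doubly_stochastic A"
  shows "row_mean (A ** x) = row_mean x"
proof -
  have "(\<Sum>i\<in>UNIV. (A ** x) $ i $ k) = (\<Sum>j\<in>UNIV. x $ j $ k)" for k
  proof -
    have "(\<Sum>i\<in>UNIV. (A ** x) $ i $ k) = (\<Sum>i\<in>UNIV. \<Sum>j\<in>UNIV. A $ i $ j * x $ j $ k)"
      by (simp add: matrix_matrix_mult_def)
    also have "\<dots> = (\<Sum>j\<in>UNIV. \<Sum>i\<in>UNIV. A $ i $ j * x $ j $ k)"
      by (rule sum.swap)
    also have "\<dots> = (\<Sum>j\<in>UNIV. (\<Sum>i\<in>UNIV. A $ i $ j) * x $ j $ k)"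
      by (simp add: sum_distrib_right)
    finally show ?thesis
      using assms by (simp add: doubly_stochastic_def)
  qed
  then show ?thesis
    by (simp add: row_mean_def vec_eq_iff)
qed

lemma centering_mult:
  fixes x :: "real^'d::finite^'m::finite"
  shows "centering ** x = x - vec (row_mean x)"
proof -
  have "(\<Sum>j\<in>UNIV. ((if i = j then 1 else 0) - 1 / real CARD('m)) * x $ j $ k)
      = x $ i $ k - (\<Sum>j\<in>UNIV. x $ j $ k) / real CARD('m)" for i k
    by (simp add: left_diff_distrib sum_subtractf if_distrib[of "\<lambda>c. c * _"] sum_divide_distrib
        cong: if_cong)
  then show ?thesis
    by (simp add: vec_eq_iff matrix_matrix_mult_def centering_def mat_def row_mean_def)
qed

lemma centering_add:
  fixes x y :: "real^'d::finite^'m::finite"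
  shows "centering ** (x + y) = centering ** x + centering ** y"
  by (simp add: matrix_add_ldistrib)

lemma centering_diff:
  fixes x y :: "real^'d::finite^'m::finite"
  shows "centering ** (x - y) = centering ** x - centering ** y"
  by (simp add: centering_mult row_mean_diff vec_eq_iff)

lemma centering_scaleR:
  fixes x :: "real^'d::finite^'m::finite"
  shows "centering ** (c *\<^sub>R x) = c *\<^sub>R (centering ** x)"
  by (simp add: centering_mult row_mean_scaleR vec_eq_iff algebra_simps)

text \<open>Bias-variance decomposition over the rows: the cross terms vanish because the deviations from the
  mean row add up to zero.\<close>

lemma sum_norm_sq_diff_eq_row_mean:
  fixes x :: "real^'d::finite^'m::finite"
  shows "(\<Sum>i\<in>UNIV. (norm (x $ i - v))\<^sup>2)
    = real CARD('m) * (norm (row_mean x - v))\<^sup>2 + (norm (centering ** x))\<^sup>2"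
proof -
  let ?c = "row_mean x"
  have "(norm (x $ i - v))\<^sup>2
      = (norm (x $ i - ?c))\<^sup>2 + 2 * ((x $ i - ?c) \<bullet> (?c - v)) + (norm (?c - v))\<^sup>2" for i
    by (simp add: power2_norm_eq_inner algebra_simps inner_commute)
  then have "(\<Sum>i\<in>UNIV. (norm (x $ i - v))\<^sup>2)
      = (\<Sum>i\<in>UNIV. (norm (x $ i - ?c))\<^sup>2) + 2 * ((\<Sum>i\<in>UNIV. x $ i - ?c) \<bullet> (?c - v))
        + real CARD('m) * (norm (?c - v))\<^sup>2"
    by (simp add: sum.distrib inner_sum_left flip: sum_distrib_left)
  moreover have "(\<Sum>i\<in>UNIV. x $ i - ?c) = 0"
    by (simp add: sum_subtractf sum_rows_eq_row_mean sum_constant_scaleR del: sum_constant)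
  ultimately show ?thesis
    by (simp add: norm_sq_rows centering_mult)
qed

lemma norm_sq_centering_le:
  fixes x :: "real^'d::finite^'m::finite"
  shows "(norm (centering ** x))\<^sup>2 \<le> (norm x)\<^sup>2"
  using sum_norm_sq_diff_eq_row_mean[of x 0] by (simp add: norm_sq_rows[of x])

lemma norm_sq_row_mean_le:
  fixes x :: "real^'d::finite^'m::finite"
  shows "(norm (row_mean x))\<^sup>2 \<le> (norm x)\<^sup>2 / real CARD('m)"
proof -
  have "real CARD('m) * (norm (row_mean x))\<^sup>2 + (norm (centering ** x))\<^sup>2 = (norm x)\<^sup>2"
    using sum_norm_sq_diff_eq_row_mean[of x 0] by (simp add: norm_sq_rows[of x])
  then have "real CARD('m) * (norm (row_mean x))\<^sup>2 \<le> (norm x)\<^sup>2"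
    by (smt (verit) zero_le_power2)
  then show ?thesis
    by (simp add: field_simps)
qed

lemma norm_sq_add_le: "(norm (a + b))\<^sup>2 \<le> 2 * (norm a)\<^sup>2 + 2 * (norm b)\<^sup>2"
  for a b :: "'a::real_inner"
proof -
  have "0 \<le> (norm (a - b))\<^sup>2" by simp
  then show ?thesis by (simp add: power2_norm_eq_inner algebra_simps inner_commute)
qed

lemma norm_sq_diff_le: "(norm (a - b))\<^sup>2 \<le> 2 * (norm a)\<^sup>2 + 2 * (norm b)\<^sup>2"
  for a b :: "'a::real_inner"
  using norm_sq_add_le[of a "- b"] by simp

text \<open>Young's inequality with the weight that spends one of the two factors \<open>1 - \<theta>\<close>: after division
  by \<open>1 - \<theta>\<close> the two sides differ by the square of \<open>\<theta> a + (1 - \<theta>) b\<close> over \<open>\<theta>\<close>. In this form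
  it also covers \<open>\<theta> = 1\<close>.\<close>

lemma contracted_norm_sq_diff_le:
  fixes a b :: "'a::real_inner"
  assumes "0 < \<theta>" "\<theta> \<le> 1"
  shows "(1 - \<theta>)\<^sup>2 * (norm (a - b))\<^sup>2 \<le> (1 - \<theta>) * (norm a)\<^sup>2 + (norm b)\<^sup>2 / \<theta>"
proof -
  define c where "c = 1 - \<theta>"
  have ab: "(norm (a - b))\<^sup>2 = (norm a)\<^sup>2 - 2 * (a \<bullet> b) + (norm b)\<^sup>2"
    by (simp add: power2_norm_eq_inner algebra_simps inner_commute)
  have comb: "(norm (\<theta> *\<^sub>R a + c *\<^sub>R b))\<^sup>2
      = \<theta>\<^sup>2 * (norm a)\<^sup>2 + 2 * \<theta> * c * (a \<bullet> b) + c\<^sup>2 * (norm b)\<^sup>2"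
    unfolding power2_norm_eq_inner by (simp add: algebra_simps inner_commute power2_eq_square)
  have "(norm a)\<^sup>2 + (1 - \<theta>) / \<theta> * (norm b)\<^sup>2 - (1 - \<theta>) * (norm (a - b))\<^sup>2
      = (norm (\<theta> *\<^sub>R a + c *\<^sub>R b))\<^sup>2 / \<theta>"
    unfolding ab comb using assms by (simp add: c_def field_simps power2_eq_square)
  then have "(1 - \<theta>) * (norm (a - b))\<^sup>2 \<le> (norm a)\<^sup>2 + (1 - \<theta>) / \<theta> * (norm b)\<^sup>2"
    using assms by (smt (verit) divide_nonneg_pos zero_le_power2)
  then have "(1 - \<theta>) * ((1 - \<theta>) * (norm (a - b))\<^sup>2)
      \<le> (1 - \<theta>) * ((norm a)\<^sup>2 + (1 - \<theta>) / \<theta> * (norm b)\<^sup>2)"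
    using assms by (intro mult_left_mono) auto
  also have "\<dots> = (1 - \<theta>) * (norm a)\<^sup>2 + (1 - \<theta>)\<^sup>2 * ((norm b)\<^sup>2 / \<theta>)"
    using assms by (simp add: field_simps power2_eq_square)
  also have "\<dots> \<le> (1 - \<theta>) * (norm a)\<^sup>2 + 1 * ((norm b)\<^sup>2 / \<theta>)"
    using assms by (intro add_left_mono mult_right_mono) (auto simp: power_le_one)
  finally show ?thesis
    by (simp add: power2_eq_square)
qed

section \<open>Strongly convex and smooth objectives\<close>

text \<open>Compare the two bounds on the value at \<open>x - (g x - g y) / L\<close>: smoothness from \<open>x\<close> and convexity
  from \<open>y\<close>.\<close>

lemma strongly_convex_smooth_cocoercive:
  fixes f :: "real^'d::finite \<Rightarrow> real"
  assumes scs: "strongly_convex_smooth \<mu> L f g" and "0 \<le> \<mu>" "0 < L"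
  shows "(norm (g x - g y))\<^sup>2 \<le> 2 * L * (f x - f y - g y \<bullet> (x - y))"
proof -
  define v where "v = g x - g y"
  define z where "z = x - (1 / L) *\<^sub>R v"
  have "f y + g y \<bullet> (z - y) + \<mu> / 2 * (norm (y - z))\<^sup>2 \<le> f z"
    using scs by (simp add: strongly_convex_smooth_def)
  moreover have "0 \<le> \<mu> / 2 * (norm (y - z))\<^sup>2"
    using assms by simp
  moreover have "f z \<le> f x + g x \<bullet> (z - x) + L / 2 * (norm (x - z))\<^sup>2"
    using scs by (simp add: strongly_convex_smooth_def)
  moreover have grad: "g x \<bullet> (z - x) - g y \<bullet> (z - y) = - (1 / L) * (norm v)\<^sup>2 - g y \<bullet> (x - y)"
  proof -
    have "g x \<bullet> (z - x) - g y \<bullet> (z - y) = v \<bullet> (z - x) - g y \<bullet> (x - y)"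
      by (simp add: v_def algebra_simps)
    also have "v \<bullet> (z - x) = - (1 / L) * (norm v)\<^sup>2"
      by (simp add: z_def power2_norm_eq_inner)
    finally show ?thesis .
  qed
  moreover have normz: "(norm (x - z))\<^sup>2 = (norm v)\<^sup>2 / L\<^sup>2"
    using assms by (simp add: z_def power_divide)
  ultimately have "f y \<le> f x + (g x \<bullet> (z - x) - g y \<bullet> (z - y)) + L / 2 * (norm (x - z))\<^sup>2"
    by linarith
  then have "f y \<le> f x - g y \<bullet> (x - y) - (1 / L) * (norm v)\<^sup>2 + L / 2 * ((norm v)\<^sup>2 / L\<^sup>2)"
    unfolding grad normz by simp
  then show ?thesis
    using assms by (simp add: v_def[symmetric] field_simps power2_eq_square)
qed

lemma strongly_convex_smooth_lipschitz:
  fixes f :: "real^'d::finite \<Rightarrow> real"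
  assumes scs: "strongly_convex_smooth \<mu> L f g" and "0 \<le> \<mu>" "0 < L"
  shows "norm (g x - g y) \<le> L * norm (x - y)"
proof -
  have "(norm (g y - g x))\<^sup>2 = (norm (g x - g y))\<^sup>2"
    by (simp add: norm_minus_commute)
  then have "2 * (norm (g x - g y))\<^sup>2
      \<le> 2 * L * (f x - f y - g y \<bullet> (x - y)) + 2 * L * (f y - f x - g x \<bullet> (y - x))"
    using strongly_convex_smooth_cocoercive[OF assms, of x y]
      strongly_convex_smooth_cocoercive[OF assms, of y x] by linarith
  also have "\<dots> = 2 * (L * ((g x - g y) \<bullet> (x - y)))"
    by (simp add: algebra_simps)
  finally have "(norm (g x - g y))\<^sup>2 \<le> L * ((g x - g y) \<bullet> (x - y))"
    by simp
  also have "\<dots> \<le> L * (norm (g x - g y) * norm (x - y))"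
    using assms norm_cauchy_schwarz by (intro mult_left_mono) auto
  finally have "norm (g x - g y) * norm (g x - g y) \<le> norm (g x - g y) * (L * norm (x - y))"
    by (simp add: power2_eq_square mult_ac)
  then show ?thesis
    using assms by (cases "norm (g x - g y) = 0") (auto simp: mult_le_cancel_left_pos)
qed

text \<open>Both quadratic bounds hold along a unit vector, which exists because the space is not trivial.\<close>

lemma strongly_convex_smooth_constants:
  fixes f :: "real^'d::finite \<Rightarrow> real"
  assumes "strongly_convex_smooth \<mu> L f g"
  shows "\<mu> \<le> L"
proof -
  obtain e :: "real^'d" where e: "e \<in> Basis"
    using nonempty_Basis by blast
  have "f 0 + g 0 \<bullet> (e - 0) + \<mu> / 2 * (norm (0 - e))\<^sup>2 \<le> f e"
    "f e \<le> f 0 + g 0 \<bullet> (e - 0) + L / 2 * (norm (0 - e))\<^sup>2"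
    using assms unfolding strongly_convex_smooth_def by blast+
  then show ?thesis using e by simp
qed

locale strongly_convex_agents =
  fixes f :: "'m::finite \<Rightarrow> real^'d::finite \<Rightarrow> real"
    and gf :: "'m \<Rightarrow> real^'d \<Rightarrow> real^'d"
    and \<mu> L :: real
    and xstar :: "real^'d"
    and m :: real
  assumes m_def: "m = real CARD('m)"
    and mu_pos: "0 < \<mu>"
    and strongly_convex_smooth: "\<And>i. strongly_convex_smooth \<mu> L (f i) (gf i)"
    and minimizer: "is_arg_min (average_objective f) (\<lambda>_. True) xstar"
begin

abbreviation F :: "real^'d \<Rightarrow> real" where "F \<equiv> average_objective f"

text \<open>The squared distance of the local gradients from those at the minimizer, which do not vanish
  individually.\<close>

definition grad_gap :: "real^'d^'m \<Rightarrow> real" where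
  "grad_gap x = (norm (grad_rows gf x - grad_rows gf (vec xstar)))\<^sup>2"

lemma m_ge_1: "1 \<le> m"
  by (simp add: m_def Suc_le_eq)

lemma mu_le_L: "\<mu> \<le> L"
  using strongly_convex_smooth strongly_convex_smooth_constants by blast

lemma L_pos: "0 < L"
  using mu_pos mu_le_L by simp

lemma cocoercive: "(norm (gf i x - gf i y))\<^sup>2 \<le> 2 * L * (f i x - f i y - gf i y \<bullet> (x - y))"
  using strongly_convex_smooth_cocoercive[OF strongly_convex_smooth] mu_pos L_pos by simp

lemma lipschitz: "norm (gf i x - gf i y) \<le> L * norm (x - y)"
  using strongly_convex_smooth_lipschitz[OF strongly_convex_smooth] mu_pos L_pos by simp

lemma F_le: "F xstar \<le> F y"
  using minimizer by (auto simp: is_arg_min_def not_less)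

lemma F_gap_eq: "m * (F y - F x) = (\<Sum>i\<in>UNIV. f i y - f i x)"
  by (simp add: average_objective_def sum_subtractf m_def right_diff_distrib)

lemma F_upper:
  "F y \<le> F x + row_mean (grad_rows gf (vec x)) \<bullet> (y - x) + L / 2 * (norm (x - y))\<^sup>2"
proof -
  have "m * (F y - F x) \<le> (\<Sum>i\<in>(UNIV::'m set). gf i x \<bullet> (y - x) + L / 2 * (norm (x - y))\<^sup>2)"
    unfolding F_gap_eq
  proof (rule sum_mono)
    fix i
    show "f i y - f i x \<le> gf i x \<bullet> (y - x) + L / 2 * (norm (x - y))\<^sup>2"
      using strongly_convex_smooth[of i] unfolding strongly_convex_smooth_def by (smt (verit))
  qed
  also have "\<dots> = m * (row_mean (grad_rows gf (vec x)) \<bullet> (y - x) + L / 2 * (norm (x - y))\<^sup>2)"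
    by (simp add: sum.distrib row_mean_def grad_rows_def distrib_left m_def flip: inner_sum_left)
  finally show ?thesis
    using m_ge_1 by (simp add: mult_le_cancel_left_pos)
qed

text \<open>A gradient step of length \<open>1 / L\<close> from the minimizer would decrease the objective.\<close>

lemma mean_gradient_xstar: "row_mean (grad_rows gf (vec xstar)) = 0"
proof -
  define v where "v = row_mean (grad_rows gf (vec xstar))"
  have "F xstar \<le> F (xstar - (1 / L) *\<^sub>R v)"
    by (rule F_le)
  also have "\<dots> \<le> F xstar + v \<bullet> (xstar - (1 / L) *\<^sub>R v - xstar)
      + L / 2 * (norm (xstar - (xstar - (1 / L) *\<^sub>R v)))\<^sup>2"
    using F_upper unfolding v_def by blast
  also have "\<dots> = F xstar - (norm v)\<^sup>2 / (2 * L)"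
    using L_pos unfolding power_mult_distrib power2_norm_eq_inner
    by (simp add: power2_norm_eq_inner field_simps power2_eq_square inner_commute flip: power2_norm_eq_inner)
  finally have "(norm v)\<^sup>2 \<le> 0"
    using L_pos by (simp add: field_simps zero_less_divide_iff)
  then show ?thesis
    by (simp add: v_def)
qed

lemma F_gap_upper: "F y - F xstar \<le> L / 2 * (norm (y - xstar))\<^sup>2"
  using F_upper[of y xstar] by (simp add: mean_gradient_xstar norm_minus_commute)

text \<open>The linear terms of the cocoercivity inequalities add up to zero, because the mean gradient vanishes
  at the minimizer; only the gap of the mean objective remains.\<close>

lemma sum_cocoercive_xstar:
  "(\<Sum>i\<in>UNIV. (norm (gf i y - gf i xstar))\<^sup>2) \<le> 2 * L * m * (F y - F xstar)"
proof -
  have "(\<Sum>i\<in>UNIV. (norm (gf i y - gf i xstar))\<^sup>2)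
      \<le> (\<Sum>i\<in>UNIV. 2 * L * (f i y - f i xstar - gf i xstar \<bullet> (y - xstar)))"
    by (intro sum_mono cocoercive)
  also have "\<dots> = 2 * L * (m * (F y - F xstar) - (\<Sum>i\<in>UNIV. gf i xstar) \<bullet> (y - xstar))"
    by (simp add: F_gap_eq sum_subtractf inner_sum_left flip: sum_distrib_left)
  also have "(\<Sum>i\<in>UNIV. gf i xstar) = 0"
    using mean_gradient_xstar by (simp add: row_mean_def grad_rows_def)
  finally show ?thesis by simp
qed

lemma grad_gap_le:
  "grad_gap x \<le> 2 * L\<^sup>2 * (norm (centering ** x))\<^sup>2 + 4 * L * m * (F (row_mean x) - F xstar)"
proof -
  let ?c = "row_mean x"
  have "grad_gap x = (\<Sum>i\<in>UNIV. (norm (gf i (x $ i) - gf i xstar))\<^sup>2)"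
    by (simp add: grad_gap_def norm_sq_rows grad_rows_def)
  also have "\<dots> \<le> (\<Sum>i\<in>UNIV. 2 * L\<^sup>2 * (norm (x $ i - ?c))\<^sup>2 + 2 * (norm (gf i ?c - gf i xstar))\<^sup>2)"
  proof (rule sum_mono)
    fix i
    have "(norm (gf i (x $ i) - gf i ?c))\<^sup>2 \<le> (L * norm (x $ i - ?c))\<^sup>2"
      by (intro power_mono lipschitz) simp
    then show "(norm (gf i (x $ i) - gf i xstar))\<^sup>2
        \<le> 2 * L\<^sup>2 * (norm (x $ i - ?c))\<^sup>2 + 2 * (norm (gf i ?c - gf i xstar))\<^sup>2"
      using norm_sq_add_le[of "gf i (x $ i) - gf i ?c" "gf i ?c - gf i xstar"]
      by (simp add: power_mult_distrib)
  qed
  also have "\<dots> = 2 * L\<^sup>2 * (norm (centering ** x))\<^sup>2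
      + 2 * (\<Sum>i\<in>UNIV. (norm (gf i ?c - gf i xstar))\<^sup>2)"
    by (simp add: sum.distrib norm_sq_rows centering_mult flip: sum_distrib_left)
  finally show ?thesis
    using sum_cocoercive_xstar[of ?c] by simp
qed

lemma norm_sq_mean_gradient_le:
  "(norm (row_mean (grad_rows gf x)))\<^sup>2
     \<le> 2 * L\<^sup>2 * (norm (centering ** x))\<^sup>2 / m + 4 * L * (F (row_mean x) - F xstar)"
proof -
  have "row_mean (grad_rows gf x) = row_mean (grad_rows gf x - grad_rows gf (vec xstar))"
    by (simp add: row_mean_diff mean_gradient_xstar)
  then have "(norm (row_mean (grad_rows gf x)))\<^sup>2 \<le> grad_gap x / m"
    using norm_sq_row_mean_le by (metis grad_gap_def m_def)
  also have "\<dots> \<le> (2 * L\<^sup>2 * (norm (centering ** x))\<^sup>2 + 4 * L * m * (F (row_mean x) - F xstar)) / m"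
    using m_ge_1 by (intro divide_right_mono grad_gap_le) auto
  finally show ?thesis
    using m_ge_1 by (simp add: add_divide_distrib)
qed

text \<open>Each local gradient is paired with the step from the local iterate to the mean, where smoothness is
  used, and with the step from the minimizer to the local iterate, where strong convexity is used. The
  local function values at the local iterates cancel.\<close>

lemma mean_gradient_inner_ge:
  "row_mean (grad_rows gf x) \<bullet> (row_mean x - xstar)
     \<ge> (F (row_mean x) - F xstar) - L / 2 * (norm (centering ** x))\<^sup>2 / m
        + \<mu> / 2 * (norm (row_mean x - xstar))\<^sup>2"
proof -
  let ?c = "row_mean x"
  have centering: "(\<Sum>i\<in>UNIV. (norm (x $ i - ?c))\<^sup>2) = (norm (centering ** x))\<^sup>2"
    by (simp add: sum_norm_sq_diff_eq_row_mean)
  have "(\<Sum>i\<in>UNIV. gf i (x $ i) \<bullet> (?c - xstar))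
      \<ge> (\<Sum>i\<in>UNIV. (f i ?c - f i xstar) - L / 2 * (norm (x $ i - ?c))\<^sup>2
            + \<mu> / 2 * (norm (x $ i - xstar))\<^sup>2)"
  proof (rule sum_mono)
    fix i
    have "f i ?c \<le> f i (x $ i) + gf i (x $ i) \<bullet> (?c - x $ i) + L / 2 * (norm (x $ i - ?c))\<^sup>2"
      "f i (x $ i) + gf i (x $ i) \<bullet> (xstar - x $ i) + \<mu> / 2 * (norm (x $ i - xstar))\<^sup>2 \<le> f i xstar"
      using strongly_convex_smooth[of i] unfolding strongly_convex_smooth_def by blast+
    then show "(f i ?c - f i xstar) - L / 2 * (norm (x $ i - ?c))\<^sup>2
        + \<mu> / 2 * (norm (x $ i - xstar))\<^sup>2 \<le> gf i (x $ i) \<bullet> (?c - xstar)"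
      by (simp add: inner_diff_right)
  qed
  also have "(\<Sum>i\<in>UNIV. (f i ?c - f i xstar) - L / 2 * (norm (x $ i - ?c))\<^sup>2
            + \<mu> / 2 * (norm (x $ i - xstar))\<^sup>2)
      = m * (F ?c - F xstar) - L / 2 * (norm (centering ** x))\<^sup>2
        + \<mu> / 2 * (m * (norm (?c - xstar))\<^sup>2 + (norm (centering ** x))\<^sup>2)"
    unfolding F_gap_eq
    by (simp only: sum.distrib sum_subtractf centering m_def sum_norm_sq_diff_eq_row_mean
        sum_distrib_left[symmetric])
  finally have "m * (F ?c - F xstar) - L / 2 * (norm (centering ** x))\<^sup>2
        + \<mu> / 2 * (m * (norm (?c - xstar))\<^sup>2 + (norm (centering ** x))\<^sup>2)
      \<le> m * (row_mean (grad_rows gf x) \<bullet> (?c - xstar))"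
    by (simp add: row_mean_def grad_rows_def inner_sum_left m_def)
  moreover have "0 \<le> \<mu> / 2 * (norm (centering ** x))\<^sup>2"
    using mu_pos by simp
  ultimately have "m * ((F ?c - F xstar) - L / 2 * (norm (centering ** x))\<^sup>2 / m
        + \<mu> / 2 * (norm (?c - xstar))\<^sup>2) \<le> m * (row_mean (grad_rows gf x) \<bullet> (?c - xstar))"
    using m_ge_1 by (simp add: algebra_simps)
  then show ?thesis
    using m_ge_1 by (simp add: mult_le_cancel_left_pos)
qed

text \<open>One exact gradient step from the mean. The squared gradient costs a multiple of \<open>L * \<eta>\<^sup>2\<close> of the
  objective gap, which is small against the decrease \<open>2 * \<eta>\<close>.\<close>

lemma mean_gradient_step:
  assumes "0 \<le> \<eta>"
  shows "(norm (row_mean x - xstar - \<eta> *\<^sub>R row_mean (grad_rows gf x)))\<^sup>2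
    \<le> (1 - \<eta> * \<mu>) * (norm (row_mean x - xstar))\<^sup>2
      - (2 * \<eta> - 4 * L * \<eta>\<^sup>2) * (F (row_mean x) - F xstar)
      + (\<eta> * L + 2 * \<eta>\<^sup>2 * L\<^sup>2) * ((norm (centering ** x))\<^sup>2 / m)"
proof -
  define a h d X where "a = row_mean x - xstar" and "h = row_mean (grad_rows gf x)"
    and "d = F (row_mean x) - F xstar" and "X = (norm (centering ** x))\<^sup>2 / m"
  have 1: "d - L / 2 * X + \<mu> / 2 * (norm a)\<^sup>2 \<le> h \<bullet> a"
    using mean_gradient_inner_ge[of x] by (simp add: a_def h_def d_def X_def)
  have 2: "(norm h)\<^sup>2 \<le> 2 * L\<^sup>2 * X + 4 * L * d"
    using norm_sq_mean_gradient_le[of x] by (simp add: h_def d_def X_def)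
  have "(norm (a - \<eta> *\<^sub>R h))\<^sup>2 = (norm a)\<^sup>2 - 2 * \<eta> * (h \<bullet> a) + \<eta>\<^sup>2 * (norm h)\<^sup>2"
    unfolding power2_norm_eq_inner by (simp add: algebra_simps inner_commute power2_eq_square)
  also have "\<dots> \<le> (norm a)\<^sup>2 - 2 * \<eta> * (d - L / 2 * X + \<mu> / 2 * (norm a)\<^sup>2)
      + \<eta>\<^sup>2 * (2 * L\<^sup>2 * X + 4 * L * d)"
    using assms 1 2 by (intro add_mono diff_mono mult_left_mono) auto
  also have "\<dots> = (1 - \<eta> * \<mu>) * (norm a)\<^sup>2 - (2 * \<eta> - 4 * L * \<eta>\<^sup>2) * d + (\<eta> * L + 2 * \<eta>\<^sup>2 * L\<^sup>2) * X"
    by (simp add: algebra_simps power2_eq_square)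
  finally show ?thesis
    by (simp add: a_def h_def d_def X_def)
qed

end

section \<open>The Lyapunov recursion\<close>

text \<open>The deterministic core. Here \<open>d\<close>, \<open>X\<close>, \<open>Sg\<close>, \<open>Q\<close>, \<open>G\<close>, \<open>D\<close> and \<open>\<delta>\<close> stand for the expectations of the
  squared distance to the minimizer, the consensus error, the tracking error, the gradient gap at the
  anchor, the gradient gap at the iterate, the squared increment and the objective gap; primes denote
  the next iteration and \<open>v\<close> is the noise level.

  The contraction of \<open>\<Psi>\<close> leaves \<open>\<theta> / 2\<close> to spare. With \<open>\<eta> L \<le> \<theta> / 192\<close> the terms that the increment
  adds to the consensus error and to the gap at the anchor take only a small part of it. The rest, multiplied
  by \<open>\<kappa>\<close>, has to absorb the consensus error \<open>\<eta> L X / m\<close> of the descent step, which is the lower bound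
  on \<open>\<kappa>\<close>. The next weight \<open>\<kappa>'\<close> and the next step size may only be smaller, so the next value of
  the function is bounded by its value with the old coefficients.\<close>

lemma lyapunov_step:
  fixes d X Sg Q D G \<delta> d' X' S' Q' :: real
  assumes par: "0 < \<theta>" "\<theta> \<le> 1" "0 < \<mu>" "\<mu> \<le> L" "1 \<le> m" "0 < \<eta>" "\<eta> * L \<le> \<theta> / 192"
    and nonneg: "0 \<le> d" "0 \<le> X" "0 \<le> Sg" "0 \<le> Q" "0 \<le> G" "0 \<le> \<delta>" "0 \<le> v"
      "0 \<le> X'" "0 \<le> S'" "0 \<le> Q'"
    and opt: "d' \<le> (1 - \<eta> * \<mu>) * d - (2 * \<eta> - 4 * L * \<eta>\<^sup>2) * \<delta>
        + (\<eta> * L + 2 * \<eta>\<^sup>2 * L\<^sup>2) * (X / m) + \<eta>\<^sup>2 * (v / m)"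
    and cons: "X' \<le> (1 - \<theta>) * X + 2 * \<eta>\<^sup>2 / \<theta> * (Sg + D)"
    and track: "S' \<le> (1 - \<theta>) * Sg + 2 * \<theta> * D"
    and stale: "Q' \<le> \<theta> * G + (1 - \<theta>) * Q"
    and increment: "D \<le> 4 * (G + Q + 2 * (m * v))"
    and gap: "G \<le> 2 * L\<^sup>2 * X + 4 * L * m * \<delta>"
    and kappa: "3 * \<eta> * L / \<theta> \<le> \<kappa> * m"
    and mono: "0 < \<eta>'" "\<eta>' \<le> \<eta>" "0 \<le> \<kappa>'" "\<kappa>' \<le> \<kappa>"
  shows "d' + \<kappa>' * (X' + 4 * \<eta>'\<^sup>2 / \<theta>\<^sup>2 * S' + 2 * \<eta>' / (L * \<theta>) * Q')
    \<le> (1 - \<eta> * \<mu> / 2) * (d + \<kappa> * (X + 4 * \<eta>\<^sup>2 / \<theta>\<^sup>2 * Sg + 2 * \<eta> / (L * \<theta>) * Q))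
      - (19 / 10 - 9 * (\<kappa> * m)) * \<eta> * \<delta> + \<eta>\<^sup>2 * (v / m) + 80 * \<kappa> * \<eta>\<^sup>2 * (m * v) / \<theta>"
proof -
  define C1 C2 u where "C1 = 4 * \<eta>\<^sup>2 / \<theta>\<^sup>2" and "C2 = 2 * \<eta> / (L * \<theta>)" and "u = \<eta> * L"
  have L: "0 < L" using par by linarith
  have C: "0 \<le> C1" "0 \<le> C2" using par L by (simp_all add: C1_def C2_def)
  have u: "0 < u" "u \<le> \<theta> / 192" using par L by (simp_all add: u_def)
  have kap: "0 \<le> \<kappa>" using mono by linarith
  define P where "P = X + C1 * Sg + C2 * Q"
  have P0: "0 \<le> P" using C nonneg by (simp add: P_def)
  have XS: "X' + C1 * S' \<le> (1 - \<theta>) * X + C1 * (1 - \<theta> / 2) * Sg + 10 * \<eta>\<^sup>2 / \<theta> * D"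
  proof -
    have "X' + C1 * S' \<le> ((1 - \<theta>) * X + 2 * \<eta>\<^sup>2 / \<theta> * (Sg + D)) + C1 * ((1 - \<theta>) * Sg + 2 * \<theta> * D)"
      using cons track C by (intro add_mono mult_left_mono)
    also have "\<dots> = (1 - \<theta>) * X + C1 * (1 - \<theta> / 2) * Sg + 10 * \<eta>\<^sup>2 / \<theta> * D"
      using par by (simp add: C1_def field_simps power2_eq_square)
    finally show ?thesis .
  qed
  have D: "10 * \<eta>\<^sup>2 / \<theta> * D \<le> 5 / 24 * (\<eta> / L * G) + 5 / 48 * (C2 * \<theta>) * Q + 80 * \<eta>\<^sup>2 * (m * v) / \<theta>"
  proof -
    have "10 * \<eta>\<^sup>2 / \<theta> * D \<le> 10 * \<eta>\<^sup>2 / \<theta> * (4 * (G + Q + 2 * (m * v)))"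
      using increment par by (intro mult_left_mono) auto
    also have "\<dots> = 40 * \<eta>\<^sup>2 / \<theta> * (G + Q) + 80 * \<eta>\<^sup>2 * (m * v) / \<theta>"
      by (simp add: algebra_simps add_divide_distrib)
    also have "40 * \<eta>\<^sup>2 / \<theta> * (G + Q) \<le> 5 / 24 * (\<eta> / L) * (G + Q)"
    proof (rule mult_right_mono)
      have "40 * \<eta>\<^sup>2 / \<theta> = 40 * (\<eta> / L) * (u / \<theta>)"
        using L par by (simp add: u_def field_simps power2_eq_square)
      also have "\<dots> \<le> 40 * (\<eta> / L) * (1 / 192)"
        using u par L by (intro mult_left_mono) (auto simp: field_simps)
      finally show "40 * \<eta>\<^sup>2 / \<theta> \<le> 5 / 24 * (\<eta> / L)" by simp
    qed (use nonneg in simp)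
    also have "5 / 24 * (\<eta> / L) * (G + Q) = 5 / 24 * (\<eta> / L * G) + 5 / 48 * (C2 * \<theta>) * Q"
      using par by (simp add: C2_def field_simps)
    finally show ?thesis by simp
  qed
  have Q: "C2 * Q' \<le> C2 * (1 - \<theta>) * Q + 2 * (\<eta> / L * G)"
  proof -
    have "C2 * Q' \<le> C2 * (\<theta> * G + (1 - \<theta>) * Q)"
      using stale C by (intro mult_left_mono)
    also have "\<dots> = C2 * (1 - \<theta>) * Q + 2 * (\<eta> / L * G)"
      using par L by (simp add: C2_def field_simps)
    finally show ?thesis .
  qed
  define H where "H = 2 * u * X + 4 * \<eta> * m * \<delta>"
  have G: "(\<eta> / L) * G \<le> H"
  proof -
    have "(\<eta> / L) * G \<le> (\<eta> / L) * (2 * L\<^sup>2 * X + 4 * L * m * \<delta>)"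
      using gap par L by (intro mult_left_mono) auto
    also have "\<dots> = H"
      using L by (simp add: H_def u_def field_simps power2_eq_square)
    finally show ?thesis .
  qed
  have H0: "0 \<le> H" using u nonneg par by (simp add: H_def)
  have psi: "X' + C1 * S' + C2 * Q'
      \<le> (1 - \<theta> / 2) * P - 2 / 5 * \<theta> * X + 9 * \<eta> * m * \<delta> + 80 * \<eta>\<^sup>2 * (m * v) / \<theta>"
  proof -
    have "X' + C1 * S' + C2 * Q' \<le> (1 - \<theta>) * X + C1 * (1 - \<theta> / 2) * Sg + C2 * (1 - \<theta>) * Q
        + 5 / 48 * (C2 * \<theta>) * Q + 53 / 24 * H + 80 * \<eta>\<^sup>2 * (m * v) / \<theta>"
      using add_mono[OF add_mono[OF XS Q] add_mono[OF D mult_left_mono[OF G, of "53 / 24"]]]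
      by linarith
    also have "53 / 24 * H \<le> 1 / 10 * \<theta> * X + 9 * (\<eta> * m * \<delta>)"
    proof -
      have "u * X \<le> \<theta> / 192 * X" using u nonneg by (intro mult_right_mono)
      moreover have "0 \<le> \<theta> * X" "0 \<le> \<eta> * m * \<delta>" using par nonneg by simp_all
      ultimately show ?thesis by (simp add: H_def mult_ac)
    qed
    also have "(1 - \<theta>) * X + C1 * (1 - \<theta> / 2) * Sg + C2 * (1 - \<theta>) * Q + 5 / 48 * (C2 * \<theta>) * Q
        + (1 / 10 * \<theta> * X + 9 * (\<eta> * m * \<delta>)) + 80 * \<eta>\<^sup>2 * (m * v) / \<theta>
      = (1 - \<theta> / 2) * P - 2 / 5 * \<theta> * X + 9 * \<eta> * m * \<delta> + 80 * \<eta>\<^sup>2 * (m * v) / \<theta>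
        - 19 / 48 * (C2 * \<theta> * Q)"
      by (simp add: P_def algebra_simps)
    also have "\<dots> \<le> (1 - \<theta> / 2) * P - 2 / 5 * \<theta> * X + 9 * \<eta> * m * \<delta> + 80 * \<eta>\<^sup>2 * (m * v) / \<theta>"
      using C par nonneg by simp
    finally show ?thesis by simp
  qed
  have coeff: "4 * \<eta>'\<^sup>2 / \<theta>\<^sup>2 * S' \<le> C1 * S'" "2 * \<eta>' / (L * \<theta>) * Q' \<le> C2 * Q'"
    using par L mono nonneg unfolding C1_def C2_def
    by (intro mult_right_mono divide_right_mono mult_left_mono power_mono; simp)+
  have "\<kappa>' * (X' + 4 * \<eta>'\<^sup>2 / \<theta>\<^sup>2 * S' + 2 * \<eta>' / (L * \<theta>) * Q')
      \<le> \<kappa> * ((1 - \<theta> / 2) * P - 2 / 5 * \<theta> * X + 9 * \<eta> * m * \<delta> + 80 * \<eta>\<^sup>2 * (m * v) / \<theta>)"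
    using coeff psi mono nonneg par L kap by (intro mult_mono) (auto intro!: add_nonneg_nonneg)
  also have "\<dots> = (1 - \<theta> / 2) * (\<kappa> * P) - 2 / 5 * (\<theta> * \<kappa> * m) * (X / m)
      + 9 * (\<kappa> * m) * (\<eta> * \<delta>) + 80 * \<kappa> * \<eta>\<^sup>2 * (m * v) / \<theta>"
    using par by (simp add: algebra_simps)
  finally have kpsi: "\<kappa>' * (X' + 4 * \<eta>'\<^sup>2 / \<theta>\<^sup>2 * S' + 2 * \<eta>' / (L * \<theta>) * Q')
      \<le> (1 - \<theta> / 2) * (\<kappa> * P) - 2 / 5 * (\<theta> * \<kappa> * m) * (X / m)
      + 9 * (\<kappa> * m) * (\<eta> * \<delta>) + 80 * \<kappa> * \<eta>\<^sup>2 * (m * v) / \<theta>" .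
  have Xm: "(\<eta> * L + 2 * \<eta>\<^sup>2 * L\<^sup>2) * (X / m) \<le> 2 / 5 * (\<theta> * \<kappa> * m) * (X / m)"
  proof (rule mult_right_mono)
    have "u * u \<le> u * (1 / 192)" using u par by (intro mult_left_mono) auto
    moreover have "3 * u \<le> \<theta> * \<kappa> * m" using kappa par by (simp add: u_def field_simps)
    moreover have "\<eta> * L + 2 * \<eta>\<^sup>2 * L\<^sup>2 = u + 2 * (u * u)"
      by (simp add: u_def power2_eq_square)
    ultimately show "\<eta> * L + 2 * \<eta>\<^sup>2 * L\<^sup>2 \<le> 2 / 5 * (\<theta> * \<kappa> * m)" using u by linarith
  qed (use nonneg par in simp)
  have mu: "\<eta> * \<mu> \<le> \<theta>"
  proof -
    have "\<eta> * \<mu> \<le> u" using par by (simp add: u_def)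
    then show ?thesis using u par by linarith
  qed
  have rate: "(1 - \<theta> / 2) * (\<kappa> * P) \<le> (1 - \<eta> * \<mu> / 2) * (\<kappa> * P)"
    "(1 - \<eta> * \<mu>) * d \<le> (1 - \<eta> * \<mu> / 2) * d"
    using mu P0 kap nonneg par by (intro mult_right_mono; simp)+
  have del: "(19 / 10) * (\<eta> * \<delta>) \<le> (2 * \<eta> - 4 * L * \<eta>\<^sup>2) * \<delta>"
  proof -
    have "4 * u \<le> 1 / 10" using u par by linarith
    then have "4 * u * (\<eta> * \<delta>) \<le> 1 / 10 * (\<eta> * \<delta>)"
      using par nonneg by (intro mult_right_mono) auto
    then show ?thesis by (simp add: u_def algebra_simps power2_eq_square)
  qed
  have fin: "(1 - \<eta> * \<mu> / 2) * (d + \<kappa> * P) = (1 - \<eta> * \<mu> / 2) * d + (1 - \<eta> * \<mu> / 2) * (\<kappa> * P)"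
    "(19 / 10 - 9 * (\<kappa> * m)) * \<eta> * \<delta> = (19 / 10) * (\<eta> * \<delta>) - 9 * (\<kappa> * m) * (\<eta> * \<delta>)"
    by (simp_all add: algebra_simps)
  show ?thesis
    unfolding C1_def[symmetric] C2_def[symmetric] P_def[symmetric] fin
    using opt kpsi Xm rate del by linarith
qed

lemma geometric_recursion:
  fixes \<Phi> :: "nat \<Rightarrow> real"
  assumes "\<And>t. \<Phi> (Suc t) \<le> (1 - c) * \<Phi> t" "\<And>t. 0 \<le> \<Phi> t" 
  shows "\<Phi> T \<le> exp (- c * real T) * \<Phi> 0"
proof (induction T)
  case (Suc T)
  have "1 - c \<le> exp (- c)"
    using exp_ge_add_one_self[of "- c"] by simp
  then have "\<Phi> (Suc T) \<le> exp (- c) * \<Phi> T"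
    using assms by (meson mult_right_mono order_trans)
  also have "\<dots> \<le> exp (- c) * (exp (- c * real T) * \<Phi> 0)"
    using Suc by (intro mult_left_mono) auto
  also have "\<dots> = exp (- c * real (Suc T)) * \<Phi> 0"
    by (simp add: algebra_simps flip: exp_add)
  finally show ?case .
qed simp

text \<open>The weights are the inverse of the contraction: since \<open>exp y * (1 - y) \<le> 1\<close>, multiplying the recursion
  by them makes the terms in \<open>\<Phi>\<close> telescope.\<close>

lemma weighted_recursion:
  fixes \<Phi> \<delta> \<eta> B :: "nat \<Rightarrow> real" and \<mu> c :: real
  defines "E \<equiv> \<lambda>t. exp (\<mu> / 2 * (\<Sum>i\<le>t. \<eta> i))"
  assumes rec: "\<And>t. \<Phi> (Suc t) \<le> (1 - \<eta> t * \<mu> / 2) * \<Phi> t - c * \<eta> t * \<delta> t + B t"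
    and nonneg: "\<And>t. 0 \<le> \<Phi> t"
  shows "(\<Sum>t\<le>T. E t * (c * \<eta> t * \<delta> t)) \<le> \<Phi> 0 + (\<Sum>t\<le>T. E t * B t)"
proof -
  have exp_le: "exp y * (1 - y) \<le> 1" for y :: real
  proof -
    have "exp y * (1 - y) \<le> exp y * exp (- y)"
      using exp_ge_add_one_self[of "- y"] by (intro mult_left_mono) auto
    then show ?thesis by (simp flip: exp_add)
  qed
  have step: "E t * (c * \<eta> t * \<delta> t) + E t * \<Phi> (Suc t) \<le> E t * (1 - \<eta> t * \<mu> / 2) * \<Phi> t + E t * B t" for t
  proof -
    have "E t * \<Phi> (Suc t) \<le> E t * ((1 - \<eta> t * \<mu> / 2) * \<Phi> t - c * \<eta> t * \<delta> t + B t)"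
      using rec by (intro mult_left_mono) (auto simp: E_def)
    then show ?thesis by (simp add: algebra_simps)
  qed
  have "(\<Sum>t\<le>T. E t * (c * \<eta> t * \<delta> t)) + E T * \<Phi> (Suc T) \<le> \<Phi> 0 + (\<Sum>t\<le>T. E t * B t)"
  proof (induction T)
    case 0
    have "E 0 * (1 - \<eta> 0 * \<mu> / 2) \<le> 1"
      using exp_le[of "\<mu> / 2 * \<eta> 0"] by (simp add: E_def mult_ac)
    then have "E 0 * (1 - \<eta> 0 * \<mu> / 2) * \<Phi> 0 \<le> \<Phi> 0"
      using nonneg[of 0] mult_right_mono by fastforce
    then show ?case using step[of 0] by simp
  next
    case (Suc T)
    have "E (Suc T) = E T * exp (\<mu> / 2 * \<eta> (Suc T))"
      by (simp add: E_def distrib_left add_divide_distrib flip: exp_add)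
    then have "E (Suc T) * (1 - \<eta> (Suc T) * \<mu> / 2) = E T * (exp (\<mu> / 2 * \<eta> (Suc T)) * (1 - \<mu> / 2 * \<eta> (Suc T)))"
      by (simp add: mult_ac)
    also have "\<dots> \<le> E T * 1"
      using exp_le by (intro mult_left_mono) (auto simp: E_def)
    finally have "E (Suc T) * (1 - \<eta> (Suc T) * \<mu> / 2) * \<Phi> (Suc T) \<le> E T * \<Phi> (Suc T)"
      using nonneg[of "Suc T"] mult_right_mono by fastforce
    then show ?case using step[of "Suc T"] Suc by simp
  qed
  moreover have "0 \<le> E T * \<Phi> (Suc T)"
    using nonneg by (simp add: E_def)
  ultimately show ?thesis by linarith
qed

section \<open>The decreasing step sizes\<close>

text \<open>Both bounds are products of \<open>1 + 1 / b \<le> exp (1 / b) \<le> 1 / (1 - 1 / b)\<close> over consecutive values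
  of \<open>b\<close>, and these products telescope.\<close>

lemma exp_harmonic_bounds:
  fixes a :: real
  assumes "1 < a"
  shows "((a + real t + 1) / a) ^ 3 \<le> exp (\<Sum>i\<le>t. 3 / (a + real i))"
    and "exp (\<Sum>i\<le>t. 3 / (a + real i)) \<le> ((a + real t) / (a - 1)) ^ 3"
proof -
  have cube: "exp (3 / b) = exp (1 / b) ^ 3" for b :: real
    by (simp flip: exp_of_nat_mult)
  have lower: "((b + 1) / b) ^ 3 \<le> exp (3 / b)" if "1 < b" for b :: real
  proof -
    have "(b + 1) / b \<le> exp (1 / b)"
      using exp_ge_add_one_self[of "1 / b"] that by (simp add: add_divide_distrib)
    then show ?thesis
      unfolding cube using that by (intro power_mono) auto
  qed
  have upper: "exp (3 / b) \<le> (b / (b - 1)) ^ 3" if "1 < b" for b :: real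
  proof -
    have "(b - 1) / b \<le> exp (- (1 / b))"
      using exp_ge_add_one_self[of "- (1 / b)"] that by (simp add: diff_divide_distrib)
    then have "inverse (exp (- (1 / b))) \<le> inverse ((b - 1) / b)"
      using that by (intro le_imp_inverse_le) auto
    then have "exp (1 / b) \<le> b / (b - 1)"
      by (simp add: exp_minus)
    then show ?thesis
      unfolding cube by (intro power_mono) auto
  qed
  show "((a + real t + 1) / a) ^ 3 \<le> exp (\<Sum>i\<le>t. 3 / (a + real i))"
  proof (induction t)
    case 0
    then show ?case using lower[OF assms] by simp
  next
    case (Suc t)
    have "((a + real (Suc t) + 1) / a) ^ 3
        = ((a + real t + 1) / a) ^ 3 * ((a + real (Suc t) + 1) / (a + real (Suc t))) ^ 3"
      using assms by (simp add: add_ac flip: power_mult_distrib)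
    also have "\<dots> \<le> exp (\<Sum>i\<le>t. 3 / (a + real i)) * exp (3 / (a + real (Suc t)))"
      using assms by (intro mult_mono Suc lower) auto
    finally show ?case by (simp add: exp_add)
  qed
  show "exp (\<Sum>i\<le>t. 3 / (a + real i)) \<le> ((a + real t) / (a - 1)) ^ 3"
  proof (induction t)
    case 0
    then show ?case using upper[OF assms] by simp
  next
    case (Suc t)
    have "exp (\<Sum>i\<le>Suc t. 3 / (a + real i))
        = exp (\<Sum>i\<le>t. 3 / (a + real i)) * exp (3 / (a + real (Suc t)))"
      by (simp add: exp_add)
    also have "\<dots> \<le> ((a + real t) / (a - 1)) ^ 3 * ((a + real (Suc t)) / (a + real (Suc t) - 1)) ^ 3"
      using assms by (intro mult_mono Suc upper) auto
    also have "\<dots> = ((a + real (Suc t)) / (a - 1)) ^ 3"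
      using assms by (simp flip: power_mult_distrib)
    finally show ?case .
  qed
qed

lemma cube_le_sum_squares: "real T ^ 3 \<le> 3 * (\<Sum>t\<le>T. (real t)\<^sup>2)"
proof (induction T)
  case (Suc T)
  have "real (Suc T) ^ 3 = real T ^ 3 + 3 * (real T)\<^sup>2 + 3 * real T + 1"
    by (simp add: power3_eq_cube power2_eq_square algebra_simps)
  also have "\<dots> \<le> real T ^ 3 + 3 * (real (Suc T))\<^sup>2"
    by (simp add: power2_eq_square algebra_simps)
  finally show ?case using Suc by simp
qed simp

text \<open>With \<open>a = L / (\<beta> \<mu>)\<close> the step size is \<open>6 / (\<mu> (a + t))\<close> and the weights lie between \<open>t\<^sup>2 / a\<^sup>2\<close> and
  about \<open>(a + t)\<^sup>2 / a\<^sup>2\<close>. So the weights add up to at least \<open>T\<^sup>3 / (3 a\<^sup>2)\<close>, the weighted sum of the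
  step sizes grows like \<open>(a + T)\<^sup>2 / (\<mu> a\<^sup>2)\<close> and that of their squares like \<open>T / (\<mu>\<^sup>2 a\<^sup>2)\<close>. The
  quotients are the three terms of the bound.\<close>

lemma weighted_average_bound:
  fixes \<eta> wt \<delta> :: "nat \<Rightarrow> real" and \<theta> \<mu> L m v R :: real
  defines "\<beta> \<equiv> \<theta> / (2^7 * 3^2)"
  assumes par: "0 < \<theta>" "\<theta> \<le> 1" "0 < \<mu>" "\<mu> \<le> L" "1 \<le> m" "0 \<le> v" "0 \<le> R" "1 \<le> T"
    and \<eta>: "\<And>t. \<eta> t = 6 * \<beta> / (L + \<beta> * \<mu> * real t)"
    and wt: "\<And>t. wt t = \<eta> t / \<eta> 0 * exp (\<mu> / 2 * (\<Sum>i\<le>t. \<eta> i))"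
    and rec: "(\<Sum>t\<le>T. exp (\<mu> / 2 * (\<Sum>i\<le>t. \<eta> i)) * (17 / 10 * \<eta> t * \<delta> t))
      \<le> R + (\<Sum>t\<le>T. exp (\<mu> / 2 * (\<Sum>i\<le>t. \<eta> i)) * (\<eta> t ^ 2 * (v / m) + 240 * \<eta> t ^ 3 * L * v / \<theta>\<^sup>2))"
  shows "1 / (\<Sum>t\<le>T. wt t) * (\<Sum>t\<le>T. wt t * \<delta> t)
    \<le> 24 * (L + \<beta> * \<mu> * (real T + 1))\<^sup>2 / (\<beta>\<^sup>2 * \<mu>^3 * real T^3) * (v / m)
      + 2^8 * 3^5 * L / (\<mu>\<^sup>2 * \<theta>\<^sup>2) * (v / (real T)\<^sup>2)
      + 2^24 * 3^6 * L^3 / (\<theta>^3 * \<mu>\<^sup>2) * (1 / real T^3) * R"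
proof -
  define a where "a = L / (\<beta> * \<mu>)"
  have L: "0 < L" using par by linarith
  have \<beta>: "0 < \<beta>" using par by (simp add: \<beta>_def)
  have a_eq: "a = 1152 * L / (\<theta> * \<mu>)" using par by (simp add: a_def \<beta>_def)
  \<comment> \<open>The offset \<open>a\<close> is so large that replacing \<open>a - 1\<close> by \<open>a\<close> in a third power costs one percent.\<close>
  have a: "1152 \<le> a"
  proof -
    have "\<theta> * \<mu> \<le> 1 * L" using par by (intro mult_mono) auto
    then show ?thesis using par by (simp add: a_eq field_simps)
  qed
  have \<eta>': "\<eta> t = 6 / (\<mu> * (a + real t))" for t
  proof -
    have "L + \<beta> * \<mu> * real t = \<beta> * (\<mu> * (a + real t))"
      using \<beta> par by (simp add: a_def field_simps)
    then show ?thesis using \<beta> by (simp add: \<eta>)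
  qed
  define E where "E t = exp (\<mu> / 2 * (\<Sum>i\<le>t. \<eta> i))" for t
  have E: "E t = exp (\<Sum>i\<le>t. 3 / (a + real i))" for t
    using par by (simp add: E_def \<eta>' sum_distrib_left)
  have wtE: "wt t = a / (a + real t) * E t" for t
  proof -
    have "6 / (\<mu> * c) / (6 / (\<mu> * a)) = a / c" if "0 < c" for c
      using that par a by (simp add: field_simps)
    from this[of "a + real t"] have "\<eta> t / \<eta> 0 = a / (a + real t)"
      using a unfolding \<eta>' by (simp del: times_divide_eq_left distrib_left_numeral)
    then show ?thesis
      unfolding wt E_def[symmetric] by simp
  qed
  have cancel: "a / c * (c / b) ^ 3 = (a / b) ^ 3 * (c\<^sup>2 / a\<^sup>2)" if "0 < c" "0 < b" for b c
    using that a by (simp add: field_simps power2_eq_square power3_eq_cube)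
  have wt_lower: "(real t)\<^sup>2 / a\<^sup>2 \<le> wt t" for t
  proof -
    have "(real t)\<^sup>2 / a\<^sup>2 \<le> (a + real t)\<^sup>2 / a\<^sup>2"
      using a by (intro divide_right_mono power_mono) auto
    also have "\<dots> = a / (a + real t) * ((a + real t) / a) ^ 3"
      using cancel[of "a + real t" a] a by simp
    also have "\<dots> \<le> a / (a + real t) * ((a + real t + 1) / a) ^ 3"
      using a by (intro mult_left_mono power_mono divide_right_mono) auto
    also have "\<dots> \<le> wt t"
      unfolding wtE E using a by (intro mult_left_mono exp_harmonic_bounds) auto
    finally show ?thesis .
  qed
  have wt_upper: "wt t \<le> 101 / 100 * (a + real t)\<^sup>2 / a\<^sup>2" for t
  proof -
    have ratio: "(a / (a - 1)) ^ 3 \<le> 101 / 100"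
    proof -
      have "a / (a - 1) \<le> 1152 / 1151" using a by (simp add: field_simps)
      then have "(a / (a - 1)) ^ 3 \<le> (1152 / 1151) ^ 3" using a by (intro power_mono) auto
      then show ?thesis by (simp add: power3_eq_cube)
    qed
    have "wt t \<le> a / (a + real t) * ((a + real t) / (a - 1)) ^ 3"
      unfolding wtE E using a by (intro mult_left_mono exp_harmonic_bounds) auto
    also have "\<dots> = (a / (a - 1)) ^ 3 * ((a + real t)\<^sup>2 / a\<^sup>2)"
      using cancel[of "a + real t" "a - 1"] a by simp
    also have "\<dots> \<le> 101 / 100 * ((a + real t)\<^sup>2 / a\<^sup>2)"
      using ratio by (intro mult_right_mono) auto
    finally show ?thesis by simp
  qed
  have T: "1 \<le> real T" using par by simp
  define S where "S = (\<Sum>t\<le>T. wt t)"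
  have S: "real T ^ 3 / (3 * a\<^sup>2) \<le> S"
  proof -
    have "real T ^ 3 / (3 * a\<^sup>2) \<le> 3 * (\<Sum>t\<le>T. (real t)\<^sup>2) / (3 * a\<^sup>2)"
      using cube_le_sum_squares by (intro divide_right_mono) auto
    also have "\<dots> = (\<Sum>t\<le>T. (real t)\<^sup>2 / a\<^sup>2)"
      by (simp add: sum_divide_distrib)
    also have "\<dots> \<le> S"
      unfolding S_def by (intro sum_mono wt_lower)
    finally show ?thesis .
  qed
  have S0: "0 < S"
    using S T a by (smt (verit) divide_pos_pos zero_less_power)
  have S_div: "x / S \<le> 3 * a\<^sup>2 / real T ^ 3 * x" if "0 \<le> x" for x
  proof -
    have "x / S \<le> x / (real T ^ 3 / (3 * a\<^sup>2))"
      using that S T a by (intro divide_left_mono mult_pos_pos) (auto intro!: S0)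
    then show ?thesis by (simp add: mult_ac)
  qed
  have sum1: "(\<Sum>t\<le>T. wt t * \<eta> t) \<le> 7 * (a + real T + 1)\<^sup>2 / (\<mu> * a\<^sup>2)"
  proof -
    have "wt t * \<eta> t \<le> 7 * (a + real T) / (\<mu> * a\<^sup>2)" if "t \<le> T" for t
    proof -
      have "wt t * \<eta> t \<le> 101 / 100 * (a + real t)\<^sup>2 / a\<^sup>2 * (6 / (\<mu> * (a + real t)))"
        unfolding \<eta>' using par a by (intro mult_right_mono wt_upper) auto
      also have "\<dots> = 606 / 100 * (a + real t) / (\<mu> * a\<^sup>2)"
        by (simp add: power2_eq_square)
      also have "\<dots> \<le> 7 * (a + real T) / (\<mu> * a\<^sup>2)"
        using a par that by (intro divide_right_mono mult_mono) auto
      finally show ?thesis .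
    qed
    then have "(\<Sum>t\<le>T. wt t * \<eta> t) \<le> (\<Sum>t\<le>T. 7 * (a + real T) / (\<mu> * a\<^sup>2))"
      by (intro sum_mono) auto
    also have "\<dots> = 7 * ((a + real T) * (real T + 1)) / (\<mu> * a\<^sup>2)"
      by (simp add: algebra_simps)
    also have "\<dots> \<le> 7 * ((a + real T + 1) * (a + real T + 1)) / (\<mu> * a\<^sup>2)"
      using a par by (intro divide_right_mono mult_left_mono mult_mono) auto
    finally show ?thesis by (simp add: power2_eq_square)
  qed
  have sum2: "(\<Sum>t\<le>T. wt t * (\<eta> t)\<^sup>2) \<le> 74 * real T / (\<mu>\<^sup>2 * a\<^sup>2)"
  proof -
    have "wt t * (\<eta> t)\<^sup>2 \<le> 37 / (\<mu>\<^sup>2 * a\<^sup>2)" for t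
    proof -
      have "wt t * (\<eta> t)\<^sup>2 \<le> 101 / 100 * (a + real t)\<^sup>2 / a\<^sup>2 * (6 / (\<mu> * (a + real t)))\<^sup>2"
        unfolding \<eta>' using par a by (intro mult_right_mono wt_upper) auto
      also have "\<dots> = 3636 / 100 / (\<mu>\<^sup>2 * a\<^sup>2)"
        using a by (simp add: power_divide power_mult_distrib)
      also have "\<dots> \<le> 37 / (\<mu>\<^sup>2 * a\<^sup>2)"
        using a par by (intro divide_right_mono) auto
      finally show ?thesis .
    qed
    then have "(\<Sum>t\<le>T. wt t * (\<eta> t)\<^sup>2) \<le> (\<Sum>t\<le>T. 37 / (\<mu>\<^sup>2 * a\<^sup>2))"
      by (intro sum_mono) auto
    also have "\<dots> = 37 * (real T + 1) / (\<mu>\<^sup>2 * a\<^sup>2)"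
      by (simp add: mult_ac)
    also have "\<dots> \<le> 74 * real T / (\<mu>\<^sup>2 * a\<^sup>2)"
      using a par T by (intro divide_right_mono) auto
    finally show ?thesis .
  qed
  have \<eta>0: "\<eta> 0 = 6 / (\<mu> * a)" "0 < \<eta> 0" using a par by (simp_all add: \<eta>')
  have wt_eta: "E t * \<eta> t = \<eta> 0 * wt t" for t
    using \<eta>0(2) by (simp add: wt E_def)
  have rec': "17 / 10 * (\<Sum>t\<le>T. wt t * \<delta> t)
      \<le> R / \<eta> 0 + (v / m) * (\<Sum>t\<le>T. wt t * \<eta> t) + 240 * L * v / \<theta>\<^sup>2 * (\<Sum>t\<le>T. wt t * (\<eta> t)\<^sup>2)"
  proof -
    have l: "E t * (17 / 10 * \<eta> t * \<delta> t) = \<eta> 0 * (17 / 10 * (wt t * \<delta> t))" for t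
    proof -
      have "E t * (17 / 10 * \<eta> t * \<delta> t) = 17 / 10 * \<delta> t * (E t * \<eta> t)" by simp
      then show ?thesis by (simp add: wt_eta)
    qed
    have r: "E t * (\<eta> t ^ 2 * (v / m) + 240 * \<eta> t ^ 3 * L * v / \<theta>\<^sup>2)
      = \<eta> 0 * ((v / m) * (wt t * \<eta> t) + 240 * L * v / \<theta>\<^sup>2 * (wt t * (\<eta> t)\<^sup>2))" for t
    proof -
      have "E t * (\<eta> t ^ 2 * (v / m) + 240 * \<eta> t ^ 3 * L * v / \<theta>\<^sup>2)
        = (E t * \<eta> t) * (\<eta> t * (v / m) + 240 * (\<eta> t)\<^sup>2 * L * v / \<theta>\<^sup>2)"
        by (simp add: algebra_simps power2_eq_square power3_eq_cube)
      then show ?thesis by (simp add: wt_eta algebra_simps)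
    qed
    have "\<eta> 0 * (17 / 10 * (\<Sum>t\<le>T. wt t * \<delta> t)) \<le> R + \<eta> 0 * ((v / m) * (\<Sum>t\<le>T. wt t * \<eta> t)
        + 240 * L * v / \<theta>\<^sup>2 * (\<Sum>t\<le>T. wt t * (\<eta> t)\<^sup>2))"
      using rec unfolding E_def[symmetric] l r
      by (simp only: sum_distrib_left[symmetric] sum.distrib)
    also have "\<dots> = \<eta> 0 * (R / \<eta> 0 + (v / m) * (\<Sum>t\<le>T. wt t * \<eta> t)
        + 240 * L * v / \<theta>\<^sup>2 * (\<Sum>t\<le>T. wt t * (\<eta> t)\<^sup>2))"
      using \<eta>0(2) by (simp add: algebra_simps)
    finally show ?thesis using \<eta>0(2) by (simp only: mult_le_cancel_left_pos)
  qed
  define V1 V2 where "V1 = 7 * (a + real T + 1)\<^sup>2 / (\<mu> * a\<^sup>2)" and "V2 = 74 * real T / (\<mu>\<^sup>2 * a\<^sup>2)"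
  have V: "0 \<le> V1" "0 \<le> V2" using par by (simp_all add: V1_def V2_def)
  have "17 / 10 * (\<Sum>t\<le>T. wt t * \<delta> t) \<le> R / \<eta> 0 + (v / m) * V1 + 240 * L * v / \<theta>\<^sup>2 * V2"
  proof -
    have "(v / m) * (\<Sum>t\<le>T. wt t * \<eta> t) \<le> (v / m) * V1"
      using sum1 par unfolding V1_def by (intro mult_left_mono) auto
    moreover have "240 * L * v / \<theta>\<^sup>2 * (\<Sum>t\<le>T. wt t * (\<eta> t)\<^sup>2) \<le> 240 * L * v / \<theta>\<^sup>2 * V2"
      using sum2 par L unfolding V2_def by (intro mult_left_mono) auto
    ultimately show ?thesis using rec' by linarith
  qed
  moreover have scale: "s \<le> 10 / 17 * r" if "17 / 10 * s \<le> r" for s r :: real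
    using that by simp
  ultimately have "(\<Sum>t\<le>T. wt t * \<delta> t) / S
      \<le> (10 / 17 * (R / \<eta> 0 + (v / m) * V1 + 240 * L * v / \<theta>\<^sup>2 * V2)) / S"
    using S0 by (intro divide_right_mono scale) auto
  also have "\<dots> \<le> 3 * a\<^sup>2 / real T ^ 3 * (10 / 17 * (R / \<eta> 0 + (v / m) * V1 + 240 * L * v / \<theta>\<^sup>2 * V2))"
    using V par L \<eta>0 by (intro S_div) auto
  also have "\<dots> = 210 / 17 * (a + real T + 1)\<^sup>2 / (\<mu> * real T ^ 3) * (v / m)
      + 532800 / 17 * L / (\<mu>\<^sup>2 * \<theta>\<^sup>2) * (v / (real T)\<^sup>2)
      + 5 / 17 * a ^ 3 * \<mu> * (1 / real T ^ 3) * R"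
  proof -
    have "3 * a\<^sup>2 / real T ^ 3 * (10 / 17 * ((v / m) * V1))
        = 210 / 17 * (a + real T + 1)\<^sup>2 / (\<mu> * real T ^ 3) * (v / m)"
      using a unfolding V1_def by (simp add: mult_ac)
    moreover have "3 * a\<^sup>2 / real T ^ 3 * (10 / 17 * (240 * L * v / \<theta>\<^sup>2 * V2))
        = 532800 / 17 * L / (\<mu>\<^sup>2 * \<theta>\<^sup>2) * (v / (real T)\<^sup>2)"
      using a T unfolding V2_def by (simp add: field_simps power2_eq_square power3_eq_cube)
    moreover have "3 * a\<^sup>2 / real T ^ 3 * (10 / 17 * (R / \<eta> 0)) = 5 / 17 * a ^ 3 * \<mu> * (1 / real T ^ 3) * R"
      unfolding \<eta>0(1) by (simp add: power2_eq_square power3_eq_cube mult_ac)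
    ultimately show ?thesis by (simp only: distrib_left)
  qed
  also have "210 / 17 * (a + real T + 1)\<^sup>2 / (\<mu> * real T ^ 3) * (v / m)
      \<le> 24 * (L + \<beta> * \<mu> * (real T + 1))\<^sup>2 / (\<beta>\<^sup>2 * \<mu>^3 * real T^3) * (v / m)"
  proof -
    have "L + \<beta> * \<mu> * (real T + 1) = \<beta> * \<mu> * (a + real T + 1)"
      using \<beta> par by (simp add: a_def field_simps)
    then have eq: "24 * (L + \<beta> * \<mu> * (real T + 1))\<^sup>2 / (\<beta>\<^sup>2 * \<mu>^3 * real T^3)
        = 24 * (a + real T + 1)\<^sup>2 / (\<mu> * real T ^ 3)"
      using \<beta> par by (simp add: power_mult_distrib power2_eq_square power3_eq_cube)
    show ?thesis
      unfolding eq using par by (intro mult_right_mono divide_right_mono) auto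
  qed
  also have "532800 / 17 * L / (\<mu>\<^sup>2 * \<theta>\<^sup>2) * (v / (real T)\<^sup>2)
      \<le> 2^8 * 3^5 * L / (\<mu>\<^sup>2 * \<theta>\<^sup>2) * (v / (real T)\<^sup>2)"
    using par L by (intro mult_right_mono divide_right_mono) auto
  also have "5 / 17 * a ^ 3 * \<mu> * (1 / real T ^ 3) * R
      \<le> 2^24 * 3^6 * L^3 / (\<theta>^3 * \<mu>\<^sup>2) * (1 / real T^3) * R"
  proof -
    have "5 / 17 * a ^ 3 * \<mu> = 5 / 17 * 1152 ^ 3 * (L ^ 3 / (\<theta> ^ 3 * \<mu>\<^sup>2))"
      using par by (simp add: a_eq power_mult_distrib power_divide power2_eq_square power3_eq_cube mult_ac)
    also have "\<dots> \<le> 2^24 * 3^6 * (L ^ 3 / (\<theta> ^ 3 * \<mu>\<^sup>2))"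
      using par L by (intro mult_right_mono) auto
    finally have "5 / 17 * a ^ 3 * \<mu> \<le> 2^24 * 3^6 * L^3 / (\<theta>^3 * \<mu>\<^sup>2)"
      by simp
    then show ?thesis
      using par by (intro mult_right_mono) auto
  qed
  finally show ?thesis by (simp add: S_def)
qed

section \<open>Independence and integrals\<close>

text \<open>The value types may differ, since states are matrices and draws are samples, coins or mixing
  matrices. Factorization of the joint law is the form in which Fubini's theorem uses independence.\<close>

definition (in prob_space) indep_pair ::
    "'b measure \<Rightarrow> ('a \<Rightarrow> 'b) \<Rightarrow> 'c measure \<Rightarrow> ('a \<Rightarrow> 'c) \<Rightarrow> bool" where
  "indep_pair S X T Y \<longleftrightarrow> random_variable S X \<and> random_variable T Y \<and>
     distr M (S \<Otimes>\<^sub>M T) (\<lambda>\<omega>. (X \<omega>, Y \<omega>)) = distr M S X \<Otimes>\<^sub>M distr M T Y"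

lemma (in prob_space) indep_pairD:
  assumes "indep_pair S X T Y"
  shows "distr M (S \<Otimes>\<^sub>M T) (\<lambda>\<omega>. (X \<omega>, Y \<omega>)) = distr M S X \<Otimes>\<^sub>M distr M T Y"
    and "prob_space (distr M S X)" "prob_space (distr M T Y)"
    and "random_variable S X" "random_variable T Y"
  using assms prob_space_distr by (auto simp: indep_pair_def)

text \<open>By Fubini's theorem \<open>Y\<close> can be integrated out with \<open>X\<close> held fixed, because its law does not depend on
  \<open>X\<close>. The function is nonnegative, so integrability is a conclusion.\<close>

lemma (in prob_space) indep_freezing:
  fixes h :: "'b \<times> 'c \<Rightarrow> real"
  assumes indep: "indep_pair S X T Y"
    and h [measurable]: "h \<in> borel_measurable (S \<Otimes>\<^sub>M T)"
    and nonneg: "\<And>z. 0 \<le> h z"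
    and int: "\<And>x. x \<in> space S \<Longrightarrow> integrable (distr M T Y) (\<lambda>y. h (x, y))"
    and bound: "\<And>x. x \<in> space S \<Longrightarrow> (LINT y|distr M T Y. h (x, y)) \<le> k x"
    and k: "integrable M (\<lambda>\<omega>. k (X \<omega>))"
  shows "integrable M (\<lambda>\<omega>. h (X \<omega>, Y \<omega>))"
    and "(LINT \<omega>|M. h (X \<omega>, Y \<omega>)) \<le> (LINT \<omega>|M. k (X \<omega>))"
proof -
  note pair = indep_pairD[OF indep]
  note [measurable] = pair(4,5)
  interpret X: prob_space "distr M S X" by (rule pair)
  interpret Y: prob_space "distr M T Y" by (rule pair)
  have k0: "0 \<le> k x" if "x \<in> space S" for x
    by (rule order_trans[OF Bochner_Integration.integral_nonneg bound[OF that]]) (rule nonneg)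
  have XS: "X \<omega> \<in> space S" if "\<omega> \<in> space M" for \<omega>
    using measurable_space[OF pair(4) that] .
  have hY [measurable]: "h \<in> borel_measurable (S \<Otimes>\<^sub>M distr M T Y)"
    by simp
  have inner [measurable]: "(\<lambda>x. \<integral>\<^sup>+ y. ennreal (h (x, y)) \<partial>distr M T Y) \<in> borel_measurable S"
    by measurable
  have "(\<integral>\<^sup>+ \<omega>. ennreal (h (X \<omega>, Y \<omega>)) \<partial>M)
      = (\<integral>\<^sup>+ z. ennreal (h z) \<partial>(distr M S X \<Otimes>\<^sub>M distr M T Y))"
    unfolding pair(1)[symmetric] by (subst nn_integral_distr) auto
  also have "\<dots> = (\<integral>\<^sup>+ x. \<integral>\<^sup>+ y. ennreal (h (x, y)) \<partial>distr M T Y \<partial>distr M S X)"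
    by (subst Y.nn_integral_fst[symmetric]) auto
  also have "\<dots> = (\<integral>\<^sup>+ \<omega>. \<integral>\<^sup>+ y. ennreal (h (X \<omega>, y)) \<partial>distr M T Y \<partial>M)"
    by (subst nn_integral_distr) auto
  also have "\<dots> \<le> (\<integral>\<^sup>+ \<omega>. ennreal (k (X \<omega>)) \<partial>M)"
  proof (rule nn_integral_mono)
    fix \<omega> assume "\<omega> \<in> space M"
    then have "X \<omega> \<in> space S" by (rule XS)
    then show "(\<integral>\<^sup>+ y. ennreal (h (X \<omega>, y)) \<partial>distr M T Y) \<le> ennreal (k (X \<omega>))"
      using int bound nonneg by (subst nn_integral_eq_integral) (auto intro: ennreal_leI)
  qed
  also have "\<dots> = ennreal (LINT \<omega>|M. k (X \<omega>))"
    using k k0 XS by (intro nn_integral_eq_integral) (auto intro!: AE_I2)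
  finally have *: "(\<integral>\<^sup>+ \<omega>. ennreal (h (X \<omega>, Y \<omega>)) \<partial>M) \<le> ennreal (LINT \<omega>|M. k (X \<omega>))" .
  show int_h: "integrable M (\<lambda>\<omega>. h (X \<omega>, Y \<omega>))"
    using * nonneg by (intro integrableI_nonneg) (auto simp: top_unique less_top[symmetric])
  have "0 \<le> (LINT \<omega>|M. k (X \<omega>))"
    using k0 XS by (intro integral_nonneg_AE AE_I2) auto
  then show "(LINT \<omega>|M. h (X \<omega>, Y \<omega>)) \<le> (LINT \<omega>|M. k (X \<omega>))"
    using * nn_integral_eq_integral[OF int_h] nonneg by simp
qed

text \<open>The integral over \<open>Y\<close> of the inner product vanishes for every fixed value of \<open>X\<close>.\<close>

lemma (in prob_space) indep_uncorrelated:
  fixes v :: "'b \<Rightarrow> 'e::euclidean_space" and n :: "'b \<times> 'c \<Rightarrow> 'e"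
  assumes indep: "indep_pair S X T Y"
    and [measurable]: "v \<in> borel_measurable S" "n \<in> borel_measurable (S \<Otimes>\<^sub>M T)"
    and v: "integrable M (\<lambda>\<omega>. (norm (v (X \<omega>)))\<^sup>2)"
    and n: "integrable M (\<lambda>\<omega>. (norm (n (X \<omega>, Y \<omega>)))\<^sup>2)"
    and int: "\<And>x. x \<in> space S \<Longrightarrow> integrable (distr M T Y) (\<lambda>y. n (x, y))"
    and mean: "\<And>x. x \<in> space S \<Longrightarrow> (LINT y|distr M T Y. n (x, y)) = 0"
  shows "integrable M (\<lambda>\<omega>. v (X \<omega>) \<bullet> n (X \<omega>, Y \<omega>))"
    and "(LINT \<omega>|M. v (X \<omega>) \<bullet> n (X \<omega>, Y \<omega>)) = 0"
proof -
  note pair = indep_pairD[OF indep]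
  note [measurable] = pair(4,5)
  interpret X: prob_space "distr M S X" by (rule pair)
  interpret Y: prob_space "distr M T Y" by (rule pair)
  interpret XY: pair_sigma_finite "distr M S X" "distr M T Y" ..
  show int_vn: "integrable M (\<lambda>\<omega>. v (X \<omega>) \<bullet> n (X \<omega>, Y \<omega>))"
  proof (rule Bochner_Integration.integrable_bound)
    show "integrable M (\<lambda>\<omega>. (norm (v (X \<omega>)))\<^sup>2 + (norm (n (X \<omega>, Y \<omega>)))\<^sup>2)"
      using v n by simp
    show "AE \<omega> in M. norm (v (X \<omega>) \<bullet> n (X \<omega>, Y \<omega>))
        \<le> norm ((norm (v (X \<omega>)))\<^sup>2 + (norm (n (X \<omega>, Y \<omega>)))\<^sup>2)"
    proof (rule AE_I2)
      fix \<omega>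
      let ?a = "norm (v (X \<omega>))" and ?b = "norm (n (X \<omega>, Y \<omega>))"
      have "\<bar>v (X \<omega>) \<bullet> n (X \<omega>, Y \<omega>)\<bar> \<le> ?a * ?b"
        by (rule Cauchy_Schwarz_ineq2)
      also have "?a * ?b \<le> 2 * (?a * ?b)"
        by simp
      also have "\<dots> \<le> ?a\<^sup>2 + ?b\<^sup>2"
        using sum_squares_bound[of ?a ?b] by (simp only: mult.assoc)
      finally show "norm (v (X \<omega>) \<bullet> n (X \<omega>, Y \<omega>)) \<le> norm (?a\<^sup>2 + ?b\<^sup>2)"
        by simp
    qed
  qed simp
  let ?g = "\<lambda>z. v (fst z) \<bullet> n z"
  have int_g: "integrable (distr M S X \<Otimes>\<^sub>M distr M T Y) ?g"
    unfolding pair(1)[symmetric] using int_vn by (subst integrable_distr_eq) auto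
  have "(LINT \<omega>|M. v (X \<omega>) \<bullet> n (X \<omega>, Y \<omega>)) = (LINT z|(distr M S X \<Otimes>\<^sub>M distr M T Y). ?g z)"
    unfolding pair(1)[symmetric] by (subst integral_distr) auto
  also have "\<dots> = (LINT x|distr M S X. LINT y|distr M T Y. v x \<bullet> n (x, y))"
    using XY.integral_fst'[OF int_g] by simp
  also have "\<dots> = (LINT x|distr M S X. 0)"
    by (intro Bochner_Integration.integral_cong) (auto simp: int mean)
  finally show "(LINT \<omega>|M. v (X \<omega>) \<bullet> n (X \<omega>, Y \<omega>)) = 0"
    by simp
qed

lemma sets_sigma_subset:
  assumes "\<And>d. d \<in> J \<Longrightarrow> E d \<subseteq> sets M"
  shows "sets (sigma (space M) (\<Union>d\<in>J. E d)) \<subseteq> sets M"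
    "space (sigma (space M) (\<Union>d\<in>J. E d)) = space M"
    "sets (sigma (space M) (\<Union>d\<in>J. E d)) = sigma_sets (space M) (\<Union>d\<in>J. E d)"
proof -
  have "(\<Union>d\<in>J. E d) \<subseteq> Pow (space M)"
    using assms sets.sets_into_space by blast
  then show "space (sigma (space M) (\<Union>d\<in>J. E d)) = space M"
    "sets (sigma (space M) (\<Union>d\<in>J. E d)) = sigma_sets (space M) (\<Union>d\<in>J. E d)"
    by (simp_all add: space_measure_of_conv)
  moreover have "sigma_sets (space M) (\<Union>d\<in>J. E d) \<subseteq> sets M"
    using assms by (intro sets.sigma_sets_subset) auto
  ultimately show "sets (sigma (space M) (\<Union>d\<in>J. E d)) \<subseteq> sets M"
    by simp
qed

text \<open>The \<open>\<sigma>\<close>-algebras generated by disjoint groups of an independent family are independent; on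
  rectangles the joint law is therefore a product, and rectangles determine it.\<close>

lemma (in prob_space) indep_pair_disjoint_sigma:
  assumes indep: "indep_sets E UNIV"
    and Int: "\<And>d. Int_stable (E d)"
    and disj: "J \<inter> K = {}"
    and X: "X \<in> measurable (sigma (space M) (\<Union>d\<in>J. E d)) S"
    and Y: "Y \<in> measurable (sigma (space M) (\<Union>d\<in>K. E d)) T"
  shows "indep_pair S X T Y"
proof -
  have E: "E d \<subseteq> sets M" for d
    using indep by (auto simp: indep_sets_def)
  note sig = sets_sigma_subset[of _ E, OF E]
  have XM: "random_variable S X" "random_variable T Y"
    using measurable_from_subalg[OF _ X] measurable_from_subalg[OF _ Y] sig
    by (auto simp: subalgebra_def)
  have "indep_sets (\<lambda>b. sigma_sets (space M) (\<Union>d\<in>case_bool J K b. E d)) UNIV"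
  proof (rule indep_sets_collect_sigma)
    show "indep_sets E (\<Union>b\<in>UNIV. case_bool J K b)"
      by (rule indep_sets_mono_index[OF _ indep]) auto
    show "disjoint_family_on (case_bool J K) UNIV"
      using disj by (auto simp: disjoint_family_on_def split: bool.splits)
  qed (rule Int)
  moreover have "(\<lambda>b. sigma_sets (space M) (\<Union>d\<in>case_bool J K b. E d))
      = case_bool (sigma_sets (space M) (\<Union>d\<in>J. E d)) (sigma_sets (space M) (\<Union>d\<in>K. E d))"
    by (auto split: bool.splits)
  ultimately have "indep_set (sigma_sets (space M) (\<Union>d\<in>J. E d)) (sigma_sets (space M) (\<Union>d\<in>K. E d))"
    by (simp add: indep_set_def)
  then have prod: "prob ((X -` A \<inter> space M) \<inter> (Y -` B \<inter> space M))
      = prob (X -` A \<inter> space M) * prob (Y -` B \<inter> space M)" if "A \<in> sets S" "B \<in> sets T" for A B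
    using measurable_sets[OF X that(1)] measurable_sets[OF Y that(2)] sig by (intro indep_setD) auto
  note [measurable] = XM
  interpret X: prob_space "distr M S X" by (rule prob_space_distr) fact
  interpret Y: prob_space "distr M T Y" by (rule prob_space_distr) fact
  have "distr M S X \<Otimes>\<^sub>M distr M T Y = distr M (S \<Otimes>\<^sub>M T) (\<lambda>\<omega>. (X \<omega>, Y \<omega>))"
  proof (rule pair_measure_eqI)
    fix A B assume "A \<in> sets (distr M S X)" "B \<in> sets (distr M T Y)"
    then have AB [measurable]: "A \<in> sets S" "B \<in> sets T" by simp_all
    have "(\<lambda>\<omega>. (X \<omega>, Y \<omega>)) -` (A \<times> B) \<inter> space M = (X -` A \<inter> space M) \<inter> (Y -` B \<inter> space M)"
      by auto
    then show "emeasure (distr M S X) A * emeasure (distr M T Y) B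
        = emeasure (distr M (S \<Otimes>\<^sub>M T) (\<lambda>\<omega>. (X \<omega>, Y \<omega>))) (A \<times> B)"
      using prod[OF AB] AB by (simp add: emeasure_distr emeasure_eq_measure ennreal_mult'')
  qed (auto intro: X.sigma_finite_measure_axioms Y.sigma_finite_measure_axioms)
  then show ?thesis
    using XM by (simp add: indep_pair_def)
qed

section \<open>Measurability of matrix expressions\<close>

lemma borel_measurable_vec_nth [measurable (raw)]:
  fixes X :: "'w \<Rightarrow> ('a::euclidean_space)^'n::finite"
  assumes "X \<in> borel_measurable N"
  shows "(\<lambda>\<omega>. X \<omega> $ i) \<in> borel_measurable N"
proof -
  have "(\<lambda>y::'a^'n. y $ i) \<in> borel_measurable borel"
    by (intro borel_measurable_continuous_onI continuous_intros)
  then show ?thesis using assms by measurable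
qed

lemma borel_measurable_vec_lambda [measurable (raw)]:
  fixes X :: "'w \<Rightarrow> 'n::finite \<Rightarrow> 'a::euclidean_space"
  assumes "\<And>i. (\<lambda>\<omega>. X \<omega> i) \<in> borel_measurable N"
  shows "(\<lambda>\<omega>. \<chi> i. X \<omega> i) \<in> borel_measurable N"
proof (rule borel_measurable_euclidean_space[THEN iffD2], rule ballI)
  fix b :: "'a^'n" assume "b \<in> Basis"
  then obtain i u where "b = axis i u" by (auto simp: Basis_vec_def)
  then show "(\<lambda>\<omega>. (\<chi> i. X \<omega> i) \<bullet> b) \<in> borel_measurable N"
    using assms by (simp add: inner_axis)
qed

lemma borel_measurable_matrix_mult [measurable (raw)]:
  fixes A :: "'w \<Rightarrow> real^'k::finite^'m::finite" and B :: "'w \<Rightarrow> real^'d::finite^'k"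
  assumes [measurable]: "A \<in> borel_measurable N" "B \<in> borel_measurable N"
  shows "(\<lambda>\<omega>. A \<omega> ** B \<omega>) \<in> borel_measurable N"
  unfolding matrix_matrix_mult_def by measurable

lemma borel_measurable_row_mean [measurable (raw)]:
  fixes X :: "'w \<Rightarrow> real^'d::finite^'m::finite"
  assumes [measurable]: "X \<in> borel_measurable N"
  shows "(\<lambda>\<omega>. row_mean (X \<omega>)) \<in> borel_measurable N"
  unfolding row_mean_def by measurable

section \<open>The random iteration\<close>

lemma sample_grad_rows_measurable:
  fixes gs :: "'m::finite \<Rightarrow> real^'d::finite \<Rightarrow> 's \<Rightarrow> real^'d"
  assumes gs: "\<And>i. (\<lambda>(x, z). gs i x z) \<in> borel_measurable (borel \<Otimes>\<^sub>M D i)"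
    and [measurable]: "X \<in> borel_measurable N" "\<And>i. Y i \<in> measurable N (D i)"
  shows "(\<lambda>\<omega>. sample_grad_rows gs (X \<omega>) (\<lambda>i. Y i \<omega>)) \<in> borel_measurable N"
  unfolding sample_grad_rows_def
proof (rule borel_measurable_vec_lambda)
  fix i
  have "(\<lambda>\<omega>. (X \<omega> $ i, Y i \<omega>)) \<in> measurable N (borel \<Otimes>\<^sub>M D i)"
    by measurable
  from measurable_compose[OF this gs[of i]]
  show "(\<lambda>\<omega>. gs i (X \<omega> $ i) (Y i \<omega>)) \<in> borel_measurable N"
    by simp
qed

primrec draw_time :: "'m draw \<Rightarrow> nat" where
  "draw_time (Sample t i) = t"
| "draw_time (Coin t) = t"
| "draw_time (Mixing t) = t"

definition past :: "nat \<Rightarrow> 'm draw set" where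
  "past t = {d. draw_time d < t}"

text \<open>Within an iteration the samples are revealed before the coin and the mixing matrix, which are
  independent of them.\<close>

definition present :: "nat \<Rightarrow> 'm draw set" where
  "present t = past t \<union> range (Sample t)"

locale ss_dsgt_process = prob_space M + strongly_convex_agents f gf \<mu> L xstar m
  for M :: "'w measure"
    and f :: "'m::finite \<Rightarrow> real^'d::finite \<Rightarrow> real"
    and gf :: "'m \<Rightarrow> real^'d \<Rightarrow> real^'d"
    and \<mu> L :: real and xstar :: "real^'d" and m :: real +
  fixes D :: "'m \<Rightarrow> 's measure"
    and fs :: "'m \<Rightarrow> real^'d \<Rightarrow> 's \<Rightarrow> real"
    and gs :: "'m \<Rightarrow> real^'d \<Rightarrow> 's \<Rightarrow> real^'d"
    and \<sigma> \<theta> :: real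
    and MW :: "(real^'m^'m) measure"
    and \<xi> :: "nat \<Rightarrow> 'm \<Rightarrow> 'w \<Rightarrow> 's"
    and \<zeta> :: "nat \<Rightarrow> 'w \<Rightarrow> bool"
    and W :: "nat \<Rightarrow> 'w \<Rightarrow> real^'m^'m"
    and \<eta> :: "nat \<Rightarrow> real"
    and x0 :: "real^'d"
  assumes objective: "stochastic_objective D fs gs f gf"
    and noise: "bounded_noise D gs gf \<sigma>"
    and mixing: "mixing_law MW"
    and contraction: "\<And>x :: real^'d^'m. (LINT A|MW. (norm (A ** x - vec (row_mean x)))\<^sup>2)
          \<le> (1 - \<theta>)\<^sup>2 * (norm (x - vec (row_mean x)))\<^sup>2"
    and draws: "independent_draws M D MW \<theta> \<xi> \<zeta> W"
    and theta_pos: "0 < \<theta>" and theta_le_1: "\<theta> \<le> 1"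
    and step_pos: "\<And>t. 0 < \<eta> t"
begin

subsection \<open>Independence of the draws\<close>

definition draw_events :: "'m draw \<Rightarrow> 'w set set" where
  "draw_events d = (case d of
       Sample t i \<Rightarrow> generated_events M (D i) (\<xi> t i)
     | Coin t \<Rightarrow> generated_events M (count_space UNIV) (\<zeta> t)
     | Mixing t \<Rightarrow> generated_events M borel (W t))"

definition known :: "'m draw set \<Rightarrow> 'w measure" where
  "known J = sigma (space M) (\<Union>d\<in>J. draw_events d)"

lemma draws_measurable [measurable]:
  "\<xi> t i \<in> measurable M (D i)" "\<zeta> t \<in> measurable M (count_space UNIV)" "W t \<in> borel_measurable M"
  and draws_distr: "distr M (D i) (\<xi> t i) = D i"
    "distr M (count_space UNIV) (\<zeta> t) = measure_pmf (bernoulli_pmf \<theta>)" "distr M borel (W t) = MW"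
  and indep_draw_events: "indep_sets draw_events UNIV"
  using draws by (auto simp: independent_draws_def draw_events_def[abs_def])

lemma Int_stable_generated_events: "Int_stable (generated_events M N X)"
  unfolding Int_stable_def generated_events_def
proof clarify
  fix A B assume "A \<in> sets N" "B \<in> sets N"
  then show "\<exists>C. X -` A \<inter> space M \<inter> (X -` B \<inter> space M) = X -` C \<inter> space M \<and> C \<in> sets N"
    by (intro exI[of _ "A \<inter> B"]) auto
qed

lemma Int_stable_draw_events: "Int_stable (draw_events d)"
  by (cases d) (simp_all add: draw_events_def Int_stable_generated_events)

lemma draw_events_subset: "draw_events d \<subseteq> sets M"
  using indep_draw_events by (auto simp: indep_sets_def)

lemma space_known: "space (known J) = space M"
  and sets_known: "sets (known J) = sigma_sets (space M) (\<Union>d\<in>J. draw_events d)"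
  and sets_known_subset: "sets (known J) \<subseteq> sets M"
  unfolding known_def using sets_sigma_subset[of J draw_events M, OF draw_events_subset] by auto

lemma known_measurable:
  assumes "X \<in> measurable (known J) N"
  shows "X \<in> measurable M N"
  by (rule measurable_from_subalg[OF _ assms])
    (simp add: subalgebra_def space_known sets_known_subset)

lemma known_mono:
  assumes "X \<in> measurable (known J) N" "J \<subseteq> K"
  shows "X \<in> measurable (known K) N"
proof (rule measurable_from_subalg[OF _ assms(1)])
  have "sets (known J) \<subseteq> sets (known K)"
    unfolding sets_known using assms(2) by (intro sigma_sets_mono') auto
  then show "subalgebra (known K) (known J)"
    by (simp add: subalgebra_def space_known)
qed

lemma generated_events_known:
  assumes "X \<in> measurable M N" "d \<in> J" "draw_events d = generated_events M N X"
  shows "X \<in> measurable (known J) N"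
proof (rule measurableI)
  show "X \<omega> \<in> space N" if "\<omega> \<in> space (known J)" for \<omega>
    using measurable_space[OF assms(1)] that by (simp add: space_known)
  show "X -` A \<inter> space (known J) \<in> sets (known J)" if "A \<in> sets N" for A
  proof -
    have "X -` A \<inter> space M \<in> draw_events d"
      unfolding assms(3) generated_events_def using that by blast
    then show ?thesis
      unfolding sets_known space_known using assms(2) by (intro sigma_sets.Basic) blast
  qed
qed

lemma draws_known:
  "Sample t i \<in> J \<Longrightarrow> \<xi> t i \<in> measurable (known J) (D i)"
  "Coin t \<in> J \<Longrightarrow> \<zeta> t \<in> measurable (known J) (count_space UNIV)"
  "Mixing t \<in> J \<Longrightarrow> W t \<in> borel_measurable (known J)"
  using generated_events_known[OF draws_measurable(1), of "Sample t i" J]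
    generated_events_known[OF draws_measurable(2), of "Coin t" J]
    generated_events_known[OF draws_measurable(3), of "Mixing t" J]
  by (simp_all add: draw_events_def)

lemma indep_pair_known:
  assumes "X \<in> measurable (known J) S" "Y \<in> measurable (known K) T" "J \<inter> K = {}"
  shows "indep_pair S X T Y"
  using assms unfolding known_def
  by (intro indep_pair_disjoint_sigma[OF indep_draw_events Int_stable_draw_events, of J K])

subsection \<open>The state\<close>

definition state :: "nat \<Rightarrow> 'w \<Rightarrow> ('m, 'd) ss_state" where
  "state t \<omega> = ss_dsgt gs \<eta> x0 (\<lambda>k. W k \<omega>) (\<lambda>k. \<zeta> k \<omega>) (\<lambda>k i. \<xi> k i \<omega>) t"

definition iter :: "nat \<Rightarrow> 'w \<Rightarrow> real^'d^'m" where "iter t \<omega> = xvar (state t \<omega>)"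
definition anchor :: "nat \<Rightarrow> 'w \<Rightarrow> real^'d^'m" where "anchor t \<omega> = qvar (state t \<omega>)"
definition tracker :: "nat \<Rightarrow> 'w \<Rightarrow> real^'d^'m" where "tracker t \<omega> = svar (state t \<omega>)"

definition fresh_grad :: "nat \<Rightarrow> 'w \<Rightarrow> real^'d^'m" where
  "fresh_grad t \<omega> = sample_grad_rows gs (iter t \<omega>) (\<lambda>i. \<xi> t i \<omega>)"

definition anchor_grad :: "nat \<Rightarrow> 'w \<Rightarrow> real^'d^'m" where
  "anchor_grad t \<omega> = sample_grad_rows gs (anchor t \<omega>) (\<lambda>i. \<xi> (tau (state t \<omega>)) i \<omega>)"

definition increment :: "nat \<Rightarrow> 'w \<Rightarrow> real^'d^'m" where
  "increment t \<omega> = fresh_grad t \<omega> - anchor_grad t \<omega>"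

lemma state_0:
  "iter 0 \<omega> = vec x0" "anchor 0 \<omega> = vec x0" "tracker 0 \<omega> = fresh_grad 0 \<omega>"
  "anchor_grad 0 \<omega> = fresh_grad 0 \<omega>"
  by (simp_all add: iter_def anchor_def tracker_def fresh_grad_def anchor_grad_def state_def)

lemma state_Suc:
  "iter (Suc t) \<omega> = W t \<omega> ** (iter t \<omega> - \<eta> t *\<^sub>R (tracker t \<omega> + increment t \<omega>))"
  "anchor (Suc t) \<omega> = (if \<zeta> t \<omega> then iter t \<omega> else anchor t \<omega>)"
  "tracker (Suc t) \<omega> = W t \<omega> ** tracker t \<omega> + of_bool (\<zeta> t \<omega>) *\<^sub>R increment t \<omega>"
  "anchor_grad (Suc t) \<omega> = (if \<zeta> t \<omega> then fresh_grad t \<omega> else anchor_grad t \<omega>)"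
  by (simp_all add: iter_def anchor_def tracker_def fresh_grad_def anchor_grad_def increment_def
      state_def Let_def del: split_paired_All)

lemma gs_measurable [measurable]: "(\<lambda>(x, z). gs i x z) \<in> borel_measurable (borel \<Otimes>\<^sub>M D i)"
  using objective by (simp add: stochastic_objective_def)

lemma past_Suc: "present t \<subseteq> past (Suc t)" "past t \<subseteq> past (Suc t)" "past t \<subseteq> present t"
  "Coin t \<in> past (Suc t)" "Mixing t \<in> past (Suc t)" "Sample t i \<in> present t"
  by (auto simp: past_def present_def)

lemma fresh_grad_known_if:
  assumes "iter t \<in> borel_measurable (known (past t))"
  shows "fresh_grad t \<in> borel_measurable (known (present t))"
  unfolding fresh_grad_def[abs_def]
  by (intro sample_grad_rows_measurable[where D = D] gs_measurable draws_known past_Suc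
      known_mono[OF assms])

text \<open>At time \<open>0\<close> the tracker and the anchor gradient already contain the samples of iteration \<open>0\<close>,
  so they are only known together with the samples of the current iteration; the iterate and the
  anchor never depend on those.\<close>

lemma state_known:
  "iter t \<in> borel_measurable (known (past t))" "anchor t \<in> borel_measurable (known (past t))"
  "tracker t \<in> borel_measurable (known (present t))"
  "anchor_grad t \<in> borel_measurable (known (present t))"
proof (induction t)
  case 0
  have i: "iter 0 \<in> borel_measurable (known (past 0))"
    and "anchor 0 \<in> borel_measurable (known (past 0))"
    by (simp_all add: state_0[abs_def])
  moreover have "tracker 0 = fresh_grad 0" "anchor_grad 0 = fresh_grad 0"
    by (auto simp: state_0)
  ultimately show "iter 0 \<in> borel_measurable (known (past 0))"
    "anchor 0 \<in> borel_measurable (known (past 0))"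
    "tracker 0 \<in> borel_measurable (known (present 0))"
    "anchor_grad 0 \<in> borel_measurable (known (present 0))"
    using fresh_grad_known_if[OF i] by simp_all
next
  case (Suc t)
  let ?K = "known (past (Suc t))"
  note [measurable] = known_mono[OF Suc(1) past_Suc(2)] known_mono[OF Suc(2) past_Suc(2)]
    known_mono[OF Suc(3) past_Suc(1)] known_mono[OF Suc(4) past_Suc(1)]
    known_mono[OF fresh_grad_known_if[OF Suc(1)] past_Suc(1)]
    draws_known(2)[OF past_Suc(4)] draws_known(3)[OF past_Suc(5)]
  have inc [measurable]: "increment t \<in> borel_measurable ?K"
    unfolding increment_def[abs_def] by measurable
  show "iter (Suc t) \<in> borel_measurable ?K" "anchor (Suc t) \<in> borel_measurable ?K"
    unfolding state_Suc[abs_def] by measurable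
  have "tracker (Suc t) \<in> borel_measurable ?K" "anchor_grad (Suc t) \<in> borel_measurable ?K"
    unfolding state_Suc[abs_def] by measurable
  then show "tracker (Suc t) \<in> borel_measurable (known (present (Suc t)))"
    "anchor_grad (Suc t) \<in> borel_measurable (known (present (Suc t)))"
    by (simp_all add: known_mono[OF _ past_Suc(3)])
qed

lemma fresh_grad_known: "fresh_grad t \<in> borel_measurable (known (present t))"
  by (rule fresh_grad_known_if[OF state_known(1)])

lemma state_measurable [measurable]:
  "iter t \<in> borel_measurable M" "anchor t \<in> borel_measurable M" "tracker t \<in> borel_measurable M"
  "anchor_grad t \<in> borel_measurable M" "fresh_grad t \<in> borel_measurable M"
  using state_known fresh_grad_known by (blast intro: known_measurable)+

lemma increment_measurable [measurable]: "increment t \<in> borel_measurable M"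
  unfolding increment_def[abs_def] by measurable

lemma increment_known: "increment t \<in> borel_measurable (known (present t))"
proof -
  note [measurable] = state_known(4)[of t] fresh_grad_known[of t]
  show ?thesis unfolding increment_def[abs_def] by measurable
qed

subsection \<open>Expectations over a single draw\<close>

lemma gf_measurable [measurable]: "gf i \<in> borel_measurable borel"
proof -
  have "L-lipschitz_on UNIV (gf i)"
    using lipschitz L_pos by (intro lipschitz_onI) (auto simp: dist_norm)
  then show ?thesis
    by (intro borel_measurable_continuous_onI lipschitz_on_continuous_on)
qed

lemma grad_rows_measurable [measurable (raw)]:
  assumes [measurable]: "X \<in> borel_measurable N"
  shows "(\<lambda>\<omega>. grad_rows gf (X \<omega>)) \<in> borel_measurable N"
  unfolding grad_rows_def by measurable

lemma F_measurable [measurable]: "F \<in> borel_measurable borel"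
proof -
  have f: "continuous_on UNIV (f i)" for i
  proof (intro continuous_at_imp_continuous_on ballI)
    fix x
    have "GDERIV (f i) x :> gf i x"
      using objective unfolding stochastic_objective_def by blast
    then show "isCont (f i) x"
      unfolding gderiv_def by (rule has_derivative_continuous)
  qed
  have "continuous_on UNIV F"
    unfolding average_objective_def[abs_def] by (intro continuous_intros f)
  then show ?thesis
    by (rule borel_measurable_continuous_onI)
qed

text \<open>The coin is independent of everything that is known before it is thrown.\<close>

lemma coin_expectation:
  fixes V :: "'w \<Rightarrow> real"
  assumes V: "V \<in> borel_measurable (known (present t))" and int: "integrable M V"
  shows "integrable M (\<lambda>\<omega>. of_bool (\<zeta> t \<omega>) * V \<omega>)"
    and "(LINT \<omega>|M. of_bool (\<zeta> t \<omega>) * V \<omega>) = \<theta> * (LINT \<omega>|M. V \<omega>)"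
proof -
  define B :: "'w \<Rightarrow> real" where "B \<omega> = of_bool (\<zeta> t \<omega>)" for \<omega>
  have [measurable]: "\<zeta> t \<in> measurable (known {Coin t}) (count_space UNIV)"
    by (rule draws_known) simp
  have B: "B \<in> borel_measurable (known {Coin t})"
    unfolding B_def[abs_def] by measurable
  have intB: "integrable M B"
    using known_measurable[OF B] by (intro integrable_const_bound[of B 1]) (auto simp: B_def)
  have "(LINT \<omega>|M. B \<omega>) = (LINT b|distr M (count_space UNIV) (\<zeta> t). of_bool b)"
    unfolding B_def by (subst integral_distr) auto
  also have "\<dots> = \<theta>"
    unfolding draws_distr using theta_pos theta_le_1 by simp
  finally have EB: "(LINT \<omega>|M. B \<omega>) = \<theta>" .
  have "indep_pair borel B borel V"
    by (rule indep_pair_known[OF B V]) (auto simp: present_def past_def)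
  then have "indep_var borel B borel V"
    by (simp add: indep_var_distribution_eq indep_pair_def)
  from indep_var_integrable[OF this intB int] indep_var_lebesgue_integral[OF this intB int]
  show "integrable M (\<lambda>\<omega>. of_bool (\<zeta> t \<omega>) * V \<omega>)"
    "(LINT \<omega>|M. of_bool (\<zeta> t \<omega>) * V \<omega>) = \<theta> * (LINT \<omega>|M. V \<omega>)"
    by (simp_all add: B_def EB[unfolded B_def])
qed

lemma coin_choice_expectation:
  fixes U V :: "'w \<Rightarrow> real"
  assumes "U \<in> borel_measurable (known (present t))" "integrable M U"
    and "V \<in> borel_measurable (known (present t))" "integrable M V"
  shows "integrable M (\<lambda>\<omega>. if \<zeta> t \<omega> then U \<omega> else V \<omega>)"
    and "(LINT \<omega>|M. (if \<zeta> t \<omega> then U \<omega> else V \<omega>))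
      = \<theta> * (LINT \<omega>|M. U \<omega>) + (1 - \<theta>) * (LINT \<omega>|M. V \<omega>)"
proof -
  have eq: "(\<lambda>\<omega>. if \<zeta> t \<omega> then U \<omega> else V \<omega>)
      = (\<lambda>\<omega>. of_bool (\<zeta> t \<omega>) * U \<omega> + (V \<omega> - of_bool (\<zeta> t \<omega>) * V \<omega>))"
    by auto
  note U = coin_expectation[OF assms(1,2)] and V = coin_expectation[OF assms(3,4)]
  show "integrable M (\<lambda>\<omega>. if \<zeta> t \<omega> then U \<omega> else V \<omega>)"
    unfolding eq using U(1) V(1) assms by simp
  show "(LINT \<omega>|M. (if \<zeta> t \<omega> then U \<omega> else V \<omega>))
      = \<theta> * (LINT \<omega>|M. U \<omega>) + (1 - \<theta>) * (LINT \<omega>|M. V \<omega>)"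
    unfolding eq using U V assms by (simp add: algebra_simps)
qed

lemma AE_mixing:
  "AE A in MW. doubly_stochastic A" "prob_space MW" "sets MW = sets borel"
  using mixing by (auto simp: mixing_law_def)

lemma AE_W_doubly_stochastic: "AE \<omega> in M. doubly_stochastic (W t \<omega>)"
  using AE_distrD[of "W t" M borel doubly_stochastic] AE_mixing(1) unfolding draws_distr by simp

lemma norm_doubly_stochastic_mult_le:
  fixes A :: "real^'m^'m" and z :: "real^'d^'m"
  assumes "doubly_stochastic A"
  shows "(norm (A ** z))\<^sup>2 \<le> m * (\<Sum>j\<in>UNIV. norm (z $ j))\<^sup>2"
proof -
  have A: "0 \<le> A $ i $ j" "A $ i $ j \<le> 1" for i j
    using assms by (auto simp: doubly_stochastic_def)
  have "norm ((A ** z) $ i) \<le> (\<Sum>j\<in>UNIV. norm (z $ j))" for i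
  proof -
    have "(A ** z) $ i = (\<Sum>j\<in>UNIV. A $ i $ j *\<^sub>R z $ j)"
      by (simp add: vec_eq_iff matrix_matrix_mult_def)
    also have "norm \<dots> \<le> (\<Sum>j\<in>UNIV. norm (A $ i $ j *\<^sub>R z $ j))"
      by (rule norm_sum)
    also have "\<dots> \<le> (\<Sum>j\<in>UNIV. norm (z $ j))"
      using A by (intro sum_mono) (auto intro: mult_left_le_one_le)
    finally show ?thesis .
  qed
  then have "(norm (A ** z))\<^sup>2 \<le> (\<Sum>i\<in>(UNIV::'m set). (\<Sum>j\<in>UNIV. norm (z $ j))\<^sup>2)"
    unfolding norm_sq_rows by (intro sum_mono power_mono) auto
  then show ?thesis by (simp add: m_def)
qed

text \<open>The contraction for a fixed matrix carries over to a random one that is independent of the mixing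
  matrix. For almost every mixing matrix the mean row of the product is that of \<open>Z\<close>, so the centered
  product is the quantity of the contraction hypothesis.\<close>

lemma mixing_contracts:
  fixes Z :: "'w \<Rightarrow> real^'d^'m"
  assumes Z: "Z \<in> borel_measurable (known (insert (Coin t) (present t)))"
    and int: "integrable M (\<lambda>\<omega>. (norm (centering ** Z \<omega>))\<^sup>2)"
  shows "integrable M (\<lambda>\<omega>. (norm (centering ** (W t \<omega> ** Z \<omega>)))\<^sup>2)"
    and "(LINT \<omega>|M. (norm (centering ** (W t \<omega> ** Z \<omega>)))\<^sup>2)
      \<le> (1 - \<theta>)\<^sup>2 * (LINT \<omega>|M. (norm (centering ** Z \<omega>))\<^sup>2)"
proof -
  interpret MW: prob_space MW by (rule AE_mixing)
  note [measurable_cong] = AE_mixing(3)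
  define h :: "(real^'d^'m) \<times> (real^'m^'m) \<Rightarrow> real" where
    "h = (\<lambda>p. (norm (centering ** (snd p ** fst p)))\<^sup>2)"
  have W: "W t \<in> borel_measurable (known {Mixing t})"
    by (rule draws_known) simp
  have indep: "indep_pair borel Z borel (W t)"
    by (rule indep_pair_known[OF Z W]) (auto simp: present_def past_def)
  have h [measurable]: "h \<in> borel_measurable (borel \<Otimes>\<^sub>M borel)"
    unfolding h_def by measurable
  have int_h: "integrable MW (\<lambda>A. h (z, A))" for z
  proof (rule MW.integrable_const_bound)
    show "AE A in MW. norm (h (z, A)) \<le> m * (\<Sum>j\<in>UNIV. norm (z $ j))\<^sup>2"
      using AE_mixing(1)
    proof eventually_elim
      case (elim A)
      then show ?case
        using order_trans[OF norm_sq_centering_le norm_doubly_stochastic_mult_le[of A z]]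
        by (simp add: h_def)
    qed
    show "(\<lambda>A. h (z, A)) \<in> borel_measurable MW"
      by (simp add: h_def)
  qed
  have bound: "(LINT A|MW. h (z, A)) \<le> (1 - \<theta>)\<^sup>2 * (norm (centering ** z))\<^sup>2" for z
  proof -
    have "(LINT A|MW. h (z, A)) = (LINT A|MW. (norm (A ** z - vec (row_mean z)))\<^sup>2)"
    proof (rule integral_cong_AE)
      show "AE A in MW. h (z, A) = (norm (A ** z - vec (row_mean z)))\<^sup>2"
        using AE_mixing(1)
        by eventually_elim (simp add: h_def centering_mult row_mean_doubly_stochastic)
    qed (simp_all add: h_def)
    then show ?thesis
      using contraction[of z] by (simp add: centering_mult)
  qed
  have k: "integrable M (\<lambda>\<omega>. (1 - \<theta>)\<^sup>2 * (norm (centering ** Z \<omega>))\<^sup>2)"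
    using int by simp
  have "integrable (distr M borel (W t)) (\<lambda>A. h (z, A))"
    "(LINT A|distr M borel (W t). h (z, A)) \<le> (1 - \<theta>)\<^sup>2 * (norm (centering ** z))\<^sup>2" for z
    unfolding draws_distr by (rule int_h bound)+
  from indep_freezing[OF indep h _ this k]
  show "integrable M (\<lambda>\<omega>. (norm (centering ** (W t \<omega> ** Z \<omega>)))\<^sup>2)"
    "(LINT \<omega>|M. (norm (centering ** (W t \<omega> ** Z \<omega>)))\<^sup>2)
      \<le> (1 - \<theta>)\<^sup>2 * (LINT \<omega>|M. (norm (centering ** Z \<omega>))\<^sup>2)"
    by (simp_all add: h_def)
qed

definition row_noise :: "nat \<Rightarrow> 'm \<Rightarrow> 'w \<Rightarrow> real^'d" where
  "row_noise t i \<omega> = gs i (iter t \<omega> $ i) (\<xi> t i \<omega>) - gf i (iter t \<omega> $ i)"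

lemma row_noise_known: "row_noise t i \<in> borel_measurable (known (insert (Sample t i) (past t)))"
proof -
  let ?K = "known (insert (Sample t i) (past t))"
  have [measurable]: "iter t \<in> borel_measurable ?K" "\<xi> t i \<in> measurable ?K (D i)"
    by (auto intro: known_mono[OF state_known(1)] draws_known)
  have "(\<lambda>\<omega>. (iter t \<omega> $ i, \<xi> t i \<omega>)) \<in> measurable ?K (borel \<Otimes>\<^sub>M D i)"
    by measurable
  from measurable_compose[OF this gs_measurable]
  have [measurable]: "(\<lambda>\<omega>. gs i (iter t \<omega> $ i) (\<xi> t i \<omega>)) \<in> borel_measurable ?K"
    by simp
  show ?thesis unfolding row_noise_def[abs_def] by measurable
qed

lemma row_noise_measurable [measurable]: "row_noise t i \<in> borel_measurable M"
  by (rule known_measurable[OF row_noise_known])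

lemma fresh_grad_eq: "fresh_grad t \<omega> = grad_rows gf (iter t \<omega>) + (\<chi> i. row_noise t i \<omega>)"
  by (simp add: vec_eq_iff fresh_grad_def sample_grad_rows_def grad_rows_def row_noise_def)

lemma D_prob_space: "prob_space (D i)"
  and gs_integrable: "integrable (D i) (gs i y)"
  and gs_mean: "(LINT z|D i. gs i y z) = gf i y"
  and noise_integrable: "integrable (D i) (\<lambda>z. (norm (gs i y z - gf i y))\<^sup>2)"
  and noise_le: "(\<Sum>i\<in>UNIV. LINT z|D i. (norm (gs i (x $ i) z - gf i (x $ i)))\<^sup>2) \<le> m * \<sigma>\<^sup>2"
proof -
  show "prob_space (D i)" "integrable (D i) (gs i y)" "(LINT z|D i. gs i y z) = gf i y"
    using objective by (simp_all add: stochastic_objective_def)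
  show "integrable (D i) (\<lambda>z. (norm (gs i y z - gf i y))\<^sup>2)"
    using noise by (simp add: bounded_noise_def)
  have "1 / m * (\<Sum>i\<in>UNIV. LINT z|D i. (norm (gs i (x $ i) z - gf i (x $ i)))\<^sup>2) \<le> \<sigma>\<^sup>2"
    using noise by (simp add: bounded_noise_def m_def)
  then show "(\<Sum>i\<in>UNIV. LINT z|D i. (norm (gs i (x $ i) z - gf i (x $ i)))\<^sup>2) \<le> m * \<sigma>\<^sup>2"
    using m_ge_1 by (simp add: field_simps)
qed

lemma gs_row_measurable [measurable]:
  "(\<lambda>(x, z). gs i (x $ i) z) \<in> borel_measurable (borel \<Otimes>\<^sub>M D i)"
proof -
  have "(\<lambda>p :: (real^'d^'m) \<times> 's. (fst p $ i, snd p)) \<in> measurable (borel \<Otimes>\<^sub>M D i) (borel \<Otimes>\<^sub>M D i)"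
    by measurable
  from measurable_compose[OF this gs_measurable] show ?thesis
    by (simp add: case_prod_unfold)
qed

text \<open>The noise bound holds for every fixed point, hence after integrating out the samples with the
  iterate held fixed. It bounds only the sum over the agents, but since all terms are nonnegative it also
  makes each of them integrable.\<close>

lemma row_noise_second_moment:
  shows "integrable M (\<lambda>\<omega>. (norm (row_noise t i \<omega>))\<^sup>2)"
    and "(\<Sum>i\<in>UNIV. LINT \<omega>|M. (norm (row_noise t i \<omega>))\<^sup>2) \<le> m * \<sigma>\<^sup>2"
proof -
  define v where "v i y = (LINT z|D i. (norm (gs i y z - gf i y))\<^sup>2)" for i y
  have v0: "0 \<le> v i y" for i y
    by (simp add: v_def)
  have v_sum: "(\<Sum>i\<in>UNIV. v i (x $ i)) \<le> m * \<sigma>\<^sup>2" for x :: "real^'d^'m"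
    using noise_le[of x] by (simp add: v_def)
  have v_le: "v i y \<le> m * \<sigma>\<^sup>2" for i y
  proof -
    have "v i y = (\<Sum>j\<in>{i}. v j ((vec y :: real^'d^'m) $ j))" by simp
    also have "\<dots> \<le> (\<Sum>j\<in>UNIV. v j ((vec y :: real^'d^'m) $ j))"
      using v0 by (intro sum_mono2) auto
    finally show ?thesis using v_sum[of "vec y"] by simp
  qed
  have v_meas [measurable]: "v i \<in> borel_measurable borel" for i
  proof -
    interpret D: prob_space "D i" by (rule D_prob_space)
    show ?thesis unfolding v_def[abs_def] by measurable
  qed
  have int_v: "integrable M (\<lambda>\<omega>. v i (iter t \<omega> $ i))" for i
    using v_le v0 by (intro integrable_const_bound[of _ "m * \<sigma>\<^sup>2"]) auto
  have *: "integrable M (\<lambda>\<omega>. (norm (row_noise t i \<omega>))\<^sup>2)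
      \<and> (LINT \<omega>|M. (norm (row_noise t i \<omega>))\<^sup>2) \<le> (LINT \<omega>|M. v i (iter t \<omega> $ i))" for i
  proof -
    let ?h = "\<lambda>(x :: real^'d^'m, z). (norm (gs i (x $ i) z - gf i (x $ i)))\<^sup>2"
    have indep: "indep_pair borel (iter t) (D i) (\<xi> t i)"
      by (rule indep_pair_known[OF state_known(1) draws_known(1)[of t i "{Sample t i}"]])
        (auto simp: past_def)
    have h: "?h \<in> borel_measurable (borel \<Otimes>\<^sub>M D i)"
      by measurable
    show ?thesis
      using indep_freezing[OF indep h, of "\<lambda>x. v i (x $ i)"] noise_integrable int_v
      by (simp add: draws_distr v_def row_noise_def case_prod_unfold)
  qed
  show "integrable M (\<lambda>\<omega>. (norm (row_noise t i \<omega>))\<^sup>2)"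
    using * by blast
  have "(\<Sum>i\<in>UNIV. LINT \<omega>|M. (norm (row_noise t i \<omega>))\<^sup>2) \<le> (\<Sum>i\<in>UNIV. LINT \<omega>|M. v i (iter t \<omega> $ i))"
    using * by (intro sum_mono) blast
  also have "\<dots> = (LINT \<omega>|M. (\<Sum>i\<in>UNIV. v i (iter t \<omega> $ i)))"
    using int_v by (simp add: Bochner_Integration.integral_sum)
  also have "\<dots> \<le> (LINT \<omega>|M. m * \<sigma>\<^sup>2)"
    using int_v by (intro integral_mono v_sum) auto
  finally show "(\<Sum>i\<in>UNIV. LINT \<omega>|M. (norm (row_noise t i \<omega>))\<^sup>2) \<le> m * \<sigma>\<^sup>2"
    by (simp add: prob_space)
qed

text \<open>Here \<open>V\<close> may depend on the samples of the other agents in the same iteration. So this covers the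
  products with quantities of the past as well as those of the noises of two agents.\<close>

lemma row_noise_uncorrelated:
  assumes V: "V \<in> borel_measurable (known J)" and J: "past t \<subseteq> J" "Sample t i \<notin> J"
    and int: "integrable M (\<lambda>\<omega>. (norm (V \<omega>))\<^sup>2)"
  shows "integrable M (\<lambda>\<omega>. V \<omega> \<bullet> row_noise t i \<omega>)"
    and "(LINT \<omega>|M. V \<omega> \<bullet> row_noise t i \<omega>) = 0"
proof -
  let ?X = "\<lambda>\<omega>. (V \<omega>, iter t \<omega>)"
  let ?n = "\<lambda>((v :: real^'d, x :: real^'d^'m), z). gs i (x $ i) z - gf i (x $ i)"
  have [measurable]: "iter t \<in> borel_measurable (known J)"
    by (rule known_mono[OF state_known(1) J(1)])
  have X: "?X \<in> measurable (known J) (borel \<Otimes>\<^sub>M borel)"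
    using V by measurable
  have indep: "indep_pair (borel \<Otimes>\<^sub>M borel) ?X (D i) (\<xi> t i)"
    by (rule indep_pair_known[OF X draws_known(1)[of t i "{Sample t i}"]]) (auto simp: J)
  have "(\<lambda>p. (snd (fst p), snd p)) \<in> measurable ((borel \<Otimes>\<^sub>M borel) \<Otimes>\<^sub>M D i) (borel \<Otimes>\<^sub>M D i)"
    by measurable
  from measurable_compose[OF this gs_row_measurable]
  have [measurable]: "(\<lambda>p. gs i (snd (fst p) $ i) (snd p))
      \<in> borel_measurable ((borel \<Otimes>\<^sub>M borel) \<Otimes>\<^sub>M D i)"
    by simp
  have n: "?n \<in> borel_measurable ((borel \<Otimes>\<^sub>M borel) \<Otimes>\<^sub>M D i)"
    unfolding case_prod_unfold by measurable
  interpret D: prob_space "D i" by (rule D_prob_space)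
  have mean: "integrable (D i) (\<lambda>z. gs i y z - gf i y)" "(LINT z|D i. gs i y z - gf i y) = 0" for y
    using gs_integrable[of i y] gs_mean[of i y] by (simp_all add: D.prob_space)
  have "integrable M (\<lambda>\<omega>. (norm (?n (?X \<omega>, \<xi> t i \<omega>)))\<^sup>2)"
    using row_noise_second_moment(1)[of t i] by (simp add: row_noise_def)
  then show "integrable M (\<lambda>\<omega>. V \<omega> \<bullet> row_noise t i \<omega>)"
    "(LINT \<omega>|M. V \<omega> \<bullet> row_noise t i \<omega>) = 0"
    using indep_uncorrelated[OF indep measurable_fst n] int mean
    by (simp_all add: draws_distr row_noise_def case_prod_unfold)
qed

subsection \<open>One iteration in expectation\<close>

definition opt_err :: "nat \<Rightarrow> 'w \<Rightarrow> real" where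
  "opt_err t \<omega> = (norm (row_mean (iter t \<omega>) - xstar))\<^sup>2"

definition cons_err :: "nat \<Rightarrow> 'w \<Rightarrow> real" where
  "cons_err t \<omega> = (norm (centering ** iter t \<omega>))\<^sup>2"

definition track_err :: "nat \<Rightarrow> 'w \<Rightarrow> real" where
  "track_err t \<omega> = (norm (centering ** tracker t \<omega>))\<^sup>2"

definition obj_gap :: "nat \<Rightarrow> 'w \<Rightarrow> real" where
  "obj_gap t \<omega> = F (row_mean (iter t \<omega>)) - F xstar"

definition anchor_noise :: "nat \<Rightarrow> 'w \<Rightarrow> real" where
  "anchor_noise t \<omega> = (norm (anchor_grad t \<omega> - grad_rows gf (anchor t \<omega>)))\<^sup>2"

definition fresh_noise :: "nat \<Rightarrow> 'w \<Rightarrow> real" where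
  "fresh_noise t \<omega> = (norm (fresh_grad t \<omega> - grad_rows gf (iter t \<omega>)))\<^sup>2"

lemma grad_gap_measurable [measurable (raw)]:
  assumes [measurable]: "X \<in> borel_measurable N"
  shows "(\<lambda>\<omega>. grad_gap (X \<omega>)) \<in> borel_measurable N"
  unfolding grad_gap_def by measurable

lemma errors_measurable [measurable]:
  "opt_err t \<in> borel_measurable M" "cons_err t \<in> borel_measurable M"
  "track_err t \<in> borel_measurable M" "obj_gap t \<in> borel_measurable M"
  "anchor_noise t \<in> borel_measurable M" "fresh_noise t \<in> borel_measurable M"
  unfolding opt_err_def[abs_def] cons_err_def[abs_def] track_err_def[abs_def] obj_gap_def[abs_def]
    anchor_noise_def[abs_def] fresh_noise_def[abs_def]
  by measurable

lemma obj_gap_bounds: "0 \<le> obj_gap t \<omega>" "obj_gap t \<omega> \<le> L / 2 * opt_err t \<omega>"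
  using F_le F_gap_upper by (auto simp: obj_gap_def opt_err_def)

lemma integrable_nonneg_bound:
  fixes u v :: "'w \<Rightarrow> real"
  assumes "integrable M v" "u \<in> borel_measurable M" "\<And>\<omega>. 0 \<le> u \<omega>" "\<And>\<omega>. u \<omega> \<le> v \<omega>"
  shows "integrable M u"
  using assms(1,2)
proof (rule Bochner_Integration.integrable_bound)
  show "AE \<omega> in M. norm (u \<omega>) \<le> norm (v \<omega>)"
    using assms(3) order_trans[OF assms(4) abs_ge_self] by simp
qed

lemma obj_gap_integrable:
  assumes "integrable M (opt_err t)"
  shows "integrable M (obj_gap t)"
proof (rule integrable_nonneg_bound[OF _ _ obj_gap_bounds])
  show "integrable M (\<lambda>\<omega>. L / 2 * opt_err t \<omega>)"
    using assms by simp
qed measurable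

lemma iter_grad_gap_integrable:
  assumes "integrable M (opt_err t)" "integrable M (cons_err t)"
  shows "integrable M (\<lambda>\<omega>. grad_gap (iter t \<omega>))"
    and "(LINT \<omega>|M. grad_gap (iter t \<omega>))
      \<le> 2 * L\<^sup>2 * (LINT \<omega>|M. cons_err t \<omega>) + 4 * L * m * (LINT \<omega>|M. obj_gap t \<omega>)"
proof -
  note gap = obj_gap_integrable[OF assms(1)]
  let ?b = "\<lambda>\<omega>. 2 * L\<^sup>2 * cons_err t \<omega> + 4 * L * m * obj_gap t \<omega>"
  have int: "integrable M ?b"
    using gap assms by simp
  have le: "grad_gap (iter t \<omega>) \<le> ?b \<omega>" for \<omega>
    using grad_gap_le[of "iter t \<omega>"] by (simp add: cons_err_def obj_gap_def)
  show int': "integrable M (\<lambda>\<omega>. grad_gap (iter t \<omega>))"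
    by (rule integrable_nonneg_bound[OF int _ _ le]) (auto simp: grad_gap_def)
  have "(LINT \<omega>|M. grad_gap (iter t \<omega>)) \<le> (LINT \<omega>|M. ?b \<omega>)"
    using int' int le by (intro integral_mono)
  also have "\<dots> = 2 * L\<^sup>2 * (LINT \<omega>|M. cons_err t \<omega>) + 4 * L * m * (LINT \<omega>|M. obj_gap t \<omega>)"
    using gap assms by simp
  finally show "(LINT \<omega>|M. grad_gap (iter t \<omega>))
      \<le> 2 * L\<^sup>2 * (LINT \<omega>|M. cons_err t \<omega>) + 4 * L * m * (LINT \<omega>|M. obj_gap t \<omega>)" .
qed

lemma fresh_noise_integrable: "integrable M (fresh_noise t)"
  and fresh_noise_le: "(LINT \<omega>|M. fresh_noise t \<omega>) \<le> m * \<sigma>\<^sup>2"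
proof -
  have eq: "fresh_noise t = (\<lambda>\<omega>. \<Sum>i\<in>UNIV. (norm (row_noise t i \<omega>))\<^sup>2)"
    by (auto simp: fresh_noise_def fresh_grad_eq norm_sq_rows)
  show "integrable M (fresh_noise t)"
    unfolding eq by (rule Bochner_Integration.integrable_sum) (rule row_noise_second_moment(1))
  show "(LINT \<omega>|M. fresh_noise t \<omega>) \<le> m * \<sigma>\<^sup>2"
    unfolding eq
    by (subst Bochner_Integration.integral_sum) (rule row_noise_second_moment)+
qed

text \<open>Mixing preserves the mean of the rows, so the mean of the tracker is always the mean of the
  anchor gradient and the two cancel in the mean of the iterate.\<close>

lemma AE_tracker_mean: "AE \<omega> in M. row_mean (tracker t \<omega>) = row_mean (anchor_grad t \<omega>)"
proof (induction t)
  case 0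
  show ?case by (simp add: state_0)
next
  case (Suc t)
  from Suc AE_W_doubly_stochastic[of t] show ?case
  proof eventually_elim
    case (elim \<omega>)
    then show ?case
      by (simp add: state_Suc increment_def row_mean_add row_mean_diff row_mean_scaleR
          row_mean_doubly_stochastic)
  qed
qed

lemma AE_iter_mean:
  "AE \<omega> in M. row_mean (iter (Suc t) \<omega>) = row_mean (iter t \<omega>) - \<eta> t *\<^sub>R row_mean (fresh_grad t \<omega>)"
  using AE_tracker_mean[of t] AE_W_doubly_stochastic[of t]
proof eventually_elim
  case (elim \<omega>)
  then show ?case
    by (simp add: state_Suc increment_def row_mean_add row_mean_diff row_mean_scaleR
        row_mean_doubly_stochastic)
qed

text \<open>The noise of the \<open>m\<close> agents is uncorrelated, so averaging it divides the variance by \<open>m\<close>.\<close>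

lemma opt_err_step:
  assumes int: "integrable M (opt_err t)" "integrable M (cons_err t)"
  shows "integrable M (opt_err (Suc t))"
    and "(LINT \<omega>|M. opt_err (Suc t) \<omega>)
      \<le> (1 - \<eta> t * \<mu>) * (LINT \<omega>|M. opt_err t \<omega>)
        - (2 * \<eta> t - 4 * L * (\<eta> t)\<^sup>2) * (LINT \<omega>|M. obj_gap t \<omega>)
        + (\<eta> t * L + 2 * (\<eta> t)\<^sup>2 * L\<^sup>2) * ((LINT \<omega>|M. cons_err t \<omega>) / m) + (\<eta> t)\<^sup>2 * (\<sigma>\<^sup>2 / m)"
proof -
  define a where "a \<omega> = row_mean (iter t \<omega>) - xstar - \<eta> t *\<^sub>R row_mean (grad_rows gf (iter t \<omega>))" for \<omega>
  define c where "c = \<eta> t / m"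
  note gap = obj_gap_integrable[OF int(1)]
  note [measurable] = state_known(1)[of t]
  have a_known: "a \<in> borel_measurable (known (past t))"
    unfolding a_def[abs_def] by measurable
  note [measurable] = known_measurable[OF a_known]
  let ?b = "\<lambda>\<omega>. (1 - \<eta> t * \<mu>) * opt_err t \<omega> - (2 * \<eta> t - 4 * L * (\<eta> t)\<^sup>2) * obj_gap t \<omega>
      + (\<eta> t * L + 2 * (\<eta> t)\<^sup>2 * L\<^sup>2) * (cons_err t \<omega> / m)"
  have le: "(norm (a \<omega>))\<^sup>2 \<le> ?b \<omega>" for \<omega>
    using mean_gradient_step[of "\<eta> t" "iter t \<omega>"] step_pos[of t]
    by (simp add: a_def opt_err_def obj_gap_def cons_err_def)
  have int_b: "integrable M ?b"
    using int gap by simp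
  have int_a: "integrable M (\<lambda>\<omega>. (norm (a \<omega>))\<^sup>2)"
    by (rule integrable_nonneg_bound[OF int_b _ _ le]) auto
  have a_noise: "integrable M (\<lambda>\<omega>. a \<omega> \<bullet> row_noise t i \<omega>)"
    "(LINT \<omega>|M. a \<omega> \<bullet> row_noise t i \<omega>) = 0" for i
    by (rule row_noise_uncorrelated[OF a_known _ _ int_a]; simp add: past_def)+
  have noise_noise: "integrable M (\<lambda>\<omega>. row_noise t i \<omega> \<bullet> row_noise t j \<omega>)
      \<and> (LINT \<omega>|M. row_noise t i \<omega> \<bullet> row_noise t j \<omega>)
        = (if i = j then (LINT \<omega>|M. (norm (row_noise t i \<omega>))\<^sup>2) else 0)" for i j
  proof (cases "i = j")
    case True
    then show ?thesis
      using row_noise_second_moment(1)[of t i] by (simp add: power2_norm_eq_inner)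
  next
    case False
    then have "past t \<subseteq> insert (Sample t i) (past t)" "Sample t j \<notin> insert (Sample t i) (past t)"
      by (auto simp: past_def)
    from row_noise_uncorrelated[OF row_noise_known this row_noise_second_moment(1)] show ?thesis
      using False by simp
  qed
  let ?n = "\<lambda>\<omega>. \<Sum>i\<in>UNIV. row_noise t i \<omega>"
  have expand: "(norm (a \<omega> - c *\<^sub>R ?n \<omega>))\<^sup>2 = (norm (a \<omega>))\<^sup>2 - 2 * c * (\<Sum>i\<in>UNIV. a \<omega> \<bullet> row_noise t i \<omega>)
      + c\<^sup>2 * (\<Sum>i\<in>UNIV. \<Sum>j\<in>UNIV. row_noise t i \<omega> \<bullet> row_noise t j \<omega>)" for \<omega>
  proof -
    have sq: "(norm (u - c *\<^sub>R v))\<^sup>2 = (norm u)\<^sup>2 - 2 * c * (u \<bullet> v) + c\<^sup>2 * (v \<bullet> v)"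
      for u v :: "real^'d"
      unfolding power2_norm_eq_inner
      by (simp add: inner_diff_left inner_diff_right inner_commute power2_eq_square)
    have an: "a \<omega> \<bullet> ?n \<omega> = (\<Sum>i\<in>UNIV. a \<omega> \<bullet> row_noise t i \<omega>)"
      by (rule inner_sum_right)
    have nn: "?n \<omega> \<bullet> ?n \<omega> = (\<Sum>i\<in>UNIV. \<Sum>j\<in>UNIV. row_noise t i \<omega> \<bullet> row_noise t j \<omega>)"
      by (subst inner_sum_left, subst inner_sum_right) (rule refl)
    show ?thesis
      by (rule sq[of "a \<omega>" "?n \<omega>", unfolded an nn])
  qed
  have AE: "AE \<omega> in M. opt_err (Suc t) \<omega> = (norm (a \<omega> - c *\<^sub>R ?n \<omega>))\<^sup>2"
    using AE_iter_mean[of t]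
  proof eventually_elim
    case (elim \<omega>)
    have "row_mean (fresh_grad t \<omega>) = row_mean (grad_rows gf (iter t \<omega>)) + (1 / m) *\<^sub>R ?n \<omega>"
      unfolding fresh_grad_eq row_mean_add by (simp add: row_mean_def m_def)
    then have "row_mean (iter (Suc t) \<omega>) - xstar = a \<omega> - c *\<^sub>R ?n \<omega>"
      unfolding elim by (simp add: a_def c_def scaleR_add_right)
    then show ?case by (simp add: opt_err_def)
  qed
  let ?A = "\<lambda>\<omega>. \<Sum>i\<in>UNIV. a \<omega> \<bullet> row_noise t i \<omega>"
    and ?N = "\<lambda>\<omega>. \<Sum>i\<in>UNIV. \<Sum>j\<in>UNIV. row_noise t i \<omega> \<bullet> row_noise t j \<omega>"
  have A: "integrable M ?A" "(LINT \<omega>|M. ?A \<omega>) = 0"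
  proof -
    show "integrable M ?A"
      by (rule Bochner_Integration.integrable_sum) (rule a_noise)
    have "(LINT \<omega>|M. ?A \<omega>) = (\<Sum>i\<in>UNIV. LINT \<omega>|M. a \<omega> \<bullet> row_noise t i \<omega>)"
      by (rule Bochner_Integration.integral_sum) (rule a_noise)
    then show "(LINT \<omega>|M. ?A \<omega>) = 0"
      by (simp only: a_noise(2) sum.neutral_const)
  qed
  have N: "integrable M ?N" "(LINT \<omega>|M. ?N \<omega>) = (\<Sum>i\<in>UNIV. LINT \<omega>|M. (norm (row_noise t i \<omega>))\<^sup>2)"
  proof -
    have row: "integrable M (\<lambda>\<omega>. \<Sum>j\<in>UNIV. row_noise t i \<omega> \<bullet> row_noise t j \<omega>)" for i
      by (rule Bochner_Integration.integrable_sum) (rule noise_noise[THEN conjunct1])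
    then show "integrable M ?N"
      by (rule Bochner_Integration.integrable_sum)
    have "(LINT \<omega>|M. (\<Sum>j\<in>UNIV. row_noise t i \<omega> \<bullet> row_noise t j \<omega>))
        = (LINT \<omega>|M. (norm (row_noise t i \<omega>))\<^sup>2)" for i
    proof -
      have "(LINT \<omega>|M. (\<Sum>j\<in>UNIV. row_noise t i \<omega> \<bullet> row_noise t j \<omega>))
          = (\<Sum>j\<in>UNIV. LINT \<omega>|M. row_noise t i \<omega> \<bullet> row_noise t j \<omega>)"
        by (rule Bochner_Integration.integral_sum) (rule noise_noise[THEN conjunct1])
      also have "\<dots> = (\<Sum>j\<in>UNIV. if i = j then (LINT \<omega>|M. (norm (row_noise t i \<omega>))\<^sup>2) else 0)"
        by (simp only: noise_noise[THEN conjunct2])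
      finally show ?thesis by simp
    qed
    moreover have "(LINT \<omega>|M. ?N \<omega>)
        = (\<Sum>i\<in>UNIV. LINT \<omega>|M. (\<Sum>j\<in>UNIV. row_noise t i \<omega> \<bullet> row_noise t j \<omega>))"
      by (rule Bochner_Integration.integral_sum) (rule row)
    ultimately show "(LINT \<omega>|M. ?N \<omega>) = (\<Sum>i\<in>UNIV. LINT \<omega>|M. (norm (row_noise t i \<omega>))\<^sup>2)"
      by (simp only:)
  qed
  have int_cA: "integrable M (\<lambda>\<omega>. 2 * c * ?A \<omega>)" and int_cN: "integrable M (\<lambda>\<omega>. c\<^sup>2 * ?N \<omega>)"
    by (rule integrable_mult_right, rule A N)+
  have int_expand: "integrable M (\<lambda>\<omega>. (norm (a \<omega> - c *\<^sub>R ?n \<omega>))\<^sup>2)"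
    unfolding expand
    by (intro Bochner_Integration.integrable_add Bochner_Integration.integrable_diff int_a int_cA int_cN)
  show "integrable M (opt_err (Suc t))"
  proof (rule integrable_cong_AE_imp[OF int_expand])
    show "AE \<omega> in M. (norm (a \<omega> - c *\<^sub>R ?n \<omega>))\<^sup>2 = opt_err (Suc t) \<omega>"
      using AE by eventually_elim (rule sym)
  qed measurable
  have "(LINT \<omega>|M. opt_err (Suc t) \<omega>) = (LINT \<omega>|M. (norm (a \<omega> - c *\<^sub>R ?n \<omega>))\<^sup>2)"
    by (rule integral_cong_AE[OF _ _ AE]) measurable
  also have "\<dots> = (LINT \<omega>|M. (norm (a \<omega>))\<^sup>2)
      + c\<^sup>2 * (\<Sum>i\<in>UNIV. LINT \<omega>|M. (norm (row_noise t i \<omega>))\<^sup>2)"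
  proof -
    have "(LINT \<omega>|M. (norm (a \<omega> - c *\<^sub>R ?n \<omega>))\<^sup>2)
        = (LINT \<omega>|M. (norm (a \<omega>))\<^sup>2) - (LINT \<omega>|M. 2 * c * ?A \<omega>) + (LINT \<omega>|M. c\<^sup>2 * ?N \<omega>)"
      unfolding expand
      by (simp only: Bochner_Integration.integral_add Bochner_Integration.integral_diff
          Bochner_Integration.integrable_diff int_a int_cA int_cN)
    also have "(LINT \<omega>|M. 2 * c * ?A \<omega>) = 0"
      unfolding integral_mult_right_zero A by simp
    also have "(LINT \<omega>|M. c\<^sup>2 * ?N \<omega>) = c\<^sup>2 * (\<Sum>i\<in>UNIV. LINT \<omega>|M. (norm (row_noise t i \<omega>))\<^sup>2)"
      unfolding integral_mult_right_zero N ..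
    finally show ?thesis by simp
  qed
  also have "\<dots> \<le> (LINT \<omega>|M. ?b \<omega>) + c\<^sup>2 * (m * \<sigma>\<^sup>2)"
    by (intro add_mono integral_mono[OF int_a int_b le] mult_left_mono[OF row_noise_second_moment(2)])
      simp
  also have "c\<^sup>2 * (m * \<sigma>\<^sup>2) = (\<eta> t)\<^sup>2 * (\<sigma>\<^sup>2 / m)"
    using m_ge_1 by (simp add: c_def power2_eq_square)
  also have "(LINT \<omega>|M. ?b \<omega>) = (1 - \<eta> t * \<mu>) * (LINT \<omega>|M. opt_err t \<omega>)
        - (2 * \<eta> t - 4 * L * (\<eta> t)\<^sup>2) * (LINT \<omega>|M. obj_gap t \<omega>)
        + (\<eta> t * L + 2 * (\<eta> t)\<^sup>2 * L\<^sup>2) * ((LINT \<omega>|M. cons_err t \<omega>) / m)"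
    using int gap by simp
  finally show "(LINT \<omega>|M. opt_err (Suc t) \<omega>)
      \<le> (1 - \<eta> t * \<mu>) * (LINT \<omega>|M. opt_err t \<omega>)
        - (2 * \<eta> t - 4 * L * (\<eta> t)\<^sup>2) * (LINT \<omega>|M. obj_gap t \<omega>)
        + (\<eta> t * L + 2 * (\<eta> t)\<^sup>2 * L\<^sup>2) * ((LINT \<omega>|M. cons_err t \<omega>) / m) + (\<eta> t)\<^sup>2 * (\<sigma>\<^sup>2 / m)" .
qed

text \<open>The iterate depends on the samples at the anchor, so the noise at the anchor cannot be separated
  by independence, and all four contributions are simply added up. The loss is harmless because the
  increment enters the recursion with a factor \<open>\<eta>\<^sup>2\<close>.\<close>

lemma increment_second_moment:
  assumes int: "integrable M (\<lambda>\<omega>. grad_gap (iter t \<omega>))" "integrable M (\<lambda>\<omega>. grad_gap (anchor t \<omega>))"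
      "integrable M (anchor_noise t)"
    and noise_le: "(LINT \<omega>|M. anchor_noise t \<omega>) \<le> m * \<sigma>\<^sup>2"
  shows "integrable M (\<lambda>\<omega>. (norm (centering ** increment t \<omega>))\<^sup>2)"
    and "(LINT \<omega>|M. (norm (centering ** increment t \<omega>))\<^sup>2)
      \<le> 4 * ((LINT \<omega>|M. grad_gap (iter t \<omega>)) + (LINT \<omega>|M. grad_gap (anchor t \<omega>)) + 2 * (m * \<sigma>\<^sup>2))"
proof -
  let ?b = "\<lambda>\<omega>. 4 * (grad_gap (iter t \<omega>) + grad_gap (anchor t \<omega>) + (fresh_noise t \<omega> + anchor_noise t \<omega>))"
  have le: "(norm (centering ** increment t \<omega>))\<^sup>2 \<le> ?b \<omega>" for \<omega>
  proof -
    let ?s = "grad_rows gf (vec xstar)"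
    let ?A = "grad_rows gf (iter t \<omega>) - ?s" and ?B = "grad_rows gf (anchor t \<omega>) - ?s"
    let ?n = "fresh_grad t \<omega> - grad_rows gf (iter t \<omega>)"
      and ?e = "anchor_grad t \<omega> - grad_rows gf (anchor t \<omega>)"
    have "increment t \<omega> = (?A - ?B) + (?n - ?e)"
      by (simp add: increment_def)
    then have "(norm (increment t \<omega>))\<^sup>2 \<le> 2 * (norm (?A - ?B))\<^sup>2 + 2 * (norm (?n - ?e))\<^sup>2"
      using norm_sq_add_le by metis
    moreover have "s \<le> 4 * (a + b + (c + d))"
      if "s \<le> 2 * p + 2 * q" "p \<le> 2 * a + 2 * b" "q \<le> 2 * c + 2 * d" for s p q a b c d :: real
      using that by simp
    ultimately have "(norm (increment t \<omega>))\<^sup>2 \<le> ?b \<omega>"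
      using norm_sq_diff_le[of ?A ?B] norm_sq_diff_le[of ?n ?e]
      unfolding grad_gap_def fresh_noise_def anchor_noise_def by blast
    then show ?thesis
      using norm_sq_centering_le by (rule order_trans[rotated])
  qed
  have int_b: "integrable M ?b"
    using int fresh_noise_integrable by simp
  show int_i: "integrable M (\<lambda>\<omega>. (norm (centering ** increment t \<omega>))\<^sup>2)"
    by (rule integrable_nonneg_bound[OF int_b _ _ le]) auto
  have "(LINT \<omega>|M. (norm (centering ** increment t \<omega>))\<^sup>2) \<le> (LINT \<omega>|M. ?b \<omega>)"
    using int_i int_b le by (intro integral_mono)
  also have "\<dots> = 4 * ((LINT \<omega>|M. grad_gap (iter t \<omega>)) + (LINT \<omega>|M. grad_gap (anchor t \<omega>))
      + ((LINT \<omega>|M. fresh_noise t \<omega>) + (LINT \<omega>|M. anchor_noise t \<omega>)))"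
    using int fresh_noise_integrable by simp
  finally show "(LINT \<omega>|M. (norm (centering ** increment t \<omega>))\<^sup>2)
      \<le> 4 * ((LINT \<omega>|M. grad_gap (iter t \<omega>)) + (LINT \<omega>|M. grad_gap (anchor t \<omega>)) + 2 * (m * \<sigma>\<^sup>2))"
    using fresh_noise_le[of t] noise_le by simp
qed

text \<open>The mixing contracts the result of the local step, and the factor \<open>(1 - \<theta>)\<^sup>2\<close> is split so
  that the old consensus error keeps \<open>1 - \<theta>\<close> and the step gets \<open>1 / \<theta>\<close>.\<close>

lemma cons_err_step:
  assumes int: "integrable M (cons_err t)" "integrable M (track_err t)"
      "integrable M (\<lambda>\<omega>. (norm (centering ** increment t \<omega>))\<^sup>2)"
  shows "integrable M (cons_err (Suc t))"
    and "(LINT \<omega>|M. cons_err (Suc t) \<omega>) \<le> (1 - \<theta>) * (LINT \<omega>|M. cons_err t \<omega>)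
      + 2 * (\<eta> t)\<^sup>2 / \<theta> * ((LINT \<omega>|M. track_err t \<omega>)
        + (LINT \<omega>|M. (norm (centering ** increment t \<omega>))\<^sup>2))"
proof -
  let ?I = "\<lambda>\<omega>. (norm (centering ** increment t \<omega>))\<^sup>2"
  define Z where "Z \<omega> = iter t \<omega> - \<eta> t *\<^sub>R (tracker t \<omega> + increment t \<omega>)" for \<omega>
  have Z: "Z \<in> borel_measurable (known (insert (Coin t) (present t)))"
  proof -
    note [measurable] = known_mono[OF state_known(1) past_Suc(3)] state_known(3)[of t] increment_known[of t]
    have "Z \<in> borel_measurable (known (present t))"
      unfolding Z_def[abs_def] by measurable
    then show ?thesis by (rule known_mono) auto
  qed
  have CZ: "centering ** Z \<omega> = centering ** iter t \<omega>
      - \<eta> t *\<^sub>R (centering ** tracker t \<omega> + centering ** increment t \<omega>)" for \<omega>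
    by (simp add: Z_def centering_diff centering_scaleR centering_add)
  have sum_le: "(norm (centering ** tracker t \<omega> + centering ** increment t \<omega>))\<^sup>2
      \<le> 2 * track_err t \<omega> + 2 * ?I \<omega>" for \<omega>
    unfolding track_err_def by (rule norm_sq_add_le)
  have int_Z: "integrable M (\<lambda>\<omega>. (norm (centering ** Z \<omega>))\<^sup>2)"
  proof (rule integrable_nonneg_bound)
    show "integrable M (\<lambda>\<omega>. 2 * cons_err t \<omega> + 2 * ((\<eta> t)\<^sup>2 * (2 * track_err t \<omega> + 2 * ?I \<omega>)))"
      using int by simp
    show "(\<lambda>\<omega>. (norm (centering ** Z \<omega>))\<^sup>2) \<in> borel_measurable M"
      using known_measurable[OF Z] by measurable
    show "(norm (centering ** Z \<omega>))\<^sup>2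
        \<le> 2 * cons_err t \<omega> + 2 * ((\<eta> t)\<^sup>2 * (2 * track_err t \<omega> + 2 * ?I \<omega>))" for \<omega>
    proof -
      have "(norm (centering ** Z \<omega>))\<^sup>2 \<le> 2 * cons_err t \<omega>
          + 2 * (norm (\<eta> t *\<^sub>R (centering ** tracker t \<omega> + centering ** increment t \<omega>)))\<^sup>2"
        unfolding CZ cons_err_def by (rule norm_sq_diff_le)
      also have "(norm (\<eta> t *\<^sub>R (centering ** tracker t \<omega> + centering ** increment t \<omega>)))\<^sup>2
          \<le> (\<eta> t)\<^sup>2 * (2 * track_err t \<omega> + 2 * ?I \<omega>)"
        using sum_le by (simp add: power_mult_distrib mult_left_mono)
      finally show ?thesis by simp
    qed
  qed simp
  have pointwise: "(1 - \<theta>)\<^sup>2 * (norm (centering ** Z \<omega>))\<^sup>2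
      \<le> (1 - \<theta>) * cons_err t \<omega> + 2 * (\<eta> t)\<^sup>2 / \<theta> * (track_err t \<omega> + ?I \<omega>)" for \<omega>
  proof -
    have "(1 - \<theta>)\<^sup>2 * (norm (centering ** Z \<omega>))\<^sup>2 \<le> (1 - \<theta>) * cons_err t \<omega>
        + (norm (\<eta> t *\<^sub>R (centering ** tracker t \<omega> + centering ** increment t \<omega>)))\<^sup>2 / \<theta>"
      unfolding CZ cons_err_def by (rule contracted_norm_sq_diff_le[OF theta_pos theta_le_1])
    also have "(norm (\<eta> t *\<^sub>R (centering ** tracker t \<omega> + centering ** increment t \<omega>)))\<^sup>2 / \<theta>
        \<le> (\<eta> t)\<^sup>2 * (2 * track_err t \<omega> + 2 * ?I \<omega>) / \<theta>"
      using sum_le theta_pos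
      by (intro divide_right_mono) (auto simp: power_mult_distrib intro!: mult_left_mono)
    finally show ?thesis by (simp add: algebra_simps add_divide_distrib)
  qed
  have eq: "cons_err (Suc t) = (\<lambda>\<omega>. (norm (centering ** (W t \<omega> ** Z \<omega>)))\<^sup>2)"
    by (auto simp: cons_err_def state_Suc Z_def)
  note mix = mixing_contracts[OF Z int_Z]
  show "integrable M (cons_err (Suc t))"
    unfolding eq by (rule mix)
  have "(LINT \<omega>|M. cons_err (Suc t) \<omega>) \<le> (LINT \<omega>|M. (1 - \<theta>)\<^sup>2 * (norm (centering ** Z \<omega>))\<^sup>2)"
    unfolding eq using mix(2) by simp
  also have "\<dots> \<le> (LINT \<omega>|M. (1 - \<theta>) * cons_err t \<omega> + 2 * (\<eta> t)\<^sup>2 / \<theta> * (track_err t \<omega> + ?I \<omega>))"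
    using int int_Z pointwise by (intro integral_mono) auto
  also have "\<dots> = (1 - \<theta>) * (LINT \<omega>|M. cons_err t \<omega>)
      + 2 * (\<eta> t)\<^sup>2 / \<theta> * ((LINT \<omega>|M. track_err t \<omega>) + (LINT \<omega>|M. ?I \<omega>))"
    using int by simp
  finally show "(LINT \<omega>|M. cons_err (Suc t) \<omega>) \<le> (1 - \<theta>) * (LINT \<omega>|M. cons_err t \<omega>)
      + 2 * (\<eta> t)\<^sup>2 / \<theta> * ((LINT \<omega>|M. track_err t \<omega>) + (LINT \<omega>|M. ?I \<omega>))" .
qed

text \<open>The square of the sum is expanded only when the coin shows a refresh. Then the old tracking
  error gets the factor \<open>1 + \<zeta>\<close> and the increment the factor \<open>2 * \<zeta>\<close>; in expectation the first is
  compensated by the contraction, as \<open>(1 - \<theta>)\<^sup>2 * (1 + \<theta>) \<le> 1 - \<theta>\<close>, and the second is only \<open>2 * \<theta>\<close>.\<close>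

lemma track_err_step:
  assumes int: "integrable M (track_err t)"
      "integrable M (\<lambda>\<omega>. (norm (centering ** increment t \<omega>))\<^sup>2)"
  shows "integrable M (track_err (Suc t))"
    and "(LINT \<omega>|M. track_err (Suc t) \<omega>) \<le> (1 - \<theta>) * (LINT \<omega>|M. track_err t \<omega>)
      + 2 * \<theta> * (LINT \<omega>|M. (norm (centering ** increment t \<omega>))\<^sup>2)"
proof -
  let ?I = "\<lambda>\<omega>. (norm (centering ** increment t \<omega>))\<^sup>2"
  let ?b = "\<lambda>\<omega>. of_bool (\<zeta> t \<omega>) :: real"
  let ?P = "known (present t)" and ?C = "known (insert (Coin t) (present t))"
  note [measurable] = state_known(3)[of t] increment_known[of t]
  have T_known: "track_err t \<in> borel_measurable ?P" "?I \<in> borel_measurable ?P"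
    unfolding track_err_def[abs_def] by measurable
  \<comment> \<open>The product of the coin with the mixed tracker is the mixed product, so the contraction applies
    to it although the coin is random.\<close>
  define Z where "Z \<omega> = ?b \<omega> *\<^sub>R tracker t \<omega>" for \<omega>
  have tracker_C [measurable]: "tracker t \<in> borel_measurable ?C"
    by (rule known_mono[OF state_known(3)]) auto
  have [measurable]: "\<zeta> t \<in> measurable ?C (count_space UNIV)"
    by (rule draws_known) simp
  have Z: "Z \<in> borel_measurable ?C"
    unfolding Z_def[abs_def] by measurable
  have norm_Z: "(norm (centering ** Z \<omega>))\<^sup>2 = ?b \<omega> * track_err t \<omega>" for \<omega>
    by (simp add: Z_def track_err_def centering_scaleR)
  note coin_T = coin_expectation[OF T_known(1) int(1)]
    and coin_I = coin_expectation[OF T_known(2) int(2)]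
  have int_Z: "integrable M (\<lambda>\<omega>. (norm (centering ** Z \<omega>))\<^sup>2)"
    unfolding norm_Z by (rule coin_T)
  have int_T: "integrable M (\<lambda>\<omega>. (norm (centering ** tracker t \<omega>))\<^sup>2)"
    using int(1) by (simp add: track_err_def[abs_def])
  note mixT = mixing_contracts[OF tracker_C int_T] and mixZ = mixing_contracts[OF Z int_Z]
  let ?u = "\<lambda>\<omega>. (norm (centering ** (W t \<omega> ** tracker t \<omega>)))\<^sup>2
      + (norm (centering ** (W t \<omega> ** Z \<omega>)))\<^sup>2 + 2 * (?b \<omega> * ?I \<omega>)"
  have le: "track_err (Suc t) \<omega> \<le> ?u \<omega>" for \<omega>
  proof (cases "\<zeta> t \<omega>")
    case True
    then show ?thesis
      using norm_sq_add_le[of "centering ** (W t \<omega> ** tracker t \<omega>)" "centering ** increment t \<omega>"]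
      by (simp add: track_err_def state_Suc Z_def centering_add)
  next
    case False
    then show ?thesis
      by (simp add: track_err_def state_Suc)
  qed
  have int_u: "integrable M ?u"
    using mixT(1) mixZ(1) coin_I(1) by simp
  show int': "integrable M (track_err (Suc t))"
    by (rule integrable_nonneg_bound[OF int_u _ _ le]) (auto simp: track_err_def)
  have "(LINT \<omega>|M. track_err (Suc t) \<omega>) \<le> (LINT \<omega>|M. ?u \<omega>)"
    using int' int_u le by (intro integral_mono)
  also have "\<dots> = (LINT \<omega>|M. (norm (centering ** (W t \<omega> ** tracker t \<omega>)))\<^sup>2)
      + (LINT \<omega>|M. (norm (centering ** (W t \<omega> ** Z \<omega>)))\<^sup>2) + 2 * (\<theta> * (LINT \<omega>|M. ?I \<omega>))"
    using mixT(1) mixZ(1) coin_I by simp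
  also have "\<dots> \<le> (1 - \<theta>)\<^sup>2 * (LINT \<omega>|M. track_err t \<omega>)
      + (1 - \<theta>)\<^sup>2 * (\<theta> * (LINT \<omega>|M. track_err t \<omega>)) + 2 * (\<theta> * (LINT \<omega>|M. ?I \<omega>))"
    using mixT(2) mixZ(2) unfolding norm_Z coin_T(2) by (simp add: track_err_def[abs_def])
  also have "\<dots> = (1 - \<theta>) * (1 - \<theta>\<^sup>2) * (LINT \<omega>|M. track_err t \<omega>) + 2 * \<theta> * (LINT \<omega>|M. ?I \<omega>)"
    by (simp add: power2_eq_square algebra_simps)
  also have "\<dots> \<le> (1 - \<theta>) * 1 * (LINT \<omega>|M. track_err t \<omega>) + 2 * \<theta> * (LINT \<omega>|M. ?I \<omega>)"
    using theta_le_1 by (intro add_right_mono mult_right_mono mult_left_mono) (auto simp: track_err_def)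
  finally show "(LINT \<omega>|M. track_err (Suc t) \<omega>) \<le> (1 - \<theta>) * (LINT \<omega>|M. track_err t \<omega>)
      + 2 * \<theta> * (LINT \<omega>|M. ?I \<omega>)" by simp
qed

lemma anchor_gap_step:
  assumes "integrable M (\<lambda>\<omega>. grad_gap (iter t \<omega>))" "integrable M (\<lambda>\<omega>. grad_gap (anchor t \<omega>))"
  shows "integrable M (\<lambda>\<omega>. grad_gap (anchor (Suc t) \<omega>))"
    and "(LINT \<omega>|M. grad_gap (anchor (Suc t) \<omega>))
      = \<theta> * (LINT \<omega>|M. grad_gap (iter t \<omega>)) + (1 - \<theta>) * (LINT \<omega>|M. grad_gap (anchor t \<omega>))"
proof -
  note [measurable] = known_mono[OF state_known(1) past_Suc(3)] known_mono[OF state_known(2) past_Suc(3)]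
  have eq: "(\<lambda>\<omega>. grad_gap (anchor (Suc t) \<omega>))
      = (\<lambda>\<omega>. if \<zeta> t \<omega> then grad_gap (iter t \<omega>) else grad_gap (anchor t \<omega>))"
    by (auto simp: state_Suc)
  note coin_choice_expectation[of "\<lambda>\<omega>. grad_gap (iter t \<omega>)" t "\<lambda>\<omega>. grad_gap (anchor t \<omega>)"]
  then show "integrable M (\<lambda>\<omega>. grad_gap (anchor (Suc t) \<omega>))"
    "(LINT \<omega>|M. grad_gap (anchor (Suc t) \<omega>))
      = \<theta> * (LINT \<omega>|M. grad_gap (iter t \<omega>)) + (1 - \<theta>) * (LINT \<omega>|M. grad_gap (anchor t \<omega>))"
    unfolding eq using assms by simp_all
qed

text \<open>The noise at the anchor is the fresh noise of an earlier iteration, and whether it is replaced does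
  not depend on its value.\<close>

lemma anchor_noise_step:
  assumes "integrable M (anchor_noise t)" "(LINT \<omega>|M. anchor_noise t \<omega>) \<le> m * \<sigma>\<^sup>2"
  shows "integrable M (anchor_noise (Suc t))" "(LINT \<omega>|M. anchor_noise (Suc t) \<omega>) \<le> m * \<sigma>\<^sup>2"
proof -
  note [measurable] = known_mono[OF state_known(1) past_Suc(3)] known_mono[OF state_known(2) past_Suc(3)]
    state_known(4) fresh_grad_known
  have K: "fresh_noise t \<in> borel_measurable (known (present t))"
    "anchor_noise t \<in> borel_measurable (known (present t))"
    unfolding fresh_noise_def[abs_def] anchor_noise_def[abs_def] by measurable
  have eq: "anchor_noise (Suc t) = (\<lambda>\<omega>. if \<zeta> t \<omega> then fresh_noise t \<omega> else anchor_noise t \<omega>)"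
    by (auto simp: anchor_noise_def fresh_noise_def state_Suc)
  note coin = coin_choice_expectation[OF K(1) fresh_noise_integrable K(2) assms(1)]
  show "integrable M (anchor_noise (Suc t))"
    unfolding eq by (rule coin)
  have "(LINT \<omega>|M. anchor_noise (Suc t) \<omega>)
      = \<theta> * (LINT \<omega>|M. fresh_noise t \<omega>) + (1 - \<theta>) * (LINT \<omega>|M. anchor_noise t \<omega>)"
    unfolding eq by (rule coin)
  also have "\<dots> \<le> \<theta> * (m * \<sigma>\<^sup>2) + (1 - \<theta>) * (m * \<sigma>\<^sup>2)"
    using theta_pos theta_le_1 assms(2) fresh_noise_le by (intro add_mono mult_left_mono) auto
  finally show "(LINT \<omega>|M. anchor_noise (Suc t) \<omega>) \<le> m * \<sigma>\<^sup>2"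
    by (simp add: algebra_simps)
qed

lemma state_square_integrable:
  "integrable M (opt_err t) \<and> integrable M (cons_err t) \<and> integrable M (track_err t)
    \<and> integrable M (\<lambda>\<omega>. grad_gap (anchor t \<omega>)) \<and> integrable M (anchor_noise t)
    \<and> (LINT \<omega>|M. anchor_noise t \<omega>) \<le> m * \<sigma>\<^sup>2"
proof (induction t)
  case 0
  have noise: "anchor_noise 0 = fresh_noise 0"
    by (auto simp: anchor_noise_def fresh_noise_def state_0)
  have "integrable M (track_err 0)"
  proof (rule integrable_nonneg_bound)
    let ?g = "grad_rows gf (vec x0)"
    show "integrable M (\<lambda>\<omega>. 2 * fresh_noise 0 \<omega> + 2 * (norm ?g)\<^sup>2)"
      using fresh_noise_integrable by simp
    show "track_err 0 \<omega> \<le> 2 * fresh_noise 0 \<omega> + 2 * (norm ?g)\<^sup>2" for \<omega>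
      using order_trans[OF norm_sq_centering_le norm_sq_add_le[of "fresh_grad 0 \<omega> - ?g" ?g]]
      by (simp add: track_err_def fresh_noise_def state_0)
  qed (auto simp: track_err_def)
  then show ?case
    using fresh_noise_integrable fresh_noise_le
    by (simp add: noise opt_err_def[abs_def] cons_err_def[abs_def] state_0)
next
  case (Suc t)
  then have S: "integrable M (opt_err t)" "integrable M (cons_err t)" "integrable M (track_err t)"
    "integrable M (\<lambda>\<omega>. grad_gap (anchor t \<omega>))" "integrable M (anchor_noise t)"
    "(LINT \<omega>|M. anchor_noise t \<omega>) \<le> m * \<sigma>\<^sup>2" by auto
  note gap = iter_grad_gap_integrable(1)[OF S(1,2)]
  note inc = increment_second_moment(1)[OF gap S(4-6)]
  show ?case
    using opt_err_step(1)[OF S(1,2)] cons_err_step(1)[OF S(2,3) inc] track_err_step(1)[OF S(3) inc]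
      anchor_gap_step(1)[OF gap S(4)] anchor_noise_step[OF S(5,6)] by blast
qed

text \<open>The expected Lyapunov function, with weight \<open>\<kappa>\<close> on the part \<open>\<Psi>\<close> that measures
  disagreement and staleness.\<close>

definition expected_lyapunov :: "real \<Rightarrow> nat \<Rightarrow> real" where
  "expected_lyapunov \<kappa> t = (LINT \<omega>|M. opt_err t \<omega>) + \<kappa> * ((LINT \<omega>|M. cons_err t \<omega>)
      + 4 * (\<eta> t)\<^sup>2 / \<theta>\<^sup>2 * (LINT \<omega>|M. track_err t \<omega>)
      + 2 * \<eta> t / (L * \<theta>) * (LINT \<omega>|M. grad_gap (anchor t \<omega>)))"

lemma expected_lyapunov_eq:
  "(LINT \<omega>|M. (norm (row_mean (xvar (state t \<omega>)) - xstar))\<^sup>2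
      + \<kappa> * lyapunov gf xstar L \<theta> (\<eta> t) (state t \<omega>)) = expected_lyapunov \<kappa> t"
proof -
  have "(norm (row_mean (xvar (state t \<omega>)) - xstar))\<^sup>2 + \<kappa> * lyapunov gf xstar L \<theta> (\<eta> t) (state t \<omega>)
      = opt_err t \<omega> + \<kappa> * (cons_err t \<omega> + 4 * (\<eta> t)\<^sup>2 / \<theta>\<^sup>2 * track_err t \<omega>
          + 2 * \<eta> t / (L * \<theta>) * grad_gap (anchor t \<omega>))" for \<omega>
    by (simp add: lyapunov_def opt_err_def cons_err_def track_err_def grad_gap_def iter_def
        tracker_def anchor_def)
  then show ?thesis
    using state_square_integrable[of t] by (simp add: expected_lyapunov_def)
qed

lemma errors_nonneg: "0 \<le> (LINT \<omega>|M. opt_err t \<omega>)" "0 \<le> (LINT \<omega>|M. cons_err t \<omega>)"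
  "0 \<le> (LINT \<omega>|M. track_err t \<omega>)" "0 \<le> (LINT \<omega>|M. grad_gap (iter t \<omega>))"
  "0 \<le> (LINT \<omega>|M. grad_gap (anchor t \<omega>))" "0 \<le> (LINT \<omega>|M. obj_gap t \<omega>)"
  by (auto intro!: Bochner_Integration.integral_nonneg obj_gap_bounds
      simp: opt_err_def cons_err_def track_err_def grad_gap_def)

lemma expected_lyapunov_nonneg: "0 \<le> \<kappa> \<Longrightarrow> 0 \<le> expected_lyapunov \<kappa> t"
  unfolding expected_lyapunov_def using errors_nonneg L_pos theta_pos less_imp_le[OF step_pos]
  by (intro add_nonneg_nonneg mult_nonneg_nonneg divide_nonneg_nonneg) auto

lemma expected_lyapunov_mono: "\<kappa> \<le> \<kappa>' \<Longrightarrow> expected_lyapunov \<kappa> t \<le> expected_lyapunov \<kappa>' t"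
  unfolding expected_lyapunov_def using errors_nonneg L_pos theta_pos less_imp_le[OF step_pos]
  by (intro add_left_mono mult_right_mono add_nonneg_nonneg mult_nonneg_nonneg divide_nonneg_nonneg) auto

lemma expected_lyapunov_step:
  assumes "\<eta> t * L \<le> \<theta> / 192" "\<eta> (Suc t) \<le> \<eta> t" "0 \<le> \<kappa>'" "\<kappa>' \<le> \<kappa>" "3 * \<eta> t * L / \<theta> \<le> \<kappa> * m"
  shows "expected_lyapunov \<kappa>' (Suc t)
    \<le> (1 - \<eta> t * \<mu> / 2) * expected_lyapunov \<kappa> t
      - (19 / 10 - 9 * (\<kappa> * m)) * \<eta> t * (LINT \<omega>|M. obj_gap t \<omega>)
      + (\<eta> t)\<^sup>2 * (\<sigma>\<^sup>2 / m) + 80 * \<kappa> * (\<eta> t)\<^sup>2 * (m * \<sigma>\<^sup>2) / \<theta>"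
proof -
  from state_square_integrable[of t] have S: "integrable M (opt_err t)" "integrable M (cons_err t)"
    "integrable M (track_err t)" "integrable M (\<lambda>\<omega>. grad_gap (anchor t \<omega>))"
    "integrable M (anchor_noise t)" "(LINT \<omega>|M. anchor_noise t \<omega>) \<le> m * \<sigma>\<^sup>2" by auto
  note gap = iter_grad_gap_integrable[OF S(1,2)]
  note inc = increment_second_moment[OF gap(1) S(4-6)]
  show ?thesis
    unfolding expected_lyapunov_def
    by (rule lyapunov_step[OF theta_pos theta_le_1 mu_pos mu_le_L m_ge_1 step_pos assms(1)
          errors_nonneg(1,2,3,5,4,6) zero_le_power2 errors_nonneg(2,3,5)
          opt_err_step(2)[OF S(1,2)] cons_err_step(2)[OF S(2,3) inc(1)]
          track_err_step(2)[OF S(3) inc(1)] eq_refl[OF anchor_gap_step(2)[OF gap(1) S(4)]]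
          inc(2) gap(2) assms(5) step_pos assms(2-4)])
qed

text \<open>For the weight \<open>1 / (8 * m)\<close> the decrease of the objective still has a nonnegative coefficient and can be
  dropped.\<close>

lemma linear_convergence:
  assumes "\<sigma>\<^sup>2 = 0" and \<eta>: "\<And>t. \<eta> t = \<theta> / (2^6 * 3 * L)"
  shows "expected_lyapunov (1 / (8 * m)) T
    \<le> exp (- (1 / (2^7 * 3)) * (\<theta> * \<mu> / L) * real T) * expected_lyapunov (1 / (8 * m)) 0"
proof -
  have \<eta>L: "\<eta> t * L = \<theta> / 192" for t
    using L_pos by (simp add: \<eta>)
  have c: "\<eta> t * \<mu> / 2 = (1 / (2^7 * 3)) * (\<theta> * \<mu> / L)" for t
    by (simp add: \<eta>)
  have "expected_lyapunov (1 / (8 * m)) T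
      \<le> exp (- ((1 / (2^7 * 3)) * (\<theta> * \<mu> / L)) * real T) * expected_lyapunov (1 / (8 * m)) 0"
  proof (rule geometric_recursion)
    fix t
    show "0 \<le> expected_lyapunov (1 / (8 * m)) t"
      using m_ge_1 by (intro expected_lyapunov_nonneg) simp
    have "expected_lyapunov (1 / (8 * m)) (Suc t)
        \<le> (1 - \<eta> t * \<mu> / 2) * expected_lyapunov (1 / (8 * m)) t
          - (19 / 10 - 9 * (1 / (8 * m) * m)) * \<eta> t * (LINT \<omega>|M. obj_gap t \<omega>)
          + (\<eta> t)\<^sup>2 * (\<sigma>\<^sup>2 / m) + 80 * (1 / (8 * m)) * (\<eta> t)\<^sup>2 * (m * \<sigma>\<^sup>2) / \<theta>"
    proof (rule expected_lyapunov_step)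
      have "3 * \<eta> t * L / \<theta> = 3 / 192"
        using \<eta>L[of t] theta_pos by (simp add: mult.assoc)
      then show "3 * \<eta> t * L / \<theta> \<le> 1 / (8 * m) * m"
        using m_ge_1 by simp
    qed (use m_ge_1 \<eta>L \<eta> in auto)
    also have "\<dots> \<le> (1 - \<eta> t * \<mu> / 2) * expected_lyapunov (1 / (8 * m)) t"
      using assms(1) m_ge_1 errors_nonneg(6)[of t] step_pos[of t] by simp
    finally show "expected_lyapunov (1 / (8 * m)) (Suc t)
        \<le> (1 - (1 / (2^7 * 3)) * (\<theta> * \<mu> / L)) * expected_lyapunov (1 / (8 * m)) t"
      by (simp only: c)
  qed
  then show ?thesis by simp
qed

lemma expected_objective: "(LINT \<omega>|M. F (row_mean (iter t \<omega>))) - F xstar = (LINT \<omega>|M. obj_gap t \<omega>)"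
proof -
  have "F (row_mean (iter t \<omega>)) = obj_gap t \<omega> + F xstar" for \<omega>
    by (simp add: obj_gap_def)
  moreover have "integrable M (obj_gap t)"
    using state_square_integrable by (intro obj_gap_integrable) blast
  ultimately show ?thesis
    by (simp add: prob_space)
qed

text \<open>The weight of \<open>\<Psi>\<close> decreases with the step size; a constant weight would leave a noise term
  \<open>\<eta>\<^sup>2 * \<sigma>\<^sup>2 / \<theta>\<close>, which is not divided by the number of agents. At time \<open>0\<close> the weight
  is below \<open>1 / (8 * m)\<close>, so the initial value is at most the one of the statement.\<close>

lemma sublinear_convergence:
  fixes \<beta> :: real and wt :: "nat \<Rightarrow> real"
  assumes \<beta>: "\<beta> = \<theta> / (2^7 * 3^2)" and \<eta>: "\<And>t. \<eta> t = 6 * \<beta> / (L + \<beta> * \<mu> * real t)"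
    and wt: "\<And>t. wt t = \<eta> t / \<eta> 0 * exp (\<mu> / 2 * (\<Sum>i\<le>t. \<eta> i))" and T: "1 \<le> T"
  shows "1 / (\<Sum>t\<le>T. wt t) * (\<Sum>t\<le>T. wt t * (LINT \<omega>|M. obj_gap t \<omega>))
    \<le> 24 * (L + \<beta> * \<mu> * (real T + 1))\<^sup>2 / (\<beta>\<^sup>2 * \<mu>^3 * real T^3) * (\<sigma>\<^sup>2 / m)
      + 2^8 * 3^5 * L / (\<mu>\<^sup>2 * \<theta>\<^sup>2) * (\<sigma>\<^sup>2 / (real T)\<^sup>2)
      + 2^24 * 3^6 * L^3 / (\<theta>^3 * \<mu>\<^sup>2) * (1 / real T^3) * expected_lyapunov (1 / (8 * m)) 0"
proof -
  define \<kappa> where "\<kappa> t = 3 * \<eta> t * L / (\<theta> * m)" for t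
  have \<beta>0: "0 < \<beta>" using theta_pos by (simp add: \<beta>)
  have antimono: "\<eta> t \<le> \<eta> s" if "s \<le> t" for s t
    unfolding \<eta> using \<beta>0 mu_pos L_pos that
    by (intro divide_left_mono add_left_mono mult_left_mono mult_pos_pos add_pos_nonneg) auto
  have "\<eta> 0 * L = \<theta> / 192"
    using L_pos by (simp add: \<eta> \<beta>)
  then have \<eta>L: "\<eta> t * L \<le> \<theta> / 192" for t
    using antimono[of 0 t] L_pos by (metis le0 less_imp_le mult_right_mono)
  have \<kappa>m: "\<kappa> t * m = 3 * \<eta> t * L / \<theta>" for t
    using m_ge_1 by (simp add: \<kappa>_def)
  have \<kappa>m_le: "\<kappa> t * m \<le> 1 / 64" for t
    using \<eta>L[of t] theta_pos unfolding \<kappa>m by (simp add: field_simps)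
  have \<kappa>0: "0 \<le> \<kappa> t" for t
    using step_pos[of t] L_pos theta_pos m_ge_1 by (simp add: \<kappa>_def)
  have \<kappa>_mono: "\<kappa> (Suc t) \<le> \<kappa> t" for t
    using antimono[of t "Suc t"] L_pos theta_pos m_ge_1 unfolding \<kappa>_def
    by (intro divide_right_mono mult_right_mono mult_left_mono) auto
  let ?R = "expected_lyapunov (1 / (8 * m)) 0"
  have "(\<Sum>t\<le>T. exp (\<mu> / 2 * (\<Sum>i\<le>t. \<eta> i)) * (17 / 10 * \<eta> t * (LINT \<omega>|M. obj_gap t \<omega>)))
      \<le> expected_lyapunov (\<kappa> 0) 0 + (\<Sum>t\<le>T. exp (\<mu> / 2 * (\<Sum>i\<le>t. \<eta> i))
          * (\<eta> t ^ 2 * (\<sigma>\<^sup>2 / m) + 240 * \<eta> t ^ 3 * L * \<sigma>\<^sup>2 / \<theta>\<^sup>2))"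
  proof (rule weighted_recursion)
    fix t
    show "0 \<le> expected_lyapunov (\<kappa> t) t"
      by (rule expected_lyapunov_nonneg[OF \<kappa>0])
    have "expected_lyapunov (\<kappa> (Suc t)) (Suc t)
        \<le> (1 - \<eta> t * \<mu> / 2) * expected_lyapunov (\<kappa> t) t
          - (19 / 10 - 9 * (\<kappa> t * m)) * \<eta> t * (LINT \<omega>|M. obj_gap t \<omega>)
          + (\<eta> t)\<^sup>2 * (\<sigma>\<^sup>2 / m) + 80 * \<kappa> t * (\<eta> t)\<^sup>2 * (m * \<sigma>\<^sup>2) / \<theta>"
      by (rule expected_lyapunov_step[OF \<eta>L antimono \<kappa>0 \<kappa>_mono]) (simp_all add: \<kappa>m)
    moreover have "17 / 10 * \<eta> t * (LINT \<omega>|M. obj_gap t \<omega>)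
        \<le> (19 / 10 - 9 * (\<kappa> t * m)) * \<eta> t * (LINT \<omega>|M. obj_gap t \<omega>)"
    proof (intro mult_right_mono)
      show "17 / 10 \<le> 19 / 10 - 9 * (\<kappa> t * m)"
        using \<kappa>m_le[of t] by linarith
    qed (use step_pos[of t] errors_nonneg(6)[of t] in auto)
    moreover have "80 * \<kappa> t * (\<eta> t)\<^sup>2 * (m * \<sigma>\<^sup>2) / \<theta> = 240 * \<eta> t ^ 3 * L * \<sigma>\<^sup>2 / \<theta>\<^sup>2"
      using m_ge_1 by (simp add: \<kappa>_def power2_eq_square power3_eq_cube)
    ultimately show "expected_lyapunov (\<kappa> (Suc t)) (Suc t)
        \<le> (1 - \<eta> t * \<mu> / 2) * expected_lyapunov (\<kappa> t) t
          - 17 / 10 * \<eta> t * (LINT \<omega>|M. obj_gap t \<omega>)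
          + ((\<eta> t)\<^sup>2 * (\<sigma>\<^sup>2 / m) + 240 * \<eta> t ^ 3 * L * \<sigma>\<^sup>2 / \<theta>\<^sup>2)"
      by linarith
  qed
  also have "expected_lyapunov (\<kappa> 0) 0 \<le> ?R"
    using \<kappa>m_le[of 0] m_ge_1 by (intro expected_lyapunov_mono) (simp add: field_simps)
  finally have rec: "(\<Sum>t\<le>T. exp (\<mu> / 2 * (\<Sum>i\<le>t. \<eta> i)) * (17 / 10 * \<eta> t * (LINT \<omega>|M. obj_gap t \<omega>)))
      \<le> ?R + (\<Sum>t\<le>T. exp (\<mu> / 2 * (\<Sum>i\<le>t. \<eta> i))
          * (\<eta> t ^ 2 * (\<sigma>\<^sup>2 / m) + 240 * \<eta> t ^ 3 * L * \<sigma>\<^sup>2 / \<theta>\<^sup>2))"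
    by simp
  have "0 \<le> ?R"
    using m_ge_1 by (intro expected_lyapunov_nonneg) simp
  from weighted_average_bound[OF theta_pos theta_le_1 mu_pos mu_le_L m_ge_1 zero_le_power2 this T
      \<eta>[unfolded \<beta>] wt rec]
  show ?thesis
    unfolding \<beta> .
qed

end

theorem theorem1:
  fixes M :: "'w measure"
    and D :: "'m::finite \<Rightarrow> 's measure"
    and fs :: "'m \<Rightarrow> real^'d::finite \<Rightarrow> 's \<Rightarrow> real"
    and gs :: "'m \<Rightarrow> real^'d \<Rightarrow> 's \<Rightarrow> real^'d"
    and f :: "'m \<Rightarrow> real^'d \<Rightarrow> real"
    and gf :: "'m \<Rightarrow> real^'d \<Rightarrow> real^'d"
    and F :: "real^'d \<Rightarrow> real"
    and xstar x0 :: "real^'d"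
    and \<sigma> \<mu> L \<theta> p \<beta> m :: real
    and MW :: "(real^'m^'m) measure"
    and \<xi> :: "nat \<Rightarrow> 'm \<Rightarrow> 'w \<Rightarrow> 's"
    and \<zeta> :: "nat \<Rightarrow> 'w \<Rightarrow> bool"
    and W :: "nat \<Rightarrow> 'w \<Rightarrow> real^'m^'m"
    and \<eta> wt S :: "nat \<Rightarrow> real"
    and st :: "nat \<Rightarrow> 'w \<Rightarrow> ('m, 'd) ss_state"
    and xbar :: "nat \<Rightarrow> 'w \<Rightarrow> real^'d"
    and \<Psi> :: "nat \<Rightarrow> 'w \<Rightarrow> real"
  assumes m_def: "m = real CARD('m)"
    and objective: "stochastic_objective D fs gs f gf"
    and F_def: "F = average_objective f"
    and minimizer: "is_arg_min F (\<lambda>_. True) xstar"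
    and A1: "bounded_noise D gs gf \<sigma>"
    and mu_pos: "\<mu> > 0"
    and A2: "\<And>i. strongly_convex_smooth \<mu> L (f i) (gf i)"
    and A3_law: "mixing_law MW"
    and A3_theta: "\<theta> = 1 - sqrt (second_eigenvalue (LINT A|MW. transpose A ** A))"
    and A3_range: "0 < \<theta>" "\<theta> \<le> 1"
    and A3_contraction: "\<And>x :: real^'d^'m.
          (LINT A|MW. (norm (A ** x - vec (row_mean x)))\<^sup>2) \<le> (1 - \<theta>)\<^sup>2 * (norm (x - vec (row_mean x)))\<^sup>2"
    and prob: "prob_space M"
    and draws: "independent_draws M D MW p \<xi> \<zeta> W"
    and p_theta: "p = \<theta>"
    and step_pos: "\<And>t. \<eta> t > 0"
    and st_def: "\<And>t \<omega>. st t \<omega> =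
          ss_dsgt gs \<eta> x0 (\<lambda>k. W k \<omega>) (\<lambda>k. \<zeta> k \<omega>) (\<lambda>k i. \<xi> k i \<omega>) t"
    and xbar_def: "\<And>t \<omega>. xbar t \<omega> = row_mean (xvar (st t \<omega>))"
    and Psi_def: "\<And>t \<omega>. \<Psi> t \<omega> = lyapunov gf xstar L \<theta> (\<eta> t) (st t \<omega>)"
    and beta_def: "\<beta> = \<theta> / (2^7 * 3^2)"
    and wt_def: "\<And>t. wt t = \<eta> t / \<eta> 0 * exp (\<mu> / 2 * (\<Sum>i\<le>t. \<eta> i))"
    and S_def: "\<And>T. S T = (\<Sum>t\<le>T. wt t)"
  shows "(\<sigma>\<^sup>2 = 0 \<and> (\<forall>t. \<eta> t = \<theta> / (2^6 * 3 * L)) \<longrightarrow>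
            (\<forall>T. (LINT \<omega>|M. (norm (xbar T \<omega> - xstar))\<^sup>2 + 1 / (8 * m) * \<Psi> T \<omega>)
                 \<le> exp (- (1 / (2^7 * 3)) * (\<theta> * \<mu> / L) * real T)
                   * (LINT \<omega>|M. (norm (xbar 0 \<omega> - xstar))\<^sup>2 + 1 / (8 * m) * \<Psi> 0 \<omega>)))
       \<and> (\<sigma>\<^sup>2 > 0 \<and> (\<forall>t. \<eta> t = 6 * \<beta> / (L + \<beta> * \<mu> * real t)) \<longrightarrow>
            (\<forall>T\<ge>1. 1 / S T * (\<Sum>t\<le>T. wt t * ((LINT \<omega>|M. F (xbar t \<omega>)) - F xstar))
                 \<le> 24 * (L + \<beta> * \<mu> * (real T + 1))\<^sup>2 / (\<beta>\<^sup>2 * \<mu>^3 * real T^3) * (\<sigma>\<^sup>2 / m)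
                   + 2^8 * 3^5 * L / (\<mu>\<^sup>2 * \<theta>\<^sup>2) * (\<sigma>\<^sup>2 / (real T)\<^sup>2)
                   + 2^24 * 3^6 * L^3 / (\<theta>^3 * \<mu>\<^sup>2) * (1 / real T^3)
                     * (LINT \<omega>|M. (norm (xbar 0 \<omega> - xstar))\<^sup>2 + \<Psi> 0 \<omega> / (8 * m))))"
proof -
  interpret ss_dsgt_process M f gf \<mu> L xstar m D fs gs \<sigma> \<theta> MW \<xi> \<zeta> W \<eta> x0
  proof (intro ss_dsgt_process.intro strongly_convex_agents.intro ss_dsgt_process_axioms.intro)
    show "is_arg_min (average_objective f) (\<lambda>_. True) xstar"
      using minimizer unfolding F_def .
    show "independent_draws M D MW \<theta> \<xi> \<zeta> W"
      using draws unfolding p_theta .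
  qed (rule m_def objective A1 mu_pos A2 A3_law A3_range A3_contraction prob step_pos)+
  have st: "st t \<omega> = state t \<omega>" for t \<omega>
    by (simp add: st_def state_def)
  have lyap: "(LINT \<omega>|M. (norm (xbar t \<omega> - xstar))\<^sup>2 + 1 / (8 * m) * \<Psi> t \<omega>)
      = expected_lyapunov (1 / (8 * m)) t" for t
    unfolding xbar_def Psi_def st by (rule expected_lyapunov_eq)
  then have lyap': "(LINT \<omega>|M. (norm (xbar t \<omega> - xstar))\<^sup>2 + \<Psi> t \<omega> / (8 * m))
      = expected_lyapunov (1 / (8 * m)) t" for t
    by simp
  have gap: "(LINT \<omega>|M. F (xbar t \<omega>)) - F xstar = (LINT \<omega>|M. obj_gap t \<omega>)" for t
    using expected_objective[of t] by (simp add: F_def xbar_def st iter_def)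
  show ?thesis
    unfolding lyap lyap' gap S_def
    using linear_convergence sublinear_convergence[OF beta_def _ wt_def] by blast
qed

end
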